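(* Let $\Omega\subset\mathbb{R}^m$ be a bounded open set, $A\in\mathbb{R}^{n\times n}$ and $B\in L^\infty(\Omega)^{n\times n}$. Assume there exists $\alpha>0$ such that $\zeta^\top A\zeta\ge\alpha\|\zeta\|^2$ for every $\zeta\in\mathbb{R}^n$. Let $\Omega_1,\dots,\Omega_N\subset\mathbb{R}^m$ be pairwise disjoint Lebesgue measurable sets with $\Omega=\bigcup_{k=1}^N\Omega_k$, and for every $k=1,\dots,N$ let $B_k\in\mathbb{R}^{n\times n}$ and $\rho_k>0$ satisfy $$\|B(x)-B_k\|\le\rho_k\qquad\text{for a.e. }x\in\Omega_k .$$ Let $c>0$ be a constant such that $\|f\|_{L^2(\Omega)}\le c\|\nabla f\|_{L^2(\Omega)^m}$ for all $f\in H^1_0(\Omega)$ (Poincaré–Friedrichs inequality). If there exist a positive definite matrix $P\in\mathbb{R}^{n\times n}$, a positive definite diagonal matrix $\Lambda\in\mathbb{R}^{n\times n}$, and positive scalars $\sigma_1,\dots,\sigma_N$ such that $$\begin{bmatrix}\Lambda-\sigma_kI_n-B_k^\top P-PB_k & \rho_kP\\ \rho_k P&\sigma_kI_n\end{bmatrix}\succ0\quad\text{for all }k=1,\dots,N,\qquad\text{and}\qquad A^\top P+PA-c^2\Lambda\succeq0,$$ then the coupled parabolic system $$\partial_tz=A\Delta z+B(x)z\ \text{ in }\Omega\times(0,T],\qquad z=0\ \text{ on }\partial\Omega\times(0,T],\qquad z(\cdot,0)=z^0\ \text{ in }\Omega$$ is exponentially stable.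
   Context: Notation: $\|\cdot\|$ is the Euclidean norm of vectors and the induced norm of matrices. $P\succ0$ (resp. $\succeq0$) means $P$ is symmetric and positive definite (resp. positive semidefinite); positive definite matrices are symmetric. $\otimes$ is the Kronecker product. $\Delta$ is the Laplacian acting componentwise on $\mathbb{R}^n$-valued functions. For $z=(z_1,\dots,z_n)^\top\in H^1(\Omega)^n$, $\nabla z$ is the $\mathbb{R}^{mn}$-valued function obtained by stacking the column vectors $\nabla z_1,\dots,\nabla z_n$. $(\cdot,\cdot)_{L^2}$ is the inner product $(f,g)_{L^2}=\int_\Omega f^\top g\,dx$. $H^1_0(\Omega)^n$ is the closure of $C_0^\infty(\Omega)^n$ in $H^1(\Omega)^n$, $H^{-1}(\Omega)^n$ is its dual, and $\langle\cdot,\cdot\rangle$ is the duality pairing between $H^{-1}(\Omega)^n$ and $H^1_0(\Omega)^n$. Weak solution: for $T>0$ and $z^0\in L^2(\Omega)^n$, a function $z\in L^2(0,T;H^1_0(\Omega)^n)$ with $\frac{dz}{dt}\in L^2(0,T;H^{-1}(\Omega)^n)$ is a weak solution of the system with initial data $z^0$ if (1) for every $v\in H^1_0(\Omega)^n$ and a.e. $t\in[0,T]$, $\langle\frac{dz}{dt}(t),v\rangle=-((A\otimes I_m)\nabla z(t),\nabla v)_{L^2}+(Bz(t),v)_{L^2}$; and (2) $z(0)=z^0$. (Such $z$ belongs to $C([0,T];L^2(\Omega)^n)$, so (2) makes sense. Under the coercivity assumption on $A$, for every $z^0\in L^2(\Omega)^n$ a weak solution exists and is unique.) Exponential stability: the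 system is exponentially stable if there exist $M\ge1$ and $\gamma>0$ such that for each $T>0$ the weak solution satisfies $\|z(t)\|_{L^2}\le Me^{-\gamma t}\|z^0\|_{L^2}$ for all $z^0\in L^2(\Omega)^n$ and all $t\in[0,T]$. *)

theory Defs
  imports "HOL-Analysis.Analysis"
begin

definition pos_def :: "real^'n^'n \<Rightarrow> bool" where
  "pos_def M \<longleftrightarrow> transpose M = M \<and> (\<forall>x. x \<noteq> 0 \<longrightarrow> x \<bullet> (M *v x) > 0)"

definition pos_semidef :: "real^'n^'n \<Rightarrow> bool" where
  "pos_semidef M \<longleftrightarrow> transpose M = M \<and> (\<forall>x. x \<bullet> (M *v x) \<ge> 0)"

definition diagonal_matrix :: "real^'n^'n \<Rightarrow> bool" where
  "diagonal_matrix M \<longleftrightarrow> (\<forall>i j. i \<noteq> j \<longrightarrow> M $ i $ j = 0)"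

definition kronecker :: "real^'n^'n \<Rightarrow> real^'m^'m \<Rightarrow> real^('n \<times> 'm)^('n \<times> 'm)" where
  "kronecker A C = (\<chi> p q. A $ fst p $ fst q * C $ snd p $ snd q)"

definition block_matrix ::
  "real^'n^'n \<Rightarrow> real^'n^'n \<Rightarrow> real^'n^'n \<Rightarrow> real^'n^'n \<Rightarrow> real^('n + 'n)^('n + 'n)" where
  "block_matrix M11 M12 M21 M22 = (\<chi> p q.
     case p of
       Inl i \<Rightarrow> (case q of Inl j \<Rightarrow> M11 $ i $ j | Inr j \<Rightarrow> M12 $ i $ j)
     | Inr i \<Rightarrow> (case q of Inl j \<Rightarrow> M21 $ i $ j | Inr j \<Rightarrow> M22 $ i $ j))"

definition matrix_norm :: "real^'n^'m \<Rightarrow> real" where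
  "matrix_norm M = onorm (\<lambda>v. M *v v)"

text \<open>
  Elements of function spaces over \<open>\<Omega>\<close> are represented by total functions; values outside
  \<open>\<Omega>\<close> are irrelevant and equality means equality almost everywhere on \<open>\<Omega>\<close>.
\<close>

definition L2 :: "(real^'m) set \<Rightarrow> (real^'m \<Rightarrow> 'b::euclidean_space) set" where
  "L2 \<Omega> = {f. f \<in> borel_measurable (lebesgue_on \<Omega>) \<and>
              integrable (lebesgue_on \<Omega>) (\<lambda>x. (norm (f x))\<^sup>2)}"

definition L2_inner ::
  "(real^'m) set \<Rightarrow> (real^'m \<Rightarrow> 'b::euclidean_space) \<Rightarrow> (real^'m \<Rightarrow> 'b) \<Rightarrow> real" where
  "L2_inner \<Omega> f g = (LINT x|lebesgue_on \<Omega>. f x \<bullet> g x)"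

definition L2_norm :: "(real^'m) set \<Rightarrow> (real^'m \<Rightarrow> 'b::euclidean_space) \<Rightarrow> real" where
  "L2_norm \<Omega> f = sqrt (L2_inner \<Omega> f f)"

definition Linf_matrix :: "(real^'m) set \<Rightarrow> (real^'m \<Rightarrow> real^'n^'n) set" where
  "Linf_matrix \<Omega> = {B. \<forall>i j. (\<lambda>x. B x $ i $ j) \<in> borel_measurable (lebesgue_on \<Omega>) \<and>
                          (\<exists>C. AE x in lebesgue_on \<Omega>. \<bar>B x $ i $ j\<bar> \<le> C)}"

primrec C_k :: "nat \<Rightarrow> ('a::euclidean_space \<Rightarrow> real) \<Rightarrow> bool" where
  "C_k 0 = (\<lambda>f. continuous_on UNIV f)"
| "C_k (Suc k) = (\<lambda>f. \<exists>D. (\<forall>x. (f has_derivative D x) (at x)) \<and>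
                          (\<forall>b\<in>Basis. C_k k (\<lambda>x. D x b)))"

text \<open>A test function on \<open>\<Omega>\<close> is identified with its extension by zero.\<close>

definition test_functions :: "'a::euclidean_space set \<Rightarrow> ('a \<Rightarrow> real) set" where
  "test_functions \<Omega> = {\<phi>. (\<forall>k. C_k k \<phi>) \<and>
                          (\<exists>K. compact K \<and> K \<subseteq> \<Omega> \<and> (\<forall>x. x \<notin> K \<longrightarrow> \<phi> x = 0))}"

definition partial_deriv :: "'m \<Rightarrow> (real^'m \<Rightarrow> real) \<Rightarrow> real^'m \<Rightarrow> real" where
  "partial_deriv i \<phi> x = frechet_derivative \<phi> (at x) (axis i 1)"

definition weak_gradient :: "(real^'m) set \<Rightarrow> (real^'m \<Rightarrow> real) \<Rightarrow> (real^'m \<Rightarrow> real^'m) \<Rightarrow> bool" where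
  "weak_gradient \<Omega> f g \<longleftrightarrow> (\<forall>\<phi>\<in>test_functions \<Omega>. \<forall>i.
     (LINT x|lebesgue_on \<Omega>. f x * partial_deriv i \<phi> x) = - (LINT x|lebesgue_on \<Omega>. g x $ i * \<phi> x))"

definition H1 :: "(real^'m) set \<Rightarrow> (real^'m \<Rightarrow> real) set" where
  "H1 \<Omega> = {f \<in> L2 \<Omega>. \<exists>g\<in>L2 \<Omega>. weak_gradient \<Omega> f g}"

text \<open>The choice only fixes the values of the gradient on a null set, since the weak gradient
  on an open set is unique almost everywhere.\<close>

definition grad :: "(real^'m) set \<Rightarrow> (real^'m \<Rightarrow> real) \<Rightarrow> real^'m \<Rightarrow> real^'m" where
  "grad \<Omega> f = (SOME g. g \<in> L2 \<Omega> \<and> weak_gradient \<Omega> f g)"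

definition H1_norm :: "(real^'m) set \<Rightarrow> (real^'m \<Rightarrow> real) \<Rightarrow> real" where
  "H1_norm \<Omega> f = sqrt ((L2_norm \<Omega> f)\<^sup>2 + (L2_norm \<Omega> (grad \<Omega> f))\<^sup>2)"

definition H10 :: "(real^'m) set \<Rightarrow> (real^'m \<Rightarrow> real) set" where
  "H10 \<Omega> = {f \<in> H1 \<Omega>. \<forall>\<epsilon>>0. \<exists>\<phi>\<in>test_functions \<Omega>. H1_norm \<Omega> (f - \<phi>) < \<epsilon>}"

text \<open>The stacked gradient of \<open>z\<close> has the components
  \<open>\<partial>\<^sub>k z\<^sub>i\<close>, indexed by the pairs \<open>(i, k)\<close>.\<close>

definition vH1 :: "(real^'m) set \<Rightarrow> (real^'m \<Rightarrow> real^'n) set" where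
  "vH1 \<Omega> = {z. \<forall>i. (\<lambda>x. z x $ i) \<in> H1 \<Omega>}"

definition vgrad :: "(real^'m) set \<Rightarrow> (real^'m \<Rightarrow> real^'n) \<Rightarrow> real^'m \<Rightarrow> real^('n \<times> 'm)" where
  "vgrad \<Omega> z x = (\<chi> p. grad \<Omega> (\<lambda>y. z y $ fst p) x $ snd p)"

definition vH1_norm :: "(real^'m) set \<Rightarrow> (real^'m \<Rightarrow> real^'n) \<Rightarrow> real" where
  "vH1_norm \<Omega> z = sqrt ((L2_norm \<Omega> z)\<^sup>2 + (L2_norm \<Omega> (vgrad \<Omega> z))\<^sup>2)"

definition vH10 :: "(real^'m) set \<Rightarrow> (real^'m \<Rightarrow> real^'n) set" where
  "vH10 \<Omega> = {z \<in> vH1 \<Omega>. \<forall>\<epsilon>>0. \<exists>\<phi>. (\<forall>i. (\<lambda>x. \<phi> x $ i) \<in> test_functions \<Omega>) \<and>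
                                    vH1_norm \<Omega> (z - \<phi>) < \<epsilon>}"

text \<open>The dual \<open>H\<^sup>-\<^sup>1\<close>; the duality pairing is function application. Only the values of a functional on
  \<^term>\<open>vH10 \<Omega>\<close> matter; by boundedness they respect almost-everywhere equality.\<close>

definition Hm1 :: "(real^'m) set \<Rightarrow> ((real^'m \<Rightarrow> real^'n) \<Rightarrow> real) set" where
  "Hm1 \<Omega> = {F. (\<forall>u\<in>vH10 \<Omega>. \<forall>v\<in>vH10 \<Omega>. F (\<lambda>x. u x + v x) = F u + F v) \<and>
               (\<forall>a. \<forall>u\<in>vH10 \<Omega>. F (\<lambda>x. a *\<^sub>R u x) = a * F u) \<and>
               (\<exists>C. \<forall>u\<in>vH10 \<Omega>. \<bar>F u\<bar> \<le> C * vH1_norm \<Omega> u)}"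

definition Hm1_norm :: "(real^'m) set \<Rightarrow> ((real^'m \<Rightarrow> real^'n) \<Rightarrow> real) \<Rightarrow> real" where
  "Hm1_norm \<Omega> F = (SUP v\<in>{v \<in> vH10 \<Omega>. vH1_norm \<Omega> v \<le> 1}. \<bar>F v\<bar>)"

text \<open>Since the spaces above are carrier sets with a (semi)norm and not types,
  the library's Bochner integral does not apply to functions with values in them.
  Strong measurability is stated for a carrier \<open>X\<close> with norm \<open>p\<close>: the function is almost everywhere
  the limit of \<open>X\<close>-valued simple functions.\<close>

definition strongly_measurable ::
  "'t measure \<Rightarrow> 'a::minus set \<Rightarrow> ('a \<Rightarrow> real) \<Rightarrow> ('t \<Rightarrow> 'a) \<Rightarrow> bool" where
  "strongly_measurable M X p u \<longleftrightarrow>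
     (\<exists>s. (\<forall>k::nat. simple_function M (s k) \<and> s k ` space M \<subseteq> X) \<and>
          (AE t in M. u t \<in> X \<and> (\<lambda>k. p (u t - s k t)) \<longlonglongrightarrow> 0))"

definition Bochner_L2 :: "real \<Rightarrow> 'a::minus set \<Rightarrow> ('a \<Rightarrow> real) \<Rightarrow> (real \<Rightarrow> 'a) set" where
  "Bochner_L2 T X p = {u. strongly_measurable (lebesgue_on {0<..<T}) X p u \<and>
                          integrable (lebesgue_on {0<..<T}) (\<lambda>t. (p (u t))\<^sup>2)}"

text \<open>Distributional time derivative: the identity
  \<open>\<integral> \<phi>'(t) z(t) dt = - \<integral> \<phi>(t) g(t) dt\<close> in the dual space, where \<open>z(t)\<close> acts on \<open>v\<close> by the \<open>L\<^sup>2\<close> inner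
  product, evaluated at every \<open>v\<close>; evaluation at \<open>v\<close> commutes with the Bochner integral.\<close>

definition time_derivative ::
  "(real^'m) set \<Rightarrow> real \<Rightarrow> (real \<Rightarrow> real^'m \<Rightarrow> real^'n) \<Rightarrow>
   (real \<Rightarrow> (real^'m \<Rightarrow> real^'n) \<Rightarrow> real) \<Rightarrow> bool" where
  "time_derivative \<Omega> T z g \<longleftrightarrow> (\<forall>\<phi>\<in>test_functions {0<..<T}. \<forall>v\<in>vH10 \<Omega>.
     (LINT t|lebesgue_on {0<..<T}. deriv \<phi> t * L2_inner \<Omega> (z t) v) =
       - (LINT t|lebesgue_on {0<..<T}. \<phi> t * g t v))"

text \<open>The function \<open>z\<close> is the representative that is continuous from \<open>[0, T]\<close> to \<open>L\<^sup>2\<close>; this is the one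
  to which the initial condition and pointwise-in-time bounds refer.\<close>

definition weak_solution ::
  "(real^'m) set \<Rightarrow> real^'n^'n \<Rightarrow> (real^'m \<Rightarrow> real^'n^'n) \<Rightarrow> real \<Rightarrow> (real^'m \<Rightarrow> real^'n) \<Rightarrow>
   (real \<Rightarrow> real^'m \<Rightarrow> real^'n) \<Rightarrow> bool" where
  "weak_solution \<Omega> A B T z0 z \<longleftrightarrow>
     z \<in> Bochner_L2 T (vH10 \<Omega>) (vH1_norm \<Omega>) \<and>
     (\<forall>t\<in>{0..T}. z t \<in> L2 \<Omega> \<and>
        ((\<lambda>s. L2_norm \<Omega> (z s - z t)) \<longlongrightarrow> 0) (at t within {0..T})) \<and>
     (\<exists>g\<in>Bochner_L2 T (Hm1 \<Omega>) (Hm1_norm \<Omega>).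
        time_derivative \<Omega> T z g \<and>
        (\<forall>v\<in>vH10 \<Omega>. AE t in lebesgue_on {0..T}.
           g t v = - L2_inner \<Omega> (\<lambda>x. kronecker A (mat 1 :: real^'m^'m) *v vgrad \<Omega> (z t) x) (vgrad \<Omega> v)
                   + L2_inner \<Omega> (\<lambda>x. B x *v z t x) v)) \<and>
     (AE x in lebesgue_on \<Omega>. z 0 x = z0 x)"

text \<open>The weak solution exists and is unique for coercive \<open>A\<close>; the bound is required of every
  weak solution, so that well-posedness is not part of the definition.\<close>

definition exponentially_stable ::
  "(real^'m) set \<Rightarrow> real^'n^'n \<Rightarrow> (real^'m \<Rightarrow> real^'n^'n) \<Rightarrow> bool" where
  "exponentially_stable \<Omega> A B \<longleftrightarrow>
     (\<exists>M\<ge>1. \<exists>\<gamma>>0. \<forall>T>0. \<forall>z0\<in>L2 \<Omega>. \<forall>z. weak_solution \<Omega> A B T z0 z \<longrightarrow>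
        (\<forall>t\<in>{0..T}. L2_norm \<Omega> (z t) \<le> M * exp (- \<gamma> * t) * L2_norm \<Omega> z0))"

end

(*
  Let V(t) be the integral of z(t) . P z(t). Testing the equation with P z gives formally
  V' = - 2 ((A (x) I) grad z, (P (x) I) grad z) + 2 (B z, P z). The condition on A turns the first term, with
  the Poincare inequality in each component (here the diagonality of Lambda is needed), into
  - (Lambda z, z). The block condition, evaluated at (z, - (B(x) - B_k) z / rho_k) for x in Omega_k, bounds the
  remaining quadratic form - Lambda + 2 P B(x) by - epsilon |z|^2. Hence V' <= - kappa V.

  The formal identity V' = 2 <z', P z> is replaced by an inequality for the increments of V: since P is
  positive, V(t) - V(t - h) <= 2 (z(t) - z(t - h), P z(t)), and the increment of z is the time integral of
  the bilinear form. The only other analytic inputs are the fundamental lemma of the calculus of variations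
  (weak gradients are unique, so grad is linear almost everywhere), the density of continuous functions in
  L^2(0,T; H^1_0), and the remark that averaging increments over t costs nothing as h tends to 0.
*)

theory Submission
  imports Defs
begin

text \<open>The weak form holds for each fixed \<open>v\<close> outside a null set of times that
  depends on \<open>v\<close>, so \<open>P z(t)\<close> cannot simply be inserted at time t.
  Integrating in time removes the exceptional set: \<open>solution_increment\<close> holds for all
  interior s < t, and only then is \<open>v\<close> chosen as \<open>P z(t)\<close>. The price is
  that the form is evaluated at (z(r), P z(t)) with r in [t - h, t]. Young's inequality splits the
  mismatch into \<open>\<theta>\<close> times the squared H^1 norm of z(r) and a constant over
  \<open>\<theta>\<close> times the squared distance of z(t) from z(r). \<open>\<theta>\<close> is
  fixed first and the approximation error \<open>\<mu>\<close> afterwards, so both contributions can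
  be made small. Test functions are smooth to every order, so they are constructed from exp(-1/x) in
  two shapes: box cutoffs in space, whose pointwise limits are indicators of boxes, and steps in
  time, whose derivatives are approximate identities. Since P lies between a I and b I,
  \<open>\<kappa> = \<epsilon> / b\<close> is a decay rate of the energy; taking square roots gives
  the rate \<open>\<kappa> / 2\<close> and the factor sqrt (b / a) for the norm.\<close>

section \<open>Smooth cutoff functions\<close>

lemma C_k_SucE:
  assumes "C_k (Suc k) f"
  obtains D where "\<And>x. (f has_derivative D x) (at x)" "\<And>b. b \<in> Basis \<Longrightarrow> C_k k (\<lambda>x. D x b)"
  using assms by auto

lemma C_k_Suc_imp: "C_k (Suc k) f \<Longrightarrow> C_k k f"
proof (induction k arbitrary: f)
  case 0
  then show ?case
    by (elim C_k_SucE) (metis C_k.simps(1) continuous_at_imp_continuous_on has_derivative_continuous)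
next
  case (Suc k)
  then obtain D where D: "\<And>x. (f has_derivative D x) (at x)" "\<And>b. b \<in> Basis \<Longrightarrow> C_k (Suc k) (\<lambda>x. D x b)"
    by (subst (asm) C_k.simps(2)) blast
  then show ?case
    using Suc.IH by (subst C_k.simps(2)) blast
qed

lemma C_k_imp_continuous: "C_k k f \<Longrightarrow> continuous_on UNIV f"
  by (induction k arbitrary: f) (use C_k_Suc_imp in \<open>auto simp del: C_k.simps(2)\<close>)

lemma C_k_const: "C_k k (\<lambda>x. c)"
proof (induction k arbitrary: c)
  case (Suc k)
  show ?case
    unfolding C_k.simps by (rule exI[of _ "\<lambda>x v. 0"]) (use Suc in auto)
qed auto

lemma C_k_add: "C_k k f \<Longrightarrow> C_k k g \<Longrightarrow> C_k k (\<lambda>x. f x + g x)"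
proof (induction k arbitrary: f g)
  case 0
  then show ?case by (auto intro: continuous_intros)
next
  case (Suc k)
  obtain D where D: "\<And>x. (f has_derivative D x) (at x)" "\<And>b. b \<in> Basis \<Longrightarrow> C_k k (\<lambda>x. D x b)"
    using C_k_SucE[OF Suc.prems(1)] by blast
  obtain E where E: "\<And>x. (g has_derivative E x) (at x)" "\<And>b. b \<in> Basis \<Longrightarrow> C_k k (\<lambda>x. E x b)"
    using C_k_SucE[OF Suc.prems(2)] by blast
  show ?case
    unfolding C_k.simps
    by (rule exI[of _ "\<lambda>x v. D x v + E x v"])
      (use D E Suc.IH in \<open>auto intro: has_derivative_add\<close>)
qed

lemma C_k_mult: "C_k k f \<Longrightarrow> C_k k g \<Longrightarrow> C_k k (\<lambda>x. f x * g x)"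
proof (induction k arbitrary: f g)
  case 0
  then show ?case by (auto intro: continuous_intros)
next
  case (Suc k)
  obtain D where D: "\<And>x. (f has_derivative D x) (at x)" "\<And>b. b \<in> Basis \<Longrightarrow> C_k k (\<lambda>x. D x b)"
    using C_k_SucE[OF Suc.prems(1)] by blast
  obtain E where E: "\<And>x. (g has_derivative E x) (at x)" "\<And>b. b \<in> Basis \<Longrightarrow> C_k k (\<lambda>x. E x b)"
    using C_k_SucE[OF Suc.prems(2)] by blast
  have "C_k k f" "C_k k g"
    using Suc.prems C_k_Suc_imp by blast+
  then show ?case
    unfolding C_k.simps
    by (intro exI[of _ "\<lambda>x v. f x * E x v + D x v * g x"])
      (use D E Suc.IH in \<open>auto intro!: has_derivative_mult C_k_add\<close>)
qed

lemma C_k_scale: "C_k k f \<Longrightarrow> C_k k (\<lambda>x. c * f x)"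
  by (intro C_k_mult C_k_const)

lemma C_k_diff: "C_k k f \<Longrightarrow> C_k k g \<Longrightarrow> C_k k (\<lambda>x. f x - g x)"
  using C_k_add[of k f "\<lambda>x. (-1) * g x"] C_k_scale[of k g "-1"] by simp

lemma C_k_prod: "finite I \<Longrightarrow> (\<And>i. i \<in> I \<Longrightarrow> C_k k (f i)) \<Longrightarrow> C_k k (\<lambda>x. \<Prod>i\<in>I. f i x)"
  by (induction I rule: finite_induct) (auto intro: C_k_const C_k_mult)

lemma C_k_inverse: "C_k k f \<Longrightarrow> (\<And>x. f x \<noteq> 0) \<Longrightarrow> C_k k (\<lambda>x. inverse (f x))"
proof (induction k arbitrary: f)
  case 0
  then show ?case by (auto intro: continuous_intros)
next
  case (Suc k)
  obtain D where D: "\<And>x. (f has_derivative D x) (at x)" "\<And>b. b \<in> Basis \<Longrightarrow> C_k k (\<lambda>x. D x b)"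
    using C_k_SucE[OF Suc.prems(1)] by blast
  have f: "C_k k f"
    using Suc.prems C_k_Suc_imp by blast
  have "C_k k (\<lambda>x. (-1) * (inverse (f x) * D x b * inverse (f x)))" if "b \<in> Basis" for b
    by (intro C_k_scale C_k_mult Suc.IH f D that Suc.prems)
  then show ?case
    unfolding C_k.simps
    by (intro exI[of _ "\<lambda>x v. - (inverse (f x) * D x v * inverse (f x))"])
      (use D Suc.prems in \<open>auto intro!: has_derivative_inverse\<close>)
qed

text \<open>The inner function is affine, so differentiating along b only multiplies by the constant
  b . v and leaves a composition of the same kind; the induction needs no chain rule of higher
  order. Coordinates, shifts, reflections and scalings are all obtained from it.\<close>

lemma C_k_compose_affine:
  fixes h :: "real \<Rightarrow> real" and v :: "'a::euclidean_space"
  shows "C_k k h \<Longrightarrow> C_k k (\<lambda>x. h (x \<bullet> v + d))"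
proof (induction k arbitrary: h)
  case 0
  then show ?case
    by (auto intro!: continuous_on_compose2[of UNIV h] continuous_intros)
next
  case (Suc k)
  then obtain D where D: "\<And>x. (h has_derivative D x) (at x)" "C_k k (\<lambda>x. D x 1)"
    by auto
  have "((\<lambda>x. h (x \<bullet> v + d)) has_derivative (\<lambda>u. D (x \<bullet> v + d) (u \<bullet> v))) (at x)" for x
    by (rule has_derivative_compose[OF _ D(1)]) (auto intro!: derivative_eq_intros)
  moreover have "D (x \<bullet> v + d) (b \<bullet> v) = (b \<bullet> v) * D (x \<bullet> v + d) 1" for x b
    using linear_scale[OF has_derivative_linear[OF D(1)], of "x \<bullet> v + d" "b \<bullet> v" 1] by simp
  ultimately show ?case
    unfolding C_k.simps
    by (intro exI[of _ "\<lambda>x u. D (x \<bullet> v + d) (u \<bullet> v)"])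
      (auto intro!: C_k_scale Suc.IH[OF D(2)])
qed

text \<open>For q = 1 this is the standard smooth function exp(-1/x), extended by zero to x \<le> 0.
  The polynomial factor in 1/x is carried along because the family is then closed under
  differentiation, so smoothness follows by induction for all q at once.\<close>

definition flat :: "real poly \<Rightarrow> real \<Rightarrow> real" where
  "flat q x = (if x > 0 then poly q (1/x) * exp (- (1/x)) else 0)"

lemma poly_times_exp_minus_tendsto_0: "((\<lambda>y. poly q y * exp (- y)) \<longlongrightarrow> (0::real)) at_top"
proof -
  have "((\<lambda>y. \<Sum>i\<le>degree q. coeff q i * (y ^ i / exp y)) \<longlongrightarrow> (\<Sum>i\<le>degree q. coeff q i * 0)) at_top"
    by (intro tendsto_sum tendsto_mult tendsto_const tendsto_power_div_exp_0)
  then show ?thesis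
    by (simp add: poly_altdef exp_minus sum_distrib_right sum_distrib_left divide_inverse mult_ac)
qed

lemma flat_tendsto_0: "(flat q \<longlongrightarrow> 0) (at 0)"
proof -
  have "((\<lambda>x. poly q (1/x) * exp (- (1/x))) \<longlongrightarrow> 0) (at_right 0)"
    using filterlim_compose[OF poly_times_exp_minus_tendsto_0 filterlim_inverse_at_top_right, of q]
    by (simp add: inverse_eq_divide)
  then have "(flat q \<longlongrightarrow> 0) (at_right 0)"
    by (rule Lim_transform_eventually) (auto simp: flat_def eventually_at_right_less eventually_at_filter)
  moreover have "(flat q \<longlongrightarrow> 0) (at_left 0)"
    by (rule tendsto_eventually) (auto simp: flat_def eventually_at_filter)
  ultimately show ?thesis
    by (simp add: filterlim_at_split)
qed

text \<open>Differentiating q(1/x) exp(-1/x) produces the factor 1/x^2, encoded by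
  \<open>monom 1 2\<close>, from both the polynomial and the exponential; the minus sign belongs to
  the polynomial part.\<close>

lemma has_real_derivative_flat:
  "(flat q has_real_derivative flat (monom 1 2 * (q - pderiv q)) x) (at x)"
proof -
  consider "x < 0" | "x = 0" | "x > 0"
    by linarith
  then show ?thesis
  proof cases
    case 1
    have "((\<lambda>x. 0) has_real_derivative flat (monom 1 2 * (q - pderiv q)) x) (at x)"
      using 1 by (auto simp: flat_def)
    then show ?thesis
      by (rule DERIV_cong_ev[THEN iffD1, OF refl _ refl, rotated])
        (use 1 in \<open>auto simp: flat_def intro!: eventually_mono[OF eventually_nhds_in_open[of "{..<0}"]]\<close>)
  next
    case 2
    \<comment> \<open>Dividing by h multiplies the polynomial in 1/h by its variable, so the
      difference quotient at 0 is again a member of the family and tends to 0.\<close>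
    have "flat (pCons 0 q) = (\<lambda>h. (flat q (0 + h) - flat q 0) / h)"
      by (auto simp: flat_def)
    then have "((\<lambda>h. (flat q (0 + h) - flat q 0) / h) \<longlongrightarrow> 0) (at 0)"
      using flat_tendsto_0[of "pCons 0 q"] by metis
    then show ?thesis
      using 2 by (simp add: DERIV_def flat_def)
  next
    case 3
    have "((\<lambda>x. poly q (1/x) * exp (- (1/x))) has_real_derivative
        flat (monom 1 2 * (q - pderiv q)) x) (at x)"
      using 3 by (auto intro!: derivative_eq_intros poly_DERIV[THEN DERIV_chain2]
        simp: flat_def poly_monom field_simps power2_eq_square)
    then show ?thesis
      by (rule DERIV_cong_ev[THEN iffD1, OF refl _ refl, rotated])
        (use 3 in \<open>auto simp: flat_def intro!: eventually_mono[OF eventually_nhds_in_open[of "{0<..}"]]\<close>)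
  qed
qed

lemma C_k_flat: "C_k k (flat q)"
proof (induction k arbitrary: q)
  case 0
  then show ?case
    by (auto intro!: continuous_at_imp_continuous_on DERIV_isCont[OF has_real_derivative_flat])
next
  case (Suc k)
  show ?case
    unfolding C_k.simps
    by (intro exI[of _ "\<lambda>x v. flat (monom 1 2 * (q - pderiv q)) x * v"])
      (use has_real_derivative_flat Suc in \<open>auto simp: has_field_derivative_def\<close>)
qed

lemma flat_1: "flat 1 x = (if x > 0 then exp (- (1/x)) else 0)"
  by (simp add: flat_def)

lemma flat_1_bounds: "0 \<le> flat 1 x" "flat 1 x \<le> 1"
  by (auto simp: flat_1)

text \<open>A smooth transition from 0 to 1 across [0, 1]; the denominator never vanishes because x
  and 1 - x are not both nonpositive.\<close>

definition smooth_step :: "real \<Rightarrow> real" where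
  "smooth_step x = flat 1 x * inverse (flat 1 x + flat 1 (1 - x))"

lemma flat_sum_pos: "flat 1 x + flat 1 (1 - x) > 0"
  by (auto simp: flat_1 add_pos_pos)

lemma C_k_smooth_step: "C_k k smooth_step"
proof -
  have "(\<lambda>x. flat 1 (1 - x)) = (\<lambda>x. flat 1 (x \<bullet> (-1) + 1))"
    by auto
  then have *: "C_k k (\<lambda>x. flat 1 (1 - x))"
    using C_k_compose_affine[OF C_k_flat, of k 1 "-1 :: real" 1] by metis
  show ?thesis
    unfolding smooth_step_def[abs_def]
    by (intro C_k_mult C_k_flat C_k_inverse C_k_add *) (metis flat_sum_pos less_irrefl)
qed

lemma smooth_step_le_0: "x \<le> 0 \<Longrightarrow> smooth_step x = 0"
  and smooth_step_ge_1: "x \<ge> 1 \<Longrightarrow> smooth_step x = 1"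
  by (auto simp: smooth_step_def flat_1)

lemma smooth_step_bounds: "0 \<le> smooth_step x" "smooth_step x \<le> 1"
  using flat_sum_pos[of x] flat_1_bounds[of x] flat_1_bounds[of "1 - x"]
  by (auto simp: smooth_step_def divide_simps)

text \<open>The derivative serves as the profile of an approximate identity. Its sign comes from the
  quotient rule: with f for \<open>flat 1\<close>, the numerator is f'(x) f(1 - x) + f(x) f'(1 -
  x).\<close>

lemma smooth_step_deriv_obtain:
  obtains \<rho> where "\<And>x. (smooth_step has_real_derivative \<rho> x) (at x)" "\<And>x. \<rho> x \<ge> 0"
    "continuous_on UNIV \<rho>"
proof -
  obtain D where D: "\<And>x. (smooth_step has_derivative D x) (at x)" "C_k 0 (\<lambda>x. D x 1)"
    using C_k_smooth_step[of "Suc 0"] by auto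
  have "D x = (*) (D x 1)" for x
  proof
    show "D x v = D x 1 * v" for v
      using linear_scale[OF has_derivative_linear[OF D(1)], of x v 1] by (simp add: mult.commute)
  qed
  then have *: "(smooth_step has_real_derivative D x 1) (at x)" for x
    using D(1)[of x] unfolding has_field_derivative_def by metis
  define f' where "f' = flat (monom 1 2 * (1 - pderiv 1))"
  have f': "f' x \<ge> 0" for x
    by (auto simp: f'_def flat_def poly_monom)
  have f1: "(flat 1 has_real_derivative f' x) (at x)" for x
    unfolding f'_def by (rule has_real_derivative_flat)
  have f2: "((\<lambda>x. flat 1 (1 - x)) has_real_derivative - f' (1 - x)) (at x)" for x
    by (rule DERIV_chain2[OF f1, THEN DERIV_cong]) (auto intro!: derivative_eq_intros)
  have "D x 1 \<ge> 0" for x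
  proof -
    let ?s = "flat 1 x + flat 1 (1 - x)"
    have "((\<lambda>x. flat 1 x * inverse (flat 1 x + flat 1 (1 - x))) has_real_derivative
       (f' x * flat 1 (1 - x) + flat 1 x * f' (1 - x)) * (inverse ?s)\<^sup>2) (at x)"
      using flat_sum_pos[of x]
      by (auto intro!: derivative_eq_intros f1 f2 simp: power2_eq_square field_simps)
    then have "D x 1 = (f' x * flat 1 (1 - x) + flat 1 x * f' (1 - x)) * (inverse ?s)\<^sup>2"
      using * DERIV_unique unfolding smooth_step_def[abs_def] by blast
    also have "\<dots> \<ge> 0"
      using f' flat_1_bounds by simp
    finally show ?thesis .
  qed
  with * that[of "\<lambda>x. D x 1"] D(2) show thesis
    by auto
qed

section \<open>Test functions and the fundamental lemma of the calculus of variations\<close>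

lemma test_functionsE:
  assumes "\<phi> \<in> test_functions \<Omega>"
  obtains K where "compact K" "K \<subseteq> \<Omega>" "\<And>x. x \<notin> K \<Longrightarrow> \<phi> x = 0" "\<And>k. C_k k \<phi>"
  using assms unfolding test_functions_def by blast

lemma test_functionsI:
  assumes "\<And>k. C_k k \<phi>" "compact K" "K \<subseteq> \<Omega>" "\<And>x. x \<notin> K \<Longrightarrow> \<phi> x = 0"
  shows "\<phi> \<in> test_functions \<Omega>"
  using assms unfolding test_functions_def by blast

lemma test_functions_lincomb:
  assumes "\<phi> \<in> test_functions \<Omega>" "\<psi> \<in> test_functions \<Omega>"
  shows "(\<lambda>x. a * \<phi> x + b * \<psi> x) \<in> test_functions \<Omega>"
proof -
  obtain K where K: "compact K" "K \<subseteq> \<Omega>" "\<And>x. x \<notin> K \<Longrightarrow> \<phi> x = 0" "\<And>k. C_k k \<phi>"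
    using assms(1) test_functionsE by blast
  obtain L where L: "compact L" "L \<subseteq> \<Omega>" "\<And>x. x \<notin> L \<Longrightarrow> \<psi> x = 0" "\<And>k. C_k k \<psi>"
    using assms(2) test_functionsE by blast
  show ?thesis
    using K L
    by (intro test_functionsI[of _ "K \<union> L"] C_k_add C_k_scale) auto
qed

lemma test_functions_mult:
  assumes "\<phi> \<in> test_functions \<Omega>" "\<psi> \<in> test_functions \<Omega>"
  shows "(\<lambda>x. \<phi> x * \<psi> x) \<in> test_functions \<Omega>"
proof -
  obtain K where K: "compact K" "K \<subseteq> \<Omega>" "\<And>x. x \<notin> K \<Longrightarrow> \<phi> x = 0" "\<And>k. C_k k \<phi>"
    using assms(1) test_functionsE by blast
  have "\<And>k. C_k k \<psi>"
    using assms(2) test_functionsE by blast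
  with K show ?thesis
    by (intro test_functionsI[of _ K] C_k_mult) auto
qed

lemma test_functions_continuous: "\<phi> \<in> test_functions \<Omega> \<Longrightarrow> continuous_on UNIV \<phi>"
  by (elim test_functionsE) (rule C_k_imp_continuous)

lemma test_functions_measurable: "\<phi> \<in> test_functions \<Omega> \<Longrightarrow> \<phi> \<in> borel_measurable borel"
  by (intro borel_measurable_continuous_onI test_functions_continuous)

lemma borel_measurable_lebesgue_on: "f \<in> borel_measurable borel \<Longrightarrow> f \<in> borel_measurable (lebesgue_on S)"
  by (intro measurable_restrict_space1 measurable_completion) simp

lemma test_functions_bounded:
  assumes "\<phi> \<in> test_functions \<Omega>"
  obtains C where "\<And>x. \<bar>\<phi> x\<bar> \<le> C"
proof -
  obtain K where K: "compact K" "K \<subseteq> \<Omega>" "\<And>x. x \<notin> K \<Longrightarrow> \<phi> x = 0" "\<And>k. C_k k \<phi>"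
    using assms test_functionsE by blast
  have "bounded (\<phi> ` K)"
    using K continuous_on_subset[OF test_functions_continuous[OF assms]]
    by (intro compact_imp_bounded compact_continuous_image) auto
  then obtain C where "\<forall>x\<in>K. \<bar>\<phi> x\<bar> \<le> C"
    by (auto simp: bounded_iff)
  then have "\<bar>\<phi> x\<bar> \<le> max C 0" for x
    using K(3)[of x] by (cases "x \<in> K") (auto simp: le_max_iff_disj)
  then show thesis
    using that by blast
qed

lemma integrable_mult_bounded:
  fixes f g :: "'a \<Rightarrow> real"
  assumes "integrable M f" "g \<in> borel_measurable M" "\<And>x. \<bar>g x\<bar> \<le> C"
  shows "integrable M (\<lambda>x. f x * g x)"
proof (rule Bochner_Integration.integrable_bound)
  show "integrable M (\<lambda>x. C * \<bar>f x\<bar>)"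
    using assms by simp
  have "\<bar>f x\<bar> * \<bar>g x\<bar> \<le> \<bar>f x\<bar> * \<bar>C\<bar>" for x
    by (intro mult_left_mono order.trans[OF assms(3) abs_ge_self]) auto
  then show "AE x in M. norm (f x * g x) \<le> norm (C * \<bar>f x\<bar>)"
    by (intro AE_I2) (simp add: abs_mult mult.commute)
qed (use assms in \<open>auto intro!: borel_measurable_times\<close>)

text \<open>The shift by 1 makes the function vanish within distance 1/n of the faces, which gives
  compact support inside the open box. For a fixed point inside, the arguments tend to infinity and
  each factor tends to 1.\<close>

definition box_cutoff :: "'a::euclidean_space \<Rightarrow> 'a \<Rightarrow> nat \<Rightarrow> 'a \<Rightarrow> real" where
  "box_cutoff a b n x =
     (\<Prod>i\<in>Basis. flat 1 (real n * (x \<bullet> i - a \<bullet> i) - 1) * flat 1 (real n * (b \<bullet> i - x \<bullet> i) - 1))"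

lemma C_k_box_cutoff: "C_k k (box_cutoff a b n)"
proof -
  have "C_k k (\<lambda>x. flat 1 (x \<bullet> (real n *\<^sub>R i) + (- real n * (a \<bullet> i) - 1)) *
                  flat 1 (x \<bullet> (- real n *\<^sub>R i) + (real n * (b \<bullet> i) - 1)))" for i
    by (intro C_k_mult C_k_compose_affine C_k_flat)
  then have "C_k k (\<lambda>x. flat 1 (real n * (x \<bullet> i - a \<bullet> i) - 1) * flat 1 (real n * (b \<bullet> i - x \<bullet> i) - 1))" for i
    by (simp add: algebra_simps)
  then show ?thesis
    unfolding box_cutoff_def[abs_def] by (intro C_k_prod) auto
qed

lemma box_cutoff_bounds: "0 \<le> box_cutoff a b n x" "box_cutoff a b n x \<le> 1"
  unfolding box_cutoff_def
  by (auto intro!: prod_nonneg prod_le_1 flat_1_bounds mult_le_one mult_nonneg_nonneg)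

lemma box_cutoff_measurable: "box_cutoff a b n \<in> borel_measurable borel"
  by (rule borel_measurable_continuous_onI) (rule C_k_imp_continuous[OF C_k_box_cutoff])

lemma box_cutoff_eq_0:
  assumes "i \<in> Basis" "real n * (x \<bullet> i - a \<bullet> i) \<le> 1 \<or> real n * (b \<bullet> i - x \<bullet> i) \<le> 1"
  shows "box_cutoff a b n x = 0"
  unfolding box_cutoff_def
  by (rule prod_zero) (use assms in \<open>auto simp: flat_1 not_less intro!: bexI[of _ i]\<close>)

lemma box_cutoff_in_test_functions:
  assumes "box a b \<subseteq> \<Omega>" "n > 0"
  shows "box_cutoff a b n \<in> test_functions \<Omega>"
proof -
  let ?K = "cbox (a + (1 / n) *\<^sub>R One) (b - (1 / n) *\<^sub>R One)"
  have "?K \<subseteq> box a b"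
  proof
    fix x assume x: "x \<in> ?K"
    have n: "1 / real n > 0"
      using assms(2) by simp
    have "a \<bullet> i < x \<bullet> i \<and> x \<bullet> i < b \<bullet> i" if "i \<in> Basis" for i
    proof -
      have "a \<bullet> i + 1 / n \<le> x \<bullet> i \<and> x \<bullet> i \<le> b \<bullet> i - 1 / n"
        using x that by (auto simp: mem_box inner_add_left inner_diff_left)
      with n show ?thesis by linarith
    qed
    then show "x \<in> box a b"
      by (simp add: mem_box)
  qed
  moreover have "box_cutoff a b n x = 0" if "x \<notin> ?K" for x
  proof -
    from that obtain i where i: "i \<in> Basis"
      "\<not> (a \<bullet> i + 1 / n \<le> x \<bullet> i \<and> x \<bullet> i \<le> b \<bullet> i - 1 / n)"
      by (auto simp: mem_box inner_add_left inner_diff_left)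
    then have "x \<bullet> i - a \<bullet> i \<le> 1 / n \<or> b \<bullet> i - x \<bullet> i \<le> 1 / n"
      by linarith
    then have "real n * (x \<bullet> i - a \<bullet> i) \<le> 1 \<or> real n * (b \<bullet> i - x \<bullet> i) \<le> 1"
      using assms(2) by (simp add: pos_le_divide_eq mult.commute)
    then show ?thesis
      by (rule box_cutoff_eq_0[OF i(1)])
  qed
  ultimately show ?thesis
    using assms(1) by (intro test_functionsI[of _ ?K] C_k_box_cutoff compact_cbox) auto
qed

lemma box_cutoff_tendsto: "(\<lambda>n. box_cutoff a b n x) \<longlonglongrightarrow> indicator (box a b) x"
proof (cases "x \<in> box a b")
  case True
  have *: "(\<lambda>n. flat 1 (real n * d - 1)) \<longlonglongrightarrow> 1" if "d > 0" for d :: real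
  proof -
    have "filterlim (\<lambda>n. real n * d - 1) at_top sequentially"
      using that by real_asymp
    then have "(\<lambda>n. exp (- inverse (real n * d - 1))) \<longlonglongrightarrow> exp (- 0)"
      by (intro tendsto_intros tendsto_inverse_0_at_top)
    moreover have "eventually (\<lambda>n. real n * d - 1 > 0) sequentially"
      using that by real_asymp
    then have "eventually (\<lambda>n. exp (- inverse (real n * d - 1)) = flat 1 (real n * d - 1)) sequentially"
      by eventually_elim (simp add: flat_1 inverse_eq_divide)
    ultimately have "(\<lambda>n. flat 1 (real n * d - 1)) \<longlonglongrightarrow> exp (- 0)"
      by (rule Lim_transform_eventually)
    then show ?thesis by simp
  qed
  have "(\<lambda>n. box_cutoff a b n x) \<longlonglongrightarrow> (\<Prod>i\<in>(Basis::'a set). 1 * 1)"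
    unfolding box_cutoff_def
    by (intro tendsto_prod tendsto_mult *) (use True in \<open>auto simp: mem_box\<close>)
  with True show ?thesis by simp
next
  case False
  then obtain i where "i \<in> Basis" "x \<bullet> i \<le> a \<bullet> i \<or> b \<bullet> i \<le> x \<bullet> i"
    by (auto simp: mem_box not_less)
  moreover have "real n * (x \<bullet> i - a \<bullet> i) \<le> 1" if "x \<bullet> i \<le> a \<bullet> i" for n
    using mult_nonneg_nonpos[OF of_nat_0_le_iff[of n], of "x \<bullet> i - a \<bullet> i"] that by linarith
  moreover have "real n * (b \<bullet> i - x \<bullet> i) \<le> 1" if "b \<bullet> i \<le> x \<bullet> i" for n
    using mult_nonneg_nonpos[OF of_nat_0_le_iff[of n], of "b \<bullet> i - x \<bullet> i"] that by linarith
  ultimately have "box_cutoff a b n x = 0" for n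
    by (intro box_cutoff_eq_0[of i]) blast+
  with False show ?thesis by simp
qed

text \<open>Box cutoffs give h integral zero over every box in \<Omega>, the pi-lambda theorem
  extends this to Borel subsets of a box, and a density all of whose integrals vanish is zero almost
  everywhere. Countably many boxes cover \<Omega>.\<close>

theorem fundamental_lemma_calculus_of_variations:
  fixes h :: "'a::euclidean_space \<Rightarrow> real"
  assumes "open \<Omega>" "bounded \<Omega>" and h: "integrable (lebesgue_on \<Omega>) h"
    and test: "\<And>\<phi>. \<phi> \<in> test_functions \<Omega> \<Longrightarrow> (LINT x|lebesgue_on \<Omega>. h x * \<phi> x) = 0"
  shows "AE x in lebesgue_on \<Omega>. h x = 0"
proof -
  let ?M = "lebesgue_on \<Omega>"
  have [measurable]: "h \<in> borel_measurable ?M"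
    using h by auto
  have \<Omega>: "\<Omega> \<in> sets lebesgue"
    using \<open>open \<Omega>\<close> by auto
  have ind: "indicat_real A \<in> borel_measurable ?M" if "A \<in> sets lebesgue" for A
    using that by (metis borel_measurable_indicator measurable_restrict_space1)
  have int: "integrable ?M (\<lambda>x. h x * indicator A x)" if "A \<in> sets lebesgue" for A
    by (rule integrable_mult_bounded[OF h ind[OF that], of 1]) (auto simp: indicator_def)
  have box: "(LINT x|?M. h x * indicator (box a b) x) = 0" if "box a b \<subseteq> \<Omega>" for a b
  proof -
    have "(\<lambda>n. LINT x|?M. h x * box_cutoff a b n x) \<longlonglongrightarrow> (LINT x|?M. h x * indicator (box a b) x)"
    proof (rule integral_dominated_convergence[where w = "\<lambda>x. \<bar>h x\<bar>"])
      show "(\<lambda>x. h x * box_cutoff a b n x) \<in> borel_measurable ?M" for n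
        by (intro borel_measurable_times borel_measurable_lebesgue_on[OF box_cutoff_measurable]) fact
      show "AE x in ?M. norm (h x * box_cutoff a b n x) \<le> \<bar>h x\<bar>" for n
        using box_cutoff_bounds[of a b n] by (intro AE_I2) (simp add: abs_mult mult_left_le)
      show "AE x in ?M. (\<lambda>n. h x * box_cutoff a b n x) \<longlonglongrightarrow> h x * indicator (box a b) x"
        by (intro AE_I2 tendsto_mult tendsto_const box_cutoff_tendsto)
    qed (use h int[of "box a b"] in auto)
    moreover have "eventually (\<lambda>n. (LINT x|?M. h x * box_cutoff a b n x) = 0) sequentially"
      using eventually_gt_at_top[of 0]
    proof eventually_elim
      fix n :: nat assume "0 < n"
      then show "(LINT x|?M. h x * box_cutoff a b n x) = 0"
        using test[OF box_cutoff_in_test_functions[OF that]] by simp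
    qed
    ultimately show ?thesis
      using LIMSEQ_unique[OF _ tendsto_eventually] by blast
  qed
  \<comment> \<open>Everything stays inside one box because the complement step of the pi-lambda
    argument subtracts from the integral over the whole reference set, and for a box that integral
    is known to be zero.\<close>
  have borel: "(LINT x|?M. h x * indicator (A \<inter> box c d) x) = 0"
    if "A \<in> sets borel" "box c d \<subseteq> \<Omega>" for A c d
  proof -
    have "Int_stable (range (\<lambda>(a, b). box a b :: 'a set))"
      by (auto simp: Int_stable_def box_Int_box)
    moreover have "range (\<lambda>(a, b). box a b :: 'a set) \<subseteq> Pow UNIV"
      by auto
    moreover have "A \<in> sigma_sets UNIV (range (\<lambda>(a, b). box a b))"
      using that(1) by (simp add: borel_eq_box)
    ultimately show ?thesis
    proof (induction rule: sigma_sets_induct_disjoint)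
      case (basic A)
      then obtain a b where "A = box a b" by auto
      moreover obtain a' b' where "box a b \<inter> box c d = box a' b'"
        unfolding box_Int_box by blast
      ultimately show ?case
        using box[of a' b'] that(2) by auto
    next
      case empty
      then show ?case by simp
    next
      case (compl A)
      then have A: "A \<in> sets borel"
        by (simp add: borel_eq_box)
      have "h x * indicator ((UNIV - A) \<inter> box c d) x
          = h x * indicator (box c d) x - h x * indicator (A \<inter> box c d) x" for x
        by (auto simp: indicator_def)
      then have "(LINT x|?M. h x * indicator ((UNIV - A) \<inter> box c d) x)
          = (LINT x|?M. h x * indicator (box c d) x) - (LINT x|?M. h x * indicator (A \<inter> box c d) x)"
        using A by (simp add: Bochner_Integration.integral_diff int)
      then show ?case
        using compl.IH box[OF that(2)] by simp
    next
      case (union F)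
      then have F: "F i \<in> sets borel" for i
        by (auto simp: borel_eq_box)
      have eq: "indicat_real (\<Union>i<n. F i) x = (\<Sum>i<n. indicator (F i) x)" for n x
        by (rule indicator_UN_disjoint)
          (use union.hyps(1) in \<open>auto simp: disjoint_family_on_def\<close>)
      have "(LINT x|?M. h x * indicator ((\<Union>i<n. F i) \<inter> box c d) x) =
            (LINT x|?M. (\<Sum>i<n. h x * indicator (F i \<inter> box c d) x))" for n
        by (simp only: indicator_inter_arith eq sum_distrib_left sum_distrib_right)
      also have "\<dots> n = (\<Sum>i<n. LINT x|?M. h x * indicator (F i \<inter> box c d) x)" for n
        using F by (intro Bochner_Integration.integral_sum int) auto
      finally have zero: "(LINT x|?M. h x * indicator ((\<Union>i<n. F i) \<inter> box c d) x) = 0" for n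
        using union.IH by simp
      have "(\<lambda>n. LINT x|?M. h x * indicator ((\<Union>i<n. F i) \<inter> box c d) x)
          \<longlonglongrightarrow> (LINT x|?M. h x * indicator (\<Union>(range F) \<inter> box c d) x)"
      proof (rule integral_dominated_convergence[where w = "\<lambda>x. \<bar>h x\<bar>"])
        show "AE x in ?M. (\<lambda>n. h x * indicator ((\<Union>i<n. F i) \<inter> box c d) x)
            \<longlonglongrightarrow> h x * indicator (\<Union>(range F) \<inter> box c d) x"
          unfolding indicator_inter_arith
          by (intro AE_I2 tendsto_mult tendsto_const LIMSEQ_indicator_UN)
        show "AE x in ?M. norm (h x * indicator ((\<Union>i<n. F i) \<inter> box c d) x) \<le> \<bar>h x\<bar>" for n
          by (intro AE_I2) (simp add: abs_mult indicator_def)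
      qed (use F h in \<open>auto intro!: borel_measurable_times ind\<close>)
      then show ?case
        unfolding zero using LIMSEQ_unique tendsto_const by metis
    qed
  qed
  have "AE x in ?M. h x * indicator (box c d) x = 0" if cd: "box c d \<subseteq> \<Omega>" for c d
  proof (rule sigma_finite_measure.density_zero)
    show "sigma_finite_measure ?M"
      using \<open>open \<Omega>\<close> \<open>bounded \<Omega>\<close>
      by (intro finite_measure.axioms(1) finite_measure_lebesgue_on lmeasurable_open)
    show "integrable ?M (\<lambda>x. h x * indicator (box c d) x)"
      by (intro int) auto
    fix A assume "A \<in> sets ?M"
    then have "A \<in> sets lebesgue"
      using \<Omega> by (simp add: sets_restrict_space_iff)
    \<comment> \<open>The density criterion asks for all Lebesgue sets; each agrees with a Borel set
      up to a null set, which does not change the integral.\<close>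
    then obtain A' where A': "A' \<in> sets borel" "AE x in lebesgue. x \<in> A \<longleftrightarrow> x \<in> A'"
    proof -
      obtain N where N: "N \<in> null_sets lborel" "null_part lborel A \<subseteq> N"
        using null_part[OF \<open>A \<in> sets lebesgue\<close>] by auto
      then have "AE x in lebesgue. x \<notin> N"
        by (intro AE_not_in null_sets_completionI)
      moreover have "A = main_part lborel A \<union> null_part lborel A"
        using \<open>A \<in> sets lebesgue\<close> by simp
      ultimately have "AE x in lebesgue. x \<in> A \<longleftrightarrow> x \<in> main_part lborel A"
        using N(2) by (auto elim!: eventually_mono)
      moreover have "main_part lborel A \<in> sets borel"
        using main_part_sets[OF \<open>A \<in> sets lebesgue\<close>] by simp
      ultimately show thesis
        using that by blast
    qed
    have "AE x in ?M. x \<in> A \<longleftrightarrow> x \<in> A'"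
      using A'(2) \<Omega> by (subst AE_restrict_space_iff) auto
    then have "set_lebesgue_integral ?M A (\<lambda>x. h x * indicator (box c d) x)
        = (LINT x|?M. h x * indicator (A' \<inter> box c d) x)"
      unfolding set_lebesgue_integral_def
      using A' \<open>A \<in> sets lebesgue\<close>
      by (intro integral_cong_AE borel_measurable_scaleR borel_measurable_times ind) 
        (auto simp: indicator_def)
    then show "set_lebesgue_integral ?M A (\<lambda>x. h x * indicator (box c d) x) = 0"
      using borel A' cd by simp
  qed
  moreover obtain \<D> where \<D>: "countable \<D>" "\<D> \<subseteq> Pow \<Omega>" "\<And>X. X \<in> \<D> \<Longrightarrow> \<exists>a b. X = box a b" "\<Union>\<D> = \<Omega>"
    using open_countable_Union_open_box[OF \<open>open \<Omega>\<close>] by blast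
  ultimately have "AE x in ?M. \<forall>X\<in>\<D>. h x * indicator X x = 0"
    by (subst AE_ball_countable) (auto, metis PowD subsetD)
  then show ?thesis
  proof (rule AE_mp, intro AE_I2 impI)
    fix x assume "x \<in> space ?M" "\<forall>X\<in>\<D>. h x * indicator X x = 0"
    moreover from this obtain X where "X \<in> \<D>" "x \<in> X"
      using \<D>(4) by auto
    ultimately show "h x = 0"
      by (auto dest!: bspec[of _ _ X])
  qed
qed


section \<open>Derivatives of test functions and integration by parts\<close>

lemma test_functions_has_derivative:
  assumes "\<phi> \<in> test_functions \<Omega>"
  shows "(\<phi> has_derivative frechet_derivative \<phi> (at x)) (at x)"
proof -
  have "C_k (Suc 0) \<phi>"
    using assms test_functionsE by blast
  then have "\<phi> differentiable (at x)"
    by (auto simp: differentiable_def)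
  then show ?thesis
    using frechet_derivative_works by blast
qed

lemma partial_deriv_eq_0:
  assumes "compact K" "\<And>x. x \<notin> K \<Longrightarrow> \<phi> x = 0" "x \<notin> K"
  shows "partial_deriv i \<phi> x = 0"
proof -
  have "open (- K)" "x \<in> - K"
    using assms by (auto simp: compact_imp_closed)
  then have "(\<phi> has_derivative (\<lambda>_. 0)) (at x)"
    by (rule has_derivative_transform_within_open[OF has_derivative_const[of 0]]) (use assms in auto)
  then have "frechet_derivative \<phi> (at x) = (\<lambda>_. 0)"
    by (metis frechet_derivative_at)
  then show ?thesis
    by (simp add: partial_deriv_def)
qed

lemma partial_deriv_test_function:
  assumes "\<phi> \<in> test_functions \<Omega>"
  shows "partial_deriv i \<phi> \<in> test_functions \<Omega>"
proof -
  obtain K where K: "compact K" "K \<subseteq> \<Omega>" "\<And>x. x \<notin> K \<Longrightarrow> \<phi> x = 0" "\<And>k. C_k k \<phi>"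
    using assms test_functionsE by blast
  have "C_k k (partial_deriv i \<phi>)" for k
  proof -
    obtain D where D: "\<And>x. (\<phi> has_derivative D x) (at x)" "\<And>b. b \<in> Basis \<Longrightarrow> C_k k (\<lambda>x. D x b)"
      using C_k_SucE[OF K(4)] by blast
    have "D x = frechet_derivative \<phi> (at x)" for x
      using D(1) by (rule frechet_derivative_at)
    then have "partial_deriv i \<phi> = (\<lambda>x. D x (axis i 1))"
      by (simp add: fun_eq_iff partial_deriv_def)
    then show ?thesis
      using D(2) by (simp add: axis_in_Basis_iff)
  qed
  then show ?thesis
    using K(1,2) partial_deriv_eq_0[OF K(1,3)] by (intro test_functionsI[of _ K]) auto
qed

lemma partial_deriv_along_line:
  assumes "\<phi> \<in> test_functions \<Omega>"
  shows "((\<lambda>s. \<phi> (x + s *\<^sub>R axis i 1)) has_real_derivative partial_deriv i \<phi> (x + s *\<^sub>R axis i 1)) (at s)"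
proof -
  let ?D = "frechet_derivative \<phi> (at (x + s *\<^sub>R axis i 1))"
  have "((\<lambda>s. \<phi> (x + s *\<^sub>R axis i 1)) has_derivative (\<lambda>u. ?D (u *\<^sub>R axis i 1))) (at s)"
    by (rule has_derivative_compose[OF _ test_functions_has_derivative[OF assms]])
      (auto intro!: derivative_eq_intros)
  moreover have "(\<lambda>u. ?D (u *\<^sub>R axis i 1)) = (*) (partial_deriv i \<phi> (x + s *\<^sub>R axis i 1))"
    using linear_scale[OF has_derivative_linear[OF test_functions_has_derivative[OF assms]]]
    by (simp add: partial_deriv_def fun_eq_iff mult.commute)
  ultimately show ?thesis
    by (simp add: has_field_derivative_def)
qed

text \<open>Translation invariance of Lebesgue measure makes the integral of every difference quotient vanish.\<close>

lemma integral_partial_deriv_eq_0: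
  fixes \<phi> :: "real^'m \<Rightarrow> real"
  assumes \<phi>: "\<phi> \<in> test_functions \<Omega>"
  shows "(LINT x|lborel. partial_deriv i \<phi> x) = 0"
proof -
  obtain K where K: "compact K" "K \<subseteq> \<Omega>" "\<And>x. x \<notin> K \<Longrightarrow> \<phi> x = 0" "\<And>k. C_k k \<phi>"
    using \<phi> test_functionsE by blast
  obtain r where r: "\<And>x. x \<in> K \<Longrightarrow> norm x \<le> r"
    using compact_imp_bounded[OF K(1)] by (auto simp: bounded_iff)
  obtain C where C: "\<And>x. \<bar>partial_deriv i \<phi> x\<bar> \<le> C"
    using test_functions_bounded[OF partial_deriv_test_function[OF \<phi>]] by blast
  have meas [measurable]: "\<phi> \<in> borel_measurable borel" "partial_deriv i \<phi> \<in> borel_measurable borel"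
    using \<phi> by (auto intro: test_functions_measurable partial_deriv_test_function)
  define h where "h n = 1 / real (Suc n)" for n
  have h: "0 < h n" "h n \<le> 1" for n
    by (auto simp: h_def)
  define q where "q n x = (\<phi> (x + h n *\<^sub>R axis i 1) - \<phi> x) / h n" for n x
  \<comment> \<open>A common integrable majorant: by the mean value theorem each quotient is a value
    of the partial derivative, and since the shift is at most 1 it vanishes outside the ball of
    radius r + 1.\<close>
  have bound: "\<bar>q n x\<bar> \<le> C * indicator (cball 0 (r + 1)) x" for n x
  proof (cases "norm x \<le> r + 1")
    case True
    obtain z where "\<phi> (x + h n *\<^sub>R axis i 1) - \<phi> (x + 0 *\<^sub>R axis i 1)
        = (h n - 0) * partial_deriv i \<phi> (x + z *\<^sub>R axis i 1)"
      using MVT2[OF h(1)[of n] partial_deriv_along_line[OF \<phi>], of x i] by blast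
    then have "q n x = partial_deriv i \<phi> (x + z *\<^sub>R axis i 1)"
      using h[of n] by (simp add: q_def field_simps)
    then show ?thesis
      using C True by (simp add: dist_norm)
  next
    case False
    have "norm x \<le> norm (x + h n *\<^sub>R axis i 1) + norm (h n *\<^sub>R axis i (1::real))"
      by (metis add_diff_cancel_right' norm_triangle_ineq4)
    then have "norm x - 1 \<le> norm (x + h n *\<^sub>R axis i 1)"
      using h[of n] by (simp add: norm_axis_1)
    with False have "norm (x + h n *\<^sub>R axis i 1) > r" "norm x > r"
      by auto
    then have "x + h n *\<^sub>R axis i 1 \<notin> K" "x \<notin> K"
      using r by force+
    then show ?thesis
      using K(3) False by (simp add: q_def dist_norm)
  qed
  have int\<phi>: "integrable lborel \<phi>"
  proof -
    obtain C' where C': "\<And>x. \<bar>\<phi> x\<bar> \<le> C'"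
      using test_functions_bounded[OF \<phi>] by blast
    have "integrable lborel (\<lambda>x. indicator (cball 0 r) x * \<phi> x)"
      by (rule integrable_mult_bounded[OF _ _ C'])
        (auto intro!: integrable_real_indicator emeasure_lborel_cball_finite)
    moreover have "(\<lambda>x. indicator (cball 0 r) x * \<phi> x) = \<phi>"
      using K(3) r by (auto simp: indicator_def fun_eq_iff dist_norm)
    ultimately show ?thesis by simp
  qed
  have trans: "integrable lborel (\<lambda>x. \<phi> (x + y))" "(LINT x|lborel. \<phi> (x + y)) = (LINT x|lborel. \<phi> x)" for y
  proof -
    have *: "integrable (distr lborel borel ((+) y)) \<phi>"
      using int\<phi> by (simp add: lborel_distr_plus)
    then show "integrable lborel (\<lambda>x. \<phi> (x + y))"
      by (subst (asm) integrable_distr_eq) (auto simp: add.commute)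
    have "(LINT x|distr lborel borel ((+) y). \<phi> x) = (LINT x|lborel. \<phi> (y + x))"
      by (rule integral_distr) auto
    then show "(LINT x|lborel. \<phi> (x + y)) = (LINT x|lborel. \<phi> x)"
      by (simp add: lborel_distr_plus add.commute)
  qed
  have "(LINT x|lborel. q n x) = 0" for n
    unfolding q_def using trans int\<phi> by simp
  moreover have "(\<lambda>n. LINT x|lborel. q n x) \<longlonglongrightarrow> (LINT x|lborel. partial_deriv i \<phi> x)"
  proof (rule integral_dominated_convergence[where w = "\<lambda>x. C * indicator (cball 0 (r + 1)) x"])
    show "AE x in lborel. (\<lambda>n. q n x) \<longlonglongrightarrow> partial_deriv i \<phi> x"
    proof (intro AE_I2)
      fix x
      have "((\<lambda>s. (\<phi> (x + s *\<^sub>R axis i 1) - \<phi> x) / s) \<longlongrightarrow> partial_deriv i \<phi> x) (at 0)"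
        using partial_deriv_along_line[OF \<phi>, of x i 0] by (simp add: DERIV_def)
      moreover have "filterlim h (at 0) sequentially"
        unfolding filterlim_at h_def using LIMSEQ_inverse_real_of_nat by (auto simp: inverse_eq_divide)
      ultimately show "(\<lambda>n. q n x) \<longlonglongrightarrow> partial_deriv i \<phi> x"
        unfolding q_def by (rule filterlim_compose)
    qed
    show "(\<lambda>x. q n x) \<in> borel_measurable lborel" for n
      unfolding q_def by measurable
    show "integrable lborel (\<lambda>x. C * indicator (cball 0 (r + 1)) x)"
      by (auto intro!: integrable_real_indicator emeasure_lborel_cball_finite)
  qed (use bound in auto)
  ultimately show ?thesis
    by (simp add: LIMSEQ_const_iff)
qed

lemma partial_deriv_mult:
  assumes "\<phi> \<in> test_functions \<Omega>" "\<psi> \<in> test_functions \<Omega>"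
  shows "partial_deriv i (\<lambda>x. \<phi> x * \<psi> x) x = \<phi> x * partial_deriv i \<psi> x + partial_deriv i \<phi> x * \<psi> x"
proof -
  have "((\<lambda>x. \<phi> x * \<psi> x) has_derivative
      (\<lambda>v. \<phi> x * frechet_derivative \<psi> (at x) v + frechet_derivative \<phi> (at x) v * \<psi> x)) (at x)"
    using assms by (intro has_derivative_mult test_functions_has_derivative)
  from frechet_derivative_at[OF this] show ?thesis
    unfolding partial_deriv_def by (metis (mono_tags))
qed

text \<open>Moves integrals of functions supported in \<Omega> to the whole space, where Lebesgue
  measure is translation invariant.\<close>

lemma integral_lebesgue_on_vanishing:
  fixes f :: "'a::euclidean_space \<Rightarrow> real"
  assumes "f \<in> borel_measurable borel" "\<Omega> \<in> sets lebesgue" "\<And>x. x \<notin> \<Omega> \<Longrightarrow> f x = 0"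
  shows "(LINT x|lebesgue_on \<Omega>. f x) = (LINT x|lborel. f x)"
proof -
  have "(LINT x|lebesgue_on \<Omega>. f x) = (LINT x|lebesgue. indicator \<Omega> x *\<^sub>R f x)"
    using assms by (subst integral_restrict_space) auto
  also have "(\<lambda>x. indicator \<Omega> x *\<^sub>R f x) = f"
    using assms(3) by (intro ext) (auto simp: indicator_def)
  finally show ?thesis
    using assms(1) by (simp add: integral_completion)
qed

lemma lebesgue_open: "open \<Omega> \<Longrightarrow> \<Omega> \<in> sets lebesgue"
  by auto

lemma integrable_lebesgue_on_test_function:
  assumes "bounded \<Omega>" "open \<Omega>" "\<phi> \<in> test_functions \<Omega>"
  shows "integrable (lebesgue_on \<Omega>) \<phi>"
proof -
  interpret finite_measure "lebesgue_on \<Omega>"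
    using assms by (intro finite_measure_lebesgue_on lmeasurable_open)
  obtain C where "\<And>x. \<bar>\<phi> x\<bar> \<le> C"
    using test_functions_bounded[OF assms(3)] by blast
  then show ?thesis
    by (intro integrable_const_bound[of _ C] AE_I2
        borel_measurable_lebesgue_on[OF test_functions_measurable[OF assms(3)]]) simp
qed

text \<open>Integration by parts: the product of two test functions is a test function, so its
  partial derivative integrates to zero, and the product rule splits that integral.\<close>

lemma weak_gradient_test_function:
  assumes "open \<Omega>" "bounded \<Omega>" "\<phi> \<in> test_functions \<Omega>"
  shows "weak_gradient \<Omega> \<phi> (\<lambda>x. \<chi> i. partial_deriv i \<phi> x)"
  unfolding weak_gradient_def
proof (intro ballI allI)
  fix \<psi> i assume \<psi>: "\<psi> \<in> test_functions \<Omega>"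
  let ?M = "lebesgue_on \<Omega>"
  have prod: "(\<lambda>x. \<phi> x * \<psi> x) \<in> test_functions \<Omega>"
    using assms \<psi> by (intro test_functions_mult)
  obtain K where "compact K" "K \<subseteq> \<Omega>" "\<And>x. x \<notin> K \<Longrightarrow> partial_deriv i (\<lambda>x. \<phi> x * \<psi> x) x = 0"
      "\<And>k. C_k k (partial_deriv i (\<lambda>x. \<phi> x * \<psi> x))"
    using partial_deriv_test_function[OF prod] test_functionsE by blast
  then have "(LINT x|?M. partial_deriv i (\<lambda>x. \<phi> x * \<psi> x) x) = 0"
    using integral_lebesgue_on_vanishing[of "partial_deriv i (\<lambda>x. \<phi> x * \<psi> x)" \<Omega>]
      test_functions_measurable[OF partial_deriv_test_function[OF prod]]
      integral_partial_deriv_eq_0[OF prod, of i] assms(1) 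
    by (metis subsetD lebesgue_open)
  then have "(LINT x|?M. \<phi> x * partial_deriv i \<psi> x + partial_deriv i \<phi> x * \<psi> x) = 0"
    unfolding partial_deriv_mult[OF assms(3) \<psi>] .
  moreover have "integrable ?M (\<lambda>x. \<phi> x * partial_deriv i \<psi> x)" "integrable ?M (\<lambda>x. partial_deriv i \<phi> x * \<psi> x)"
    by (rule integrable_lebesgue_on_test_function[OF assms(2,1)
          test_functions_mult[OF assms(3) partial_deriv_test_function[OF \<psi>]]],
        rule integrable_lebesgue_on_test_function[OF assms(2,1)
          test_functions_mult[OF partial_deriv_test_function[OF assms(3)] \<psi>]])
  ultimately have "(LINT x|?M. \<phi> x * partial_deriv i \<psi> x) + (LINT x|?M. partial_deriv i \<phi> x * \<psi> x) = 0"
    by (subst Bochner_Integration.integral_add[symmetric])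
  then show "(LINT x|?M. \<phi> x * partial_deriv i \<psi> x)
      = - (LINT x|?M. (\<chi> i. partial_deriv i \<phi> x) $ i * \<psi> x)"
    by simp
qed

section \<open>The space of square integrable functions\<close>

lemma L2_measurable: "f \<in> L2 \<Omega> \<Longrightarrow> f \<in> borel_measurable (lebesgue_on \<Omega>)"
  and L2_integrable: "f \<in> L2 \<Omega> \<Longrightarrow> integrable (lebesgue_on \<Omega>) (\<lambda>x. (norm (f x))\<^sup>2)"
  by (auto simp: L2_def)

lemma L2_dominated:
  assumes "f \<in> L2 \<Omega>" "g \<in> borel_measurable (lebesgue_on \<Omega>)"
    and "AE x in lebesgue_on \<Omega>. norm (g x) \<le> C * norm (f x)"
  shows "g \<in> L2 \<Omega>"
proof -
  have [measurable]: "g \<in> borel_measurable (lebesgue_on \<Omega>)" by fact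
  have "integrable (lebesgue_on \<Omega>) (\<lambda>x. (norm (g x))\<^sup>2)"
  proof (rule Bochner_Integration.integrable_bound)
    show "integrable (lebesgue_on \<Omega>) (\<lambda>x. C\<^sup>2 * (norm (f x))\<^sup>2)"
      using L2_integrable[OF assms(1)] by simp
    show "AE x in lebesgue_on \<Omega>. norm ((norm (g x))\<^sup>2) \<le> norm (C\<^sup>2 * (norm (f x))\<^sup>2)"
      using assms(3)
    proof eventually_elim
      fix x assume "norm (g x) \<le> C * norm (f x)"
      then have "(norm (g x))\<^sup>2 \<le> (C * norm (f x))\<^sup>2"
        by (intro power_mono) auto
      then show "norm ((norm (g x))\<^sup>2) \<le> norm (C\<^sup>2 * (norm (f x))\<^sup>2)"
        by (simp add: power_mult_distrib)
    qed
  qed simp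
  with assms(2) show ?thesis
    by (simp add: L2_def)
qed

lemma L2_linear:
  assumes "bounded_linear h" "f \<in> L2 \<Omega>"
  shows "(\<lambda>x. h (f x)) \<in> L2 \<Omega>"
proof -
  have "continuous_on UNIV h"
    using assms(1) by (intro linear_continuous_on)
  then have [measurable]: "h \<in> borel_measurable borel"
    by (rule borel_measurable_continuous_onI)
  have [measurable]: "f \<in> borel_measurable (lebesgue_on \<Omega>)"
    using assms(2) by (rule L2_measurable)
  have "norm (h (f x)) \<le> onorm h * norm (f x)" for x
    using onorm[OF assms(1)] .
  then show ?thesis
    by (intro L2_dominated[OF assms(2), of _ "onorm h"] AE_I2) auto
qed

text \<open>With pairs available, closure under sums is an instance of closure under bounded linear
  maps, and a Sobolev norm becomes the \<open>L2_norm\<close> of a pair.\<close>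

lemma L2_Pair:
  assumes "f \<in> L2 \<Omega>" "g \<in> L2 \<Omega>"
  shows "(\<lambda>x. (f x, g x)) \<in> L2 \<Omega>"
  using assms unfolding L2_def by (auto simp: norm_Pair intro: borel_measurable_Pair)

lemma L2_add:
  assumes "f \<in> L2 \<Omega>" "g \<in> L2 \<Omega>"
  shows "(\<lambda>x. f x + g x) \<in> L2 \<Omega>"
proof -
  have "bounded_linear (\<lambda>p :: 'b \<times> 'b. fst p + snd p)"
    by (intro bounded_linear_add bounded_linear_fst bounded_linear_snd)
  from L2_linear[OF this L2_Pair[OF assms]] show ?thesis by simp
qed

lemma L2_scaleR: "f \<in> L2 \<Omega> \<Longrightarrow> (\<lambda>x. a *\<^sub>R f x) \<in> L2 \<Omega>"
  by (rule L2_linear[OF bounded_linear_scaleR_right])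

lemma L2_diff: "f \<in> L2 \<Omega> \<Longrightarrow> g \<in> L2 \<Omega> \<Longrightarrow> (\<lambda>x. f x - g x) \<in> L2 \<Omega>"
  using L2_add[of f \<Omega> "\<lambda>x. (-1) *\<^sub>R g x"] L2_scaleR[of g \<Omega> "-1"] by simp

lemma L2_matrix_mult:
  fixes M :: "real^'n^'k"
  shows "f \<in> L2 \<Omega> \<Longrightarrow> (\<lambda>x. M *v f x) \<in> L2 \<Omega>"
  by (rule L2_linear[OF matrix_vector_mul_bounded_linear])

lemma L2_zero: "(\<lambda>x. 0) \<in> L2 \<Omega>"
  by (simp add: L2_def)

lemma L2_sum: "finite F \<Longrightarrow> (\<And>j. j \<in> F \<Longrightarrow> f j \<in> L2 \<Omega>) \<Longrightarrow> (\<lambda>x. \<Sum>j\<in>F. f j x) \<in> L2 \<Omega>"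
  by (induction F rule: finite_induct) (auto intro!: L2_add L2_zero)

lemma L2_vec:
  fixes f :: "real^'m \<Rightarrow> real^'n"
  assumes "\<And>i. (\<lambda>x. f x $ i) \<in> L2 \<Omega>"
  shows "f \<in> L2 \<Omega>"
proof -
  have "(\<lambda>x. \<Sum>i\<in>UNIV. (f x $ i) *\<^sub>R (axis i 1 :: real^'n)) \<in> L2 \<Omega>"
    by (rule L2_sum) (auto intro!: L2_linear[OF bounded_linear_scaleR_left] assms)
  moreover have eq: "(\<lambda>x. \<Sum>i\<in>UNIV. (f x $ i) *\<^sub>R (axis i 1 :: real^'n)) = f"
    using basis_expansion[of "f x" for x] by (simp add: fun_eq_iff scalar_mult_eq_scaleR)
  ultimately show ?thesis
    unfolding eq by simp
qed

lemma L2_component: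
  fixes f :: "real^'m \<Rightarrow> real^'n"
  shows "f \<in> L2 \<Omega> \<Longrightarrow> (\<lambda>x. f x $ i) \<in> L2 \<Omega>"
  by (rule L2_linear[OF bounded_linear_vec_nth])

section \<open>Inner product and norm of L^2\<close>

lemma integrable_norm_mult:
  assumes "f \<in> L2 \<Omega>" "g \<in> L2 \<Omega>"
  shows "integrable (lebesgue_on \<Omega>) (\<lambda>x. norm (f x) * norm (g x))"
proof (rule Bochner_Integration.integrable_bound)
  show "integrable (lebesgue_on \<Omega>) (\<lambda>x. (norm (f x))\<^sup>2 + (norm (g x))\<^sup>2)"
    using L2_integrable[OF assms(1)] L2_integrable[OF assms(2)] by simp
  have "\<bar>norm (f x) * norm (g x)\<bar> \<le> \<bar>(norm (f x))\<^sup>2 + (norm (g x))\<^sup>2\<bar>" for x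
    using sum_squares_bound[of "norm (f x)" "norm (g x)"]
      mult_nonneg_nonneg[OF norm_ge_zero[of "f x"] norm_ge_zero[of "g x"]]
    unfolding abs_of_nonneg[OF mult_nonneg_nonneg[OF norm_ge_zero norm_ge_zero]] by linarith
  then show "AE x in lebesgue_on \<Omega>. norm (norm (f x) * norm (g x)) \<le> norm ((norm (f x))\<^sup>2 + (norm (g x))\<^sup>2)"
    by simp
qed (use L2_measurable[OF assms(1)] L2_measurable[OF assms(2)] in auto)

lemma integrable_inner:
  assumes "f \<in> L2 \<Omega>" "g \<in> L2 \<Omega>"
  shows "integrable (lebesgue_on \<Omega>) (\<lambda>x. f x \<bullet> g x)"
  by (rule Bochner_Integration.integrable_bound[OF integrable_norm_mult[OF assms]])
    (use L2_measurable[OF assms(1)] L2_measurable[OF assms(2)] in \<open>auto intro: Cauchy_Schwarz_ineq2\<close>)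

lemma L2_norm_nonneg: "0 \<le> L2_norm \<Omega> f"
  by (simp add: L2_norm_def L2_inner_def)

lemma L2_norm_power2: "(L2_norm \<Omega> f)\<^sup>2 = (LINT x|lebesgue_on \<Omega>. (norm (f x))\<^sup>2)"
  by (simp add: L2_norm_def L2_inner_def power2_norm_eq_inner)

lemma L2_inner_self: "L2_inner \<Omega> f f = (L2_norm \<Omega> f)\<^sup>2"
  by (simp add: L2_norm_def L2_inner_def)

lemma quadratic_nonneg_imp_discriminant:
  fixes a b c :: real
  assumes "\<And>t. 0 \<le> a * t\<^sup>2 - 2 * b * t + c" "0 \<le> a"
  shows "b\<^sup>2 \<le> a * c"
proof (cases "a = 0")
  case True
  have "b = 0"
  proof (rule ccontr)
    assume "b \<noteq> 0"
    \<comment> \<open>At this value of t the degenerate quadratic equals -1.\<close>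
    then show False
      using assms(1)[of "(c + 1) / (2 * b)"] True by (simp add: field_simps)
  qed
  with True show ?thesis by simp
next
  case False
  \<comment> \<open>The quadratic is evaluated at its minimiser b / a.\<close>
  have "0 \<le> a * (a * (b / a)\<^sup>2 - 2 * b * (b / a) + c)"
    using assms(1)[of "b / a"] assms(2) by (intro mult_nonneg_nonneg)
  also have "\<dots> = a * c - b\<^sup>2"
    using False by (simp add: field_simps power2_eq_square)
  finally show ?thesis by simp
qed

text \<open>The integral of \<open>(t * norm (f x) - norm (g x))\<^sup>2\<close> is nonnegative for
  every t, so the discriminant of this quadratic in t is nonpositive.\<close>

lemma L2_Cauchy_Schwarz_norms:
  assumes "f \<in> L2 \<Omega>" "g \<in> L2 \<Omega>"
  shows "(LINT x|lebesgue_on \<Omega>. norm (f x) * norm (g x)) \<le> L2_norm \<Omega> f * L2_norm \<Omega> g"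
proof -
  let ?I = "LINT x|lebesgue_on \<Omega>. norm (f x) * norm (g x)"
  have "0 \<le> (L2_norm \<Omega> f)\<^sup>2 * t\<^sup>2 - 2 * ?I * t + (L2_norm \<Omega> g)\<^sup>2" for t
  proof -
    have "0 \<le> (LINT x|lebesgue_on \<Omega>. (t * norm (f x) - norm (g x))\<^sup>2)"
      by simp
    also have "\<dots> = (LINT x|lebesgue_on \<Omega>. (norm (f x))\<^sup>2 * t\<^sup>2 - norm (f x) * norm (g x) * (2 * t) + (norm (g x))\<^sup>2)"
      by (simp add: power2_eq_square algebra_simps)
    also have "\<dots> = (LINT x|lebesgue_on \<Omega>. (norm (f x))\<^sup>2) * t\<^sup>2 - ?I * (2 * t) + (LINT x|lebesgue_on \<Omega>. (norm (g x))\<^sup>2)"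
      using L2_integrable[OF assms(1)] L2_integrable[OF assms(2)] integrable_norm_mult[OF assms] by simp
    finally show ?thesis
      by (simp add: L2_norm_power2 mult_ac)
  qed
  then have "?I\<^sup>2 \<le> (L2_norm \<Omega> f)\<^sup>2 * (L2_norm \<Omega> g)\<^sup>2"
    by (rule quadratic_nonneg_imp_discriminant) simp
  then show ?thesis
    by (intro power2_le_imp_le[of ?I]) (auto simp: power_mult_distrib L2_norm_nonneg)
qed

lemma L2_Cauchy_Schwarz:
  assumes "f \<in> L2 \<Omega>" "g \<in> L2 \<Omega>"
  shows "\<bar>L2_inner \<Omega> f g\<bar> \<le> L2_norm \<Omega> f * L2_norm \<Omega> g"
proof -
  have "\<bar>L2_inner \<Omega> f g\<bar> \<le> (LINT x|lebesgue_on \<Omega>. \<bar>f x \<bullet> g x\<bar>)"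
    unfolding L2_inner_def by (rule integral_abs_bound)
  also have "\<dots> \<le> (LINT x|lebesgue_on \<Omega>. norm (f x) * norm (g x))"
    by (intro integral_mono integrable_norm_mult assms integrable_abs integrable_inner Cauchy_Schwarz_ineq2)
  finally show ?thesis
    using L2_Cauchy_Schwarz_norms[OF assms] by simp
qed

lemma L2_norm_mono:
  assumes "f \<in> L2 \<Omega>" "g \<in> L2 \<Omega>" "0 \<le> C"
    and "AE x in lebesgue_on \<Omega>. norm (g x) \<le> C * norm (f x)"
  shows "L2_norm \<Omega> g \<le> C * L2_norm \<Omega> f"
proof (rule power2_le_imp_le)
  have "(L2_norm \<Omega> g)\<^sup>2 \<le> (LINT x|lebesgue_on \<Omega>. C\<^sup>2 * (norm (f x))\<^sup>2)"
    unfolding L2_norm_power2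
  proof (rule integral_mono_AE)
    show "AE x in lebesgue_on \<Omega>. (norm (g x))\<^sup>2 \<le> C\<^sup>2 * (norm (f x))\<^sup>2"
      using assms(4) by eventually_elim (metis norm_ge_zero power_mono power_mult_distrib)
  qed (use assms L2_integrable in auto)
  then show "(L2_norm \<Omega> g)\<^sup>2 \<le> (C * L2_norm \<Omega> f)\<^sup>2"
    by (simp add: L2_norm_power2 power_mult_distrib)
qed (use assms in \<open>auto simp: L2_norm_nonneg\<close>)

lemma L2_norm_cong:
  assumes "f \<in> L2 \<Omega>" "g \<in> L2 \<Omega>" "AE x in lebesgue_on \<Omega>. f x = g x"
  shows "L2_norm \<Omega> f = L2_norm \<Omega> g"
proof (rule antisym)
  have "AE x in lebesgue_on \<Omega>. norm (f x) \<le> 1 * norm (g x)" "AE x in lebesgue_on \<Omega>. norm (g x) \<le> 1 * norm (f x)"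
    using assms(3) by (auto elim: eventually_mono)
  then show "L2_norm \<Omega> f \<le> L2_norm \<Omega> g" "L2_norm \<Omega> g \<le> L2_norm \<Omega> f"
    using L2_norm_mono[OF assms(2,1), of 1] L2_norm_mono[OF assms(1,2), of 1] by simp_all
qed

lemma L2_norm_scaleR: "L2_norm \<Omega> (\<lambda>x. a *\<^sub>R f x) = \<bar>a\<bar> * L2_norm \<Omega> f"
proof -
  have "L2_inner \<Omega> (\<lambda>x. a *\<^sub>R f x) (\<lambda>x. a *\<^sub>R f x) = a\<^sup>2 * L2_inner \<Omega> f f"
    unfolding L2_inner_def by (simp add: power2_eq_square mult.assoc)
  then show ?thesis
    by (simp add: L2_norm_def real_sqrt_mult)
qed

lemma L2_inner_commute: "L2_inner \<Omega> f g = L2_inner \<Omega> g f"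
  by (simp add: L2_inner_def inner_commute)

lemma L2_inner_add_left:
  assumes "f \<in> L2 \<Omega>" "g \<in> L2 \<Omega>" "h \<in> L2 \<Omega>"
  shows "L2_inner \<Omega> (\<lambda>x. f x + g x) h = L2_inner \<Omega> f h + L2_inner \<Omega> g h"
  unfolding L2_inner_def inner_add_left
  using assms by (intro Bochner_Integration.integral_add integrable_inner)

lemma L2_inner_diff_left:
  assumes "f \<in> L2 \<Omega>" "g \<in> L2 \<Omega>" "h \<in> L2 \<Omega>"
  shows "L2_inner \<Omega> (\<lambda>x. f x - g x) h = L2_inner \<Omega> f h - L2_inner \<Omega> g h"
  unfolding L2_inner_def inner_diff_left
  using assms by (intro Bochner_Integration.integral_diff integrable_inner)

lemma L2_inner_diff_right:
  assumes "f \<in> L2 \<Omega>" "g \<in> L2 \<Omega>" "h \<in> L2 \<Omega>"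
  shows "L2_inner \<Omega> h (\<lambda>x. f x - g x) = L2_inner \<Omega> h f - L2_inner \<Omega> h g"
  using L2_inner_diff_left[OF assms] by (simp add: L2_inner_commute)

lemma L2_norm_triangle:
  assumes "f \<in> L2 \<Omega>" "g \<in> L2 \<Omega>"
  shows "L2_norm \<Omega> (\<lambda>x. f x + g x) \<le> L2_norm \<Omega> f + L2_norm \<Omega> g"
proof (rule power2_le_imp_le)
  have fg: "(\<lambda>x. f x + g x) \<in> L2 \<Omega>"
    using assms by (rule L2_add)
  have "(L2_norm \<Omega> (\<lambda>x. f x + g x))\<^sup>2
      = L2_inner \<Omega> f f + 2 * L2_inner \<Omega> f g + L2_inner \<Omega> g g"
    unfolding L2_inner_self[symmetric] L2_inner_add_left[OF assms fg]
    using L2_inner_add_left[OF assms assms(1)] L2_inner_add_left[OF assms assms(2)]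
    by (simp add: L2_inner_commute)
  also have "\<dots> \<le> (L2_norm \<Omega> f + L2_norm \<Omega> g)\<^sup>2"
    using L2_Cauchy_Schwarz[OF assms] by (simp add: L2_inner_self power2_sum)
  finally show "(L2_norm \<Omega> (\<lambda>x. f x + g x))\<^sup>2 \<le> (L2_norm \<Omega> f + L2_norm \<Omega> g)\<^sup>2" .
qed (simp add: L2_norm_nonneg)

lemma L2_norm_Pair_power2:
  assumes "f \<in> L2 \<Omega>" "g \<in> L2 \<Omega>"
  shows "(L2_norm \<Omega> (\<lambda>x. (f x, g x)))\<^sup>2 = (L2_norm \<Omega> f)\<^sup>2 + (L2_norm \<Omega> g)\<^sup>2"
  using L2_integrable[OF assms(1)] L2_integrable[OF assms(2)]
  by (simp add: L2_norm_power2 norm_Pair)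

lemma L2_norm_vec_power2:
  fixes f :: "real^'m \<Rightarrow> real^'n"
  assumes "f \<in> L2 \<Omega>"
  shows "(L2_norm \<Omega> f)\<^sup>2 = (\<Sum>i\<in>UNIV. (L2_norm \<Omega> (\<lambda>x. f x $ i))\<^sup>2)"
proof -
  have "(norm (f x))\<^sup>2 = (\<Sum>i\<in>UNIV. (norm (f x $ i))\<^sup>2)" for x
    by (simp add: norm_vec_def L2_set_def sum_nonneg)
  then show ?thesis
    unfolding L2_norm_power2
    using L2_integrable[OF L2_component[OF assms]] by simp
qed

section \<open>Sobolev spaces\<close>

lemma weak_gradient_lincomb:
  assumes "f \<in> L2 \<Omega>" "g \<in> L2 \<Omega>" "F \<in> L2 \<Omega>" "G \<in> L2 \<Omega>"
    and "\<And>\<phi>. \<phi> \<in> test_functions \<Omega> \<Longrightarrow> \<phi> \<in> L2 \<Omega>"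
    and "weak_gradient \<Omega> f F" "weak_gradient \<Omega> g G"
  shows "weak_gradient \<Omega> (\<lambda>x. a * f x + b * g x) (\<lambda>x. a *\<^sub>R F x + b *\<^sub>R G x)"
  unfolding weak_gradient_def
proof (intro ballI allI)
  fix \<phi> i assume \<phi>: "\<phi> \<in> test_functions \<Omega>"
  let ?M = "lebesgue_on \<Omega>"
  have int: "integrable ?M (\<lambda>x. u x * v x)" if "u \<in> L2 \<Omega>" "v \<in> L2 \<Omega>" for u v :: "real^'a \<Rightarrow> real"
    using integrable_inner[OF that] by simp
  note L = assms(5)[OF \<phi>] assms(5)[OF partial_deriv_test_function[OF \<phi>]]
  have "(LINT x|?M. (a * f x + b * g x) * partial_deriv i \<phi> x)
      = (LINT x|?M. a * (f x * partial_deriv i \<phi> x) + b * (g x * partial_deriv i \<phi> x))"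
    by (simp add: algebra_simps)
  also have "\<dots> = a * (LINT x|?M. f x * partial_deriv i \<phi> x) + b * (LINT x|?M. g x * partial_deriv i \<phi> x)"
    using int[OF assms(1) L(2)] int[OF assms(2) L(2)] by simp
  also have "\<dots> = - (a * (LINT x|?M. F x $ i * \<phi> x) + b * (LINT x|?M. G x $ i * \<phi> x))"
    using assms(6,7) \<phi> by (simp add: weak_gradient_def)
  also have "a * (LINT x|?M. F x $ i * \<phi> x) + b * (LINT x|?M. G x $ i * \<phi> x)
      = (LINT x|?M. a * (F x $ i * \<phi> x) + b * (G x $ i * \<phi> x))"
    using int[OF L2_component[OF assms(3)] L(1)] int[OF L2_component[OF assms(4)] L(1)] by simp
  also have "\<dots> = (LINT x|?M. (a *\<^sub>R F x + b *\<^sub>R G x) $ i * \<phi> x)"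
    by (simp add: algebra_simps)
  finally show "(LINT x|?M. (a * f x + b * g x) * partial_deriv i \<phi> x)
      = - (LINT x|?M. (a *\<^sub>R F x + b *\<^sub>R G x) $ i * \<phi> x)" .
qed

lemma grad_in_L2: "f \<in> H1 \<Omega> \<Longrightarrow> grad \<Omega> f \<in> L2 \<Omega>"
  and weak_gradient_grad: "f \<in> H1 \<Omega> \<Longrightarrow> weak_gradient \<Omega> f (grad \<Omega> f)"
proof -
  assume "f \<in> H1 \<Omega>"
  then have "\<exists>g. g \<in> L2 \<Omega> \<and> weak_gradient \<Omega> f g"
    by (auto simp: H1_def)
  from someI_ex[OF this] show "grad \<Omega> f \<in> L2 \<Omega>" "weak_gradient \<Omega> f (grad \<Omega> f)"
    by (auto simp: grad_def)
qed

lemma H1_imp_L2: "f \<in> H1 \<Omega> \<Longrightarrow> f \<in> L2 \<Omega>"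
  and H10_imp_H1: "f \<in> H10 \<Omega> \<Longrightarrow> f \<in> H1 \<Omega>"
  and vH10_imp_vH1: "z \<in> vH10 \<Omega> \<Longrightarrow> z \<in> vH1 \<Omega>"
  by (auto simp: H1_def H10_def vH10_def)

text \<open>Read as the norm of the pair of value and gradient, the Sobolev norm inherits its
  triangle inequality from L^2.\<close>

lemma H1_norm_eq: "f \<in> H1 \<Omega> \<Longrightarrow> H1_norm \<Omega> f = L2_norm \<Omega> (\<lambda>x. (f x, grad \<Omega> f x))"
  unfolding H1_norm_def
  by (simp add: L2_norm_Pair_power2[symmetric] H1_imp_L2 grad_in_L2 L2_norm_nonneg)

lemma vH1_imp_L2: "z \<in> vH1 \<Omega> \<Longrightarrow> z \<in> L2 \<Omega>"
  by (rule L2_vec) (simp add: vH1_def H1_imp_L2)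

lemma vgrad_in_L2: "z \<in> vH1 \<Omega> \<Longrightarrow> vgrad \<Omega> z \<in> L2 \<Omega>"
  by (rule L2_vec) (simp add: vH1_def vgrad_def L2_component grad_in_L2)

lemma vH1_norm_eq: "z \<in> vH1 \<Omega> \<Longrightarrow> vH1_norm \<Omega> z = L2_norm \<Omega> (\<lambda>x. (z x, vgrad \<Omega> z x))"
  unfolding vH1_norm_def
  by (simp add: L2_norm_Pair_power2[symmetric] vH1_imp_L2 vgrad_in_L2 L2_norm_nonneg)

lemma L2_norm_vgrad_power2:
  assumes "z \<in> vH1 \<Omega>"
  shows "(L2_norm \<Omega> (vgrad \<Omega> z))\<^sup>2 = (\<Sum>i\<in>UNIV. (L2_norm \<Omega> (grad \<Omega> (\<lambda>x. z x $ i)))\<^sup>2)"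
proof -
  have H1: "(\<lambda>x. z x $ i) \<in> H1 \<Omega>" for i
    using assms by (simp add: vH1_def)
  have "(L2_norm \<Omega> (vgrad \<Omega> z))\<^sup>2
      = (\<Sum>p\<in>UNIV \<times> UNIV. (L2_norm \<Omega> (\<lambda>x. grad \<Omega> (\<lambda>y. z y $ fst p) x $ snd p))\<^sup>2)"
    by (simp add: L2_norm_vec_power2[OF vgrad_in_L2[OF assms]] vgrad_def)
  also have "\<dots> = (\<Sum>i\<in>UNIV. \<Sum>k\<in>UNIV. (L2_norm \<Omega> (\<lambda>x. grad \<Omega> (\<lambda>y. z y $ i) x $ k))\<^sup>2)"
    by (simp add: sum.cartesian_product case_prod_beta)
  finally show ?thesis
    by (simp add: L2_norm_vec_power2[OF grad_in_L2[OF H1]])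
qed

lemma vH1_norm_power2:
  assumes "z \<in> vH1 \<Omega>"
  shows "(vH1_norm \<Omega> z)\<^sup>2 = (\<Sum>i\<in>UNIV. (H1_norm \<Omega> (\<lambda>x. z x $ i))\<^sup>2)"
  by (simp add: vH1_norm_def H1_norm_def L2_norm_vgrad_power2[OF assms]
      L2_norm_vec_power2[OF vH1_imp_L2[OF assms]] sum.distrib sum_nonneg)

lemma vH1_norm_nonneg: "0 \<le> vH1_norm \<Omega> z"
  and H1_norm_nonneg: "0 \<le> H1_norm \<Omega> f"
  by (simp_all add: vH1_norm_def H1_norm_def)

lemma L2_norm_le_vH1_norm: "L2_norm \<Omega> z \<le> vH1_norm \<Omega> z"
  and L2_norm_vgrad_le_vH1_norm: "L2_norm \<Omega> (vgrad \<Omega> z) \<le> vH1_norm \<Omega> z"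
  by (simp_all add: vH1_norm_def real_le_rsqrt)

text \<open>P (x) I mixes the components of z and leaves the spatial direction k alone. Hence it is
  what the gradient of P z produces, and quadratic forms built from it split over the
  directions.\<close>

lemma kronecker_mat_1_mult_component:
  fixes P :: "real^'n^'n" and w :: "real^('n \<times> 'm::finite)"
  shows "(kronecker P (mat 1 :: real^'m^'m) *v w) $ (i, k) = (\<Sum>j\<in>UNIV. P $ i $ j * w $ (j, k))"
proof -
  have "(kronecker P (mat 1 :: real^'m^'m) *v w) $ (i, k)
      = (\<Sum>q\<in>UNIV \<times> UNIV. P $ i $ fst q * (if k = snd q then 1 else 0) * w $ q)"
    by (simp add: kronecker_def matrix_vector_mult_def mat_def)
  also have "\<dots> = (\<Sum>j\<in>UNIV. \<Sum>l\<in>UNIV. P $ i $ j * (if k = l then 1 else 0) * w $ (j, l))"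
    by (simp add: sum.cartesian_product case_prod_beta)
  also have "\<dots> = (\<Sum>j\<in>UNIV. P $ i $ j * w $ (j, k))"
    by (simp add: if_distrib if_distribR cong: if_cong)
  finally show ?thesis .
qed

context
  fixes \<Omega> :: "(real^'m) set"
  assumes opn: "open \<Omega>" and bnd: "bounded \<Omega>"
begin

lemma test_function_in_L2: "\<phi> \<in> test_functions \<Omega> \<Longrightarrow> \<phi> \<in> L2 \<Omega>"
proof -
  assume \<phi>: "\<phi> \<in> test_functions \<Omega>"
  have "integrable (lebesgue_on \<Omega>) (\<lambda>x. \<phi> x * \<phi> x)"
    by (rule integrable_lebesgue_on_test_function[OF bnd opn test_functions_mult[OF \<phi> \<phi>]])
  then show ?thesis
    using borel_measurable_lebesgue_on[OF test_functions_measurable[OF \<phi>]]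
    by (simp add: L2_def power2_eq_square)
qed

lemma L2_imp_integrable:
  fixes f :: "real^'m \<Rightarrow> real"
  assumes "f \<in> L2 \<Omega>"
  shows "integrable (lebesgue_on \<Omega>) f"
proof -
  interpret finite_measure "lebesgue_on \<Omega>"
    using opn bnd by (intro finite_measure_lebesgue_on lmeasurable_open)
  have "(\<lambda>x. 1 :: real) \<in> L2 \<Omega>"
    by (simp add: L2_def)
  from integrable_inner[OF assms this] show ?thesis by simp
qed

text \<open>The difference of two weak gradients is orthogonal to all test functions, so the
  fundamental lemma applies to each component. This makes the choice in \<open>grad\<close> harmless
  and lets it be computed up to null sets.\<close>

lemma weak_gradient_unique:
  assumes "g1 \<in> L2 \<Omega>" "g2 \<in> L2 \<Omega>" "weak_gradient \<Omega> f g1" "weak_gradient \<Omega> f g2"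
  shows "AE x in lebesgue_on \<Omega>. g1 x = g2 x"
proof -
  let ?M = "lebesgue_on \<Omega>"
  have "AE x in ?M. g1 x $ i - g2 x $ i = 0" for i
  proof (rule fundamental_lemma_calculus_of_variations[OF opn bnd])
    show "integrable ?M (\<lambda>x. g1 x $ i - g2 x $ i)"
      using assms by (intro L2_imp_integrable L2_diff L2_component)
    fix \<phi> assume \<phi>: "\<phi> \<in> test_functions \<Omega>"
    have int: "integrable ?M (\<lambda>x. g x $ i * \<phi> x)" if "g \<in> L2 \<Omega>" for g :: "real^'m \<Rightarrow> real^'m"
      using integrable_inner[OF L2_component[OF that] test_function_in_L2[OF \<phi>]] by simp
    have "(LINT x|?M. g1 x $ i * \<phi> x) = (LINT x|?M. g2 x $ i * \<phi> x)"
      using assms(3)[unfolded weak_gradient_def, rule_format, OF \<phi>, of i]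
        assms(4)[unfolded weak_gradient_def, rule_format, OF \<phi>, of i] by linarith
    then show "(LINT x|?M. (g1 x $ i - g2 x $ i) * \<phi> x) = 0"
      using int[OF assms(1)] int[OF assms(2)] by (simp add: left_diff_distrib)
  qed
  then have "AE x in ?M. \<forall>i. g1 x $ i - g2 x $ i = 0"
    by (intro eventually_all_finite)
  then show ?thesis
    by eventually_elim (simp add: vec_eq_iff)
qed

text \<open>The device by which gradients are computed: a square integrable candidate is exhibited,
  and uniqueness identifies it with the chosen one.\<close>

lemma H1_grad_eqI:
  assumes "f \<in> L2 \<Omega>" "g \<in> L2 \<Omega>" "weak_gradient \<Omega> f g"
  shows "f \<in> H1 \<Omega>" "AE x in lebesgue_on \<Omega>. grad \<Omega> f x = g x"
proof -
  show "f \<in> H1 \<Omega>"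
    using assms by (auto simp: H1_def)
  then show "AE x in lebesgue_on \<Omega>. grad \<Omega> f x = g x"
    using weak_gradient_unique[OF grad_in_L2 assms(2) weak_gradient_grad assms(3)] by simp
qed

lemma test_function_in_H1:
  assumes "\<phi> \<in> test_functions \<Omega>"
  shows "\<phi> \<in> H1 \<Omega>"
  by (rule H1_grad_eqI[OF test_function_in_L2[OF assms] _ weak_gradient_test_function[OF opn bnd assms]])
    (rule L2_vec, simp add: test_function_in_L2 partial_deriv_test_function assms)

lemma
  assumes "f \<in> H1 \<Omega>" "g \<in> H1 \<Omega>"
  shows H1_lincomb: "(\<lambda>x. a * f x + b * g x) \<in> H1 \<Omega>"
    and grad_lincomb: "AE x in lebesgue_on \<Omega>.
      grad \<Omega> (\<lambda>x. a * f x + b * g x) x = a *\<^sub>R grad \<Omega> f x + b *\<^sub>R grad \<Omega> g x"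
proof -
  have *: "(\<lambda>x. a * f x + b * g x) \<in> L2 \<Omega>" "(\<lambda>x. a *\<^sub>R grad \<Omega> f x + b *\<^sub>R grad \<Omega> g x) \<in> L2 \<Omega>"
    "weak_gradient \<Omega> (\<lambda>x. a * f x + b * g x) (\<lambda>x. a *\<^sub>R grad \<Omega> f x + b *\<^sub>R grad \<Omega> g x)"
    using assms L2_add[OF L2_scaleR[of f \<Omega> a] L2_scaleR[of g \<Omega> b]]
    by (auto intro!: L2_add L2_scaleR weak_gradient_lincomb simp: H1_imp_L2 grad_in_L2
        weak_gradient_grad test_function_in_L2)
  show "(\<lambda>x. a * f x + b * g x) \<in> H1 \<Omega>"
    by (rule H1_grad_eqI[OF *])
  show "AE x in lebesgue_on \<Omega>.
      grad \<Omega> (\<lambda>x. a * f x + b * g x) x = a *\<^sub>R grad \<Omega> f x + b *\<^sub>R grad \<Omega> g x"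
    by (rule H1_grad_eqI[OF *])
qed

lemma
  shows zero_in_H1: "(\<lambda>x. 0) \<in> H1 \<Omega>"
    and grad_zero: "AE x in lebesgue_on \<Omega>. grad \<Omega> (\<lambda>x. 0) x = 0"
proof -
  have *: "(\<lambda>x. 0 :: real) \<in> L2 \<Omega>" "(\<lambda>x. 0 :: real^'m) \<in> L2 \<Omega>" "weak_gradient \<Omega> (\<lambda>x. 0) (\<lambda>x. 0)"
    by (auto simp: L2_zero weak_gradient_def)
  show "(\<lambda>x. 0) \<in> H1 \<Omega>"
    by (rule H1_grad_eqI[OF *])
  show "AE x in lebesgue_on \<Omega>. grad \<Omega> (\<lambda>x. 0) x = 0"
    by (rule H1_grad_eqI[OF *])
qed

lemma grad_sum:
  assumes "finite F" "\<And>j. j \<in> F \<Longrightarrow> f j \<in> H1 \<Omega>"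
  shows "AE x in lebesgue_on \<Omega>.
      grad \<Omega> (\<lambda>x. \<Sum>j\<in>F. c j * f j x) x = (\<Sum>j\<in>F. c j *\<^sub>R grad \<Omega> (f j) x)"
proof -
  \<comment> \<open>Membership is proved together with the formula, since linearity of
    \<open>grad\<close> at the next summand requires the partial sum to lie in
    \<open>H1\<close>.\<close>
  have "(\<lambda>x. \<Sum>j\<in>F. c j * f j x) \<in> H1 \<Omega> \<and> (AE x in lebesgue_on \<Omega>.
      grad \<Omega> (\<lambda>x. \<Sum>j\<in>F. c j * f j x) x = (\<Sum>j\<in>F. c j *\<^sub>R grad \<Omega> (f j) x))"
    using assms
  proof (induction F rule: finite_induct)
    case empty
    then show ?case using zero_in_H1 grad_zero by simp
  next
    case (insert k F)
    then have IH: "f k \<in> H1 \<Omega>" "(\<lambda>x. \<Sum>j\<in>F. c j * f j x) \<in> H1 \<Omega>" "AE x in lebesgue_on \<Omega>.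
      grad \<Omega> (\<lambda>x. \<Sum>j\<in>F. c j * f j x) x = (\<Sum>j\<in>F. c j *\<^sub>R grad \<Omega> (f j) x)"
      by auto
    show ?case
      using H1_lincomb[OF IH(1,2), of "c k" 1] grad_lincomb[OF IH(1,2), of "c k" 1] IH(3) insert.hyps
      by (auto elim: eventually_elim2)
  qed
  then show ?thesis ..
qed

lemma H1_norm_lincomb:
  assumes "f \<in> H1 \<Omega>" "g \<in> H1 \<Omega>"
  shows "H1_norm \<Omega> (\<lambda>x. a * f x + b * g x) \<le> \<bar>a\<bar> * H1_norm \<Omega> f + \<bar>b\<bar> * H1_norm \<Omega> g"
proof -
  let ?J = "\<lambda>f x. (f x, grad \<Omega> f x)"
  have L2: "?J f \<in> L2 \<Omega>" "?J g \<in> L2 \<Omega>" "?J (\<lambda>x. a * f x + b * g x) \<in> L2 \<Omega>"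
    using assms H1_lincomb[OF assms, of a b] by (auto intro!: L2_Pair H1_imp_L2 grad_in_L2)
  have "H1_norm \<Omega> (\<lambda>x. a * f x + b * g x) = L2_norm \<Omega> (\<lambda>x. a *\<^sub>R ?J f x + b *\<^sub>R ?J g x)"
    unfolding H1_norm_eq[OF H1_lincomb[OF assms, of a b]]
    by (rule L2_norm_cong[OF L2(3) L2_add[OF L2_scaleR[OF L2(1)] L2_scaleR[OF L2(2)]]])
      (use grad_lincomb[OF assms] in simp)
  also have "\<dots> \<le> L2_norm \<Omega> (\<lambda>x. a *\<^sub>R ?J f x) + L2_norm \<Omega> (\<lambda>x. b *\<^sub>R ?J g x)"
    by (intro L2_norm_triangle L2_scaleR L2)
  finally show ?thesis
    by (simp only: L2_norm_scaleR H1_norm_eq assms)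
qed

section \<open>Zero boundary values, for scalar and for vector functions\<close>

lemma H10_lincomb:
  assumes "f \<in> H10 \<Omega>" "g \<in> H10 \<Omega>"
  shows "(\<lambda>x. a * f x + b * g x) \<in> H10 \<Omega>"
proof -
  have H1: "f \<in> H1 \<Omega>" "g \<in> H1 \<Omega>"
    using assms by (auto intro: H10_imp_H1)
  have "\<exists>\<phi>\<in>test_functions \<Omega>. H1_norm \<Omega> ((\<lambda>x. a * f x + b * g x) - \<phi>) < \<epsilon>" if "\<epsilon> > 0" for \<epsilon>
  proof -
    \<comment> \<open>The 1 keeps the denominator positive when a = b = 0 and makes the final
      estimate strict.\<close>
    define \<delta> where "\<delta> = \<epsilon> / (1 + \<bar>a\<bar> + \<bar>b\<bar>)"
    have "\<delta> > 0"
      using that by (auto simp: \<delta>_def intro!: divide_pos_pos)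
    obtain \<phi> where \<phi>: "\<phi> \<in> test_functions \<Omega>" "H1_norm \<Omega> (f - \<phi>) < \<delta>"
      using assms(1) \<open>\<delta> > 0\<close> by (auto simp: H10_def)
    obtain \<psi> where \<psi>: "\<psi> \<in> test_functions \<Omega>" "H1_norm \<Omega> (g - \<psi>) < \<delta>"
      using assms(2) \<open>\<delta> > 0\<close> by (auto simp: H10_def)
    have diff: "f - \<phi> \<in> H1 \<Omega>" "g - \<psi> \<in> H1 \<Omega>"
      using H1_lincomb[OF H1(1) test_function_in_H1[OF \<phi>(1)], of 1 "-1"]
        H1_lincomb[OF H1(2) test_function_in_H1[OF \<psi>(1)], of 1 "-1"]
      by (simp_all add: fun_diff_def)
    have "(\<lambda>x. a * f x + b * g x) - (\<lambda>x. a * \<phi> x + b * \<psi> x)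
        = (\<lambda>x. a * (f - \<phi>) x + b * (g - \<psi>) x)"
      by (simp add: fun_eq_iff algebra_simps)
    then have "H1_norm \<Omega> ((\<lambda>x. a * f x + b * g x) - (\<lambda>x. a * \<phi> x + b * \<psi> x))
        \<le> \<bar>a\<bar> * H1_norm \<Omega> (f - \<phi>) + \<bar>b\<bar> * H1_norm \<Omega> (g - \<psi>)"
      using H1_norm_lincomb[OF diff] by metis
    also have "\<dots> \<le> \<bar>a\<bar> * \<delta> + \<bar>b\<bar> * \<delta>"
      using \<phi>(2) \<psi>(2) by (intro add_mono mult_left_mono) auto
    also have "\<dots> < (1 + \<bar>a\<bar> + \<bar>b\<bar>) * \<delta>"
      using \<open>\<delta> > 0\<close> by (simp add: algebra_simps)
    also have "\<dots> = \<epsilon>"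
      by (simp add: \<delta>_def add_nonneg_eq_0_iff)
    finally show ?thesis
      using test_functions_lincomb[OF \<phi>(1) \<psi>(1)] by blast
  qed
  with H1_lincomb[OF H1] show ?thesis
    by (auto simp: H10_def)
qed

lemma zero_in_H10: "(\<lambda>x. 0) \<in> H10 \<Omega>"
proof -
  have "(\<lambda>x. 0 :: real) \<in> test_functions \<Omega>"
    by (rule test_functionsI[of _ "{}"]) (auto intro: C_k_const)
  moreover have "H1_norm \<Omega> (\<lambda>x. 0) = 0"
    using H1_norm_lincomb[OF zero_in_H1 zero_in_H1, of 0 0] H1_norm_nonneg[of \<Omega> "\<lambda>x. 0"] by simp
  then have "H1_norm \<Omega> ((\<lambda>x. 0) - (\<lambda>x. 0)) = 0"
    by (simp add: fun_diff_def)
  ultimately show ?thesis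
    using zero_in_H1 by (auto simp: H10_def intro!: bexI[of _ "\<lambda>x. 0"])
qed

lemma H10_sum:
  assumes "finite F" "\<And>j. j \<in> F \<Longrightarrow> f j \<in> H10 \<Omega>"
  shows "(\<lambda>x. \<Sum>j\<in>F. c j * f j x) \<in> H10 \<Omega>"
  using assms
proof (induction F rule: finite_induct)
  case empty
  then show ?case using zero_in_H10 by simp
next
  case (insert k F)
  then have "f k \<in> H10 \<Omega>" "(\<lambda>x. \<Sum>j\<in>F. c j * f j x) \<in> H10 \<Omega>"
    by auto
  from H10_lincomb[OF this, of "c k" 1] show ?case
    using insert.hyps by simp
qed

text \<open>The norm of a component is at most \<open>vH1_norm\<close>, which in turn is at most the
  sum of the component norms. So approximating the vector and approximating its components amount to
  the same, with tolerance \<open>\<epsilon> / ?n\<close> for each component, and linear facts about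
  \<open>H10\<close> carry over to vectors.\<close>

lemma vH10_iff:
  fixes z :: "real^'m \<Rightarrow> real^'n"
  shows "z \<in> vH10 \<Omega> \<longleftrightarrow> (\<forall>i. (\<lambda>x. z x $ i) \<in> H10 \<Omega>)"
proof
  assume z: "z \<in> vH10 \<Omega>"
  show "\<forall>i. (\<lambda>x. z x $ i) \<in> H10 \<Omega>"
  proof
    fix i
    have H1: "(\<lambda>x. z x $ i) \<in> H1 \<Omega>" for i
      using vH10_imp_vH1[OF z] by (simp add: vH1_def)
    have "\<exists>\<phi>\<in>test_functions \<Omega>. H1_norm \<Omega> ((\<lambda>x. z x $ i) - \<phi>) < \<epsilon>" if \<epsilon>: "\<epsilon> > 0" for \<epsilon>
    proof -
      obtain \<phi> where \<phi>: "\<forall>i. (\<lambda>x. \<phi> x $ i) \<in> test_functions \<Omega>" "vH1_norm \<Omega> (z - \<phi>) < \<epsilon>"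
        using z \<epsilon> by (auto simp: vH10_def)
      have "(\<lambda>x. (z - \<phi>) x $ j) \<in> H1 \<Omega>" for j
        using H1_lincomb[OF H1[of j] test_function_in_H1[OF \<phi>(1)[rule_format, of j]], of 1 "-1"] by simp
      then have "z - \<phi> \<in> vH1 \<Omega>"
        by (simp add: vH1_def)
      have "(H1_norm \<Omega> (\<lambda>x. (z - \<phi>) x $ i))\<^sup>2 \<le> (vH1_norm \<Omega> (z - \<phi>))\<^sup>2"
        unfolding vH1_norm_power2[OF \<open>z - \<phi> \<in> vH1 \<Omega>\<close>]
        by (rule member_le_sum) auto
      then have "H1_norm \<Omega> (\<lambda>x. (z - \<phi>) x $ i) < \<epsilon>"
        using \<phi>(2) power2_le_imp_le[OF _ vH1_norm_nonneg] by (meson le_less_trans)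
      then show ?thesis
        using \<phi>(1)[rule_format, of i] by (intro bexI[of _ "\<lambda>x. \<phi> x $ i"]) (simp_all add: fun_diff_def)
    qed
    with H1 show "(\<lambda>x. z x $ i) \<in> H10 \<Omega>"
      by (auto simp: H10_def)
  qed
next
  assume z: "\<forall>i. (\<lambda>x. z x $ i) \<in> H10 \<Omega>"
  then have H1: "(\<lambda>x. z x $ i) \<in> H1 \<Omega>" for i
    by (auto intro: H10_imp_H1)
  have "\<exists>\<phi>. (\<forall>i. (\<lambda>x. \<phi> x $ i) \<in> test_functions \<Omega>) \<and> vH1_norm \<Omega> (z - \<phi>) < \<epsilon>" if "\<epsilon> > 0" for \<epsilon>
  proof -
    let ?n = "real CARD('n)"
    have "\<exists>\<phi>\<in>test_functions \<Omega>. H1_norm \<Omega> ((\<lambda>x. z x $ i) - \<phi>) < \<epsilon> / ?n" for i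
      using z that by (auto simp: H10_def)
    then obtain f where f: "\<And>i. f i \<in> test_functions \<Omega>" "\<And>i. H1_norm \<Omega> ((\<lambda>x. z x $ i) - f i) < \<epsilon> / ?n"
      by metis
    let ?\<phi> = "\<lambda>x. \<chi> i. f i x"
    have eq: "(\<lambda>x. (z - ?\<phi>) x $ i) = (\<lambda>x. z x $ i) - f i" for i
      by (simp add: fun_eq_iff)
    have "(\<lambda>x. (z - ?\<phi>) x $ j) \<in> H1 \<Omega>" for j
      using H1_lincomb[OF H1[of j] test_function_in_H1[OF f(1)[of j]], of 1 "-1"] by simp
    then have "z - ?\<phi> \<in> vH1 \<Omega>"
      by (simp add: vH1_def)
    have "vH1_norm \<Omega> (z - ?\<phi>) = L2_set (\<lambda>i. H1_norm \<Omega> (\<lambda>x. (z - ?\<phi>) x $ i)) UNIV"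
      unfolding L2_set_def using vH1_norm_power2[OF \<open>z - ?\<phi> \<in> vH1 \<Omega>\<close>] vH1_norm_nonneg
      by (metis real_sqrt_unique)
    also have "\<dots> \<le> (\<Sum>i\<in>UNIV. H1_norm \<Omega> (\<lambda>x. (z - ?\<phi>) x $ i))"
      by (intro L2_set_le_sum H1_norm_nonneg)
    also have "\<dots> < (\<Sum>i\<in>(UNIV::'n set). \<epsilon> / ?n)"
      unfolding eq using f(2) by (intro sum_strict_mono) auto
    also have "\<dots> = \<epsilon>" by simp
    finally show ?thesis
      using f(1) by (intro exI[of _ ?\<phi>]) auto
  qed
  with H1 show "z \<in> vH10 \<Omega>"
    by (simp add: vH10_def vH1_def)
qed

lemma vgrad_lincomb:
  assumes "u \<in> vH10 \<Omega>" "w \<in> vH10 \<Omega>"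
  shows "AE x in lebesgue_on \<Omega>.
    vgrad \<Omega> (\<lambda>x. a *\<^sub>R u x + b *\<^sub>R w x) x = a *\<^sub>R vgrad \<Omega> u x + b *\<^sub>R vgrad \<Omega> w x"
proof -
  have H1: "(\<lambda>x. u x $ i) \<in> H1 \<Omega>" "(\<lambda>x. w x $ i) \<in> H1 \<Omega>" for i
    using assms vH10_imp_vH1 by (auto simp: vH1_def)
  have "AE x in lebesgue_on \<Omega>. \<forall>i. grad \<Omega> (\<lambda>x. a * u x $ i + b * w x $ i) x
      = a *\<^sub>R grad \<Omega> (\<lambda>x. u x $ i) x + b *\<^sub>R grad \<Omega> (\<lambda>x. w x $ i) x"
    by (intro eventually_all_finite grad_lincomb H1)
  then show ?thesis
    by eventually_elim (simp add: vec_eq_iff vgrad_def)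
qed

lemma vH10_lincomb:
  "u \<in> vH10 \<Omega> \<Longrightarrow> w \<in> vH10 \<Omega> \<Longrightarrow> (\<lambda>x. a *\<^sub>R u x + b *\<^sub>R w x) \<in> vH10 \<Omega>"
  by (simp add: vH10_iff H10_lincomb)

lemma vH10_diff: "u \<in> vH10 \<Omega> \<Longrightarrow> w \<in> vH10 \<Omega> \<Longrightarrow> u - w \<in> vH10 \<Omega>"
  using vH10_lincomb[of u w 1 "-1"] by (simp add: fun_diff_def)

lemma vgrad_diff:
  "u \<in> vH10 \<Omega> \<Longrightarrow> w \<in> vH10 \<Omega> \<Longrightarrow>
    AE x in lebesgue_on \<Omega>. vgrad \<Omega> (u - w) x = vgrad \<Omega> u x - vgrad \<Omega> w x"
  using vgrad_lincomb[of u w 1 "-1"] by (simp add: fun_diff_def)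

lemma vH1_norm_lincomb:
  assumes "u \<in> vH10 \<Omega>" "w \<in> vH10 \<Omega>"
  shows "vH1_norm \<Omega> (\<lambda>x. a *\<^sub>R u x + b *\<^sub>R w x) \<le> \<bar>a\<bar> * vH1_norm \<Omega> u + \<bar>b\<bar> * vH1_norm \<Omega> w"
proof -
  let ?J = "\<lambda>f x. (f x, vgrad \<Omega> f x)"
  note H1 = vH10_imp_vH1[OF assms(1)] vH10_imp_vH1[OF assms(2)] vH10_imp_vH1[OF vH10_lincomb[OF assms, of a b]]
  have L2: "?J u \<in> L2 \<Omega>" "?J w \<in> L2 \<Omega>" "?J (\<lambda>x. a *\<^sub>R u x + b *\<^sub>R w x) \<in> L2 \<Omega>"
    using H1 by (auto intro!: L2_Pair vH1_imp_L2 vgrad_in_L2)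
  have "vH1_norm \<Omega> (\<lambda>x. a *\<^sub>R u x + b *\<^sub>R w x) = L2_norm \<Omega> (\<lambda>x. a *\<^sub>R ?J u x + b *\<^sub>R ?J w x)"
    unfolding vH1_norm_eq[OF H1(3)]
    by (rule L2_norm_cong[OF L2(3) L2_add[OF L2_scaleR[OF L2(1)] L2_scaleR[OF L2(2)]]])
      (use vgrad_lincomb[OF assms] in simp)
  also have "\<dots> \<le> L2_norm \<Omega> (\<lambda>x. a *\<^sub>R ?J u x) + L2_norm \<Omega> (\<lambda>x. b *\<^sub>R ?J w x)"
    by (intro L2_norm_triangle L2_scaleR L2)
  finally show ?thesis
    by (simp only: L2_norm_scaleR vH1_norm_eq H1)
qed

lemma vH1_norm_diff_triangle:
  assumes "u \<in> vH10 \<Omega>" "v \<in> vH10 \<Omega>" "w \<in> vH10 \<Omega>"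
  shows "vH1_norm \<Omega> (u - w) \<le> vH1_norm \<Omega> (u - v) + vH1_norm \<Omega> (v - w)"
proof -
  have "u - w = (\<lambda>x. 1 *\<^sub>R (u - v) x + 1 *\<^sub>R (v - w) x)"
    by (simp add: fun_eq_iff)
  then show ?thesis
    using vH1_norm_lincomb[OF vH10_diff[OF assms(1,2)] vH10_diff[OF assms(2,3)], of 1 1] by simp
qed

lemma vH1_norm_diff_commute:
  fixes u v :: "real^'m \<Rightarrow> real^'n"
  assumes "u \<in> vH10 \<Omega>" "v \<in> vH10 \<Omega>"
  shows "vH1_norm \<Omega> (u - v) = vH1_norm \<Omega> (v - u)"
proof -
  have *: "vH1_norm \<Omega> (u - v) \<le> vH1_norm \<Omega> (v - u)" if "u \<in> vH10 \<Omega>" "v \<in> vH10 \<Omega>" for u v :: "real^'m \<Rightarrow> real^'n"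
  proof -
    have "u - v = (\<lambda>x. (-1) *\<^sub>R (v - u) x + 0 *\<^sub>R u x)"
      by (simp add: fun_eq_iff)
    then show ?thesis
      using vH1_norm_lincomb[OF vH10_diff[OF that(2,1)] that(1), of "-1" 0] by simp
  qed
  show ?thesis
    using *[OF assms] *[OF assms(2,1)] by simp
qed

lemma
  fixes v :: "'j \<Rightarrow> real^'m \<Rightarrow> real^'n"
  assumes "finite F" "\<And>j. j \<in> F \<Longrightarrow> v j \<in> vH10 \<Omega>"
  shows vH10_sum: "(\<lambda>x. \<Sum>j\<in>F. c j *\<^sub>R v j x) \<in> vH10 \<Omega>"
    and vH1_norm_sum: "vH1_norm \<Omega> (\<lambda>x. \<Sum>j\<in>F. c j *\<^sub>R v j x) \<le> (\<Sum>j\<in>F. \<bar>c j\<bar> * vH1_norm \<Omega> (v j))"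
proof -
  have "(\<lambda>x. \<Sum>j\<in>F. c j *\<^sub>R v j x) \<in> vH10 \<Omega> \<and>
    vH1_norm \<Omega> (\<lambda>x. \<Sum>j\<in>F. c j *\<^sub>R v j x) \<le> (\<Sum>j\<in>F. \<bar>c j\<bar> * vH1_norm \<Omega> (v j))"
    using assms
  proof (induction F rule: finite_induct)
    case empty
    have z: "(\<lambda>x. 0 :: real^'n) \<in> vH10 \<Omega>"
      by (simp add: vH10_iff zero_in_H10)
    then show ?case
      using vH1_norm_lincomb[OF z z, of 0 0] by simp
  next
    case (insert k F)
    then have IH: "v k \<in> vH10 \<Omega>" "(\<lambda>x. \<Sum>j\<in>F. c j *\<^sub>R v j x) \<in> vH10 \<Omega>"
      "vH1_norm \<Omega> (\<lambda>x. \<Sum>j\<in>F. c j *\<^sub>R v j x) \<le> (\<Sum>j\<in>F. \<bar>c j\<bar> * vH1_norm \<Omega> (v j))"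
      by auto
    show ?case
      using vH10_lincomb[OF IH(1,2), of "c k" 1] vH1_norm_lincomb[OF IH(1,2), of "c k" 1] IH(3) insert.hyps
      by simp
  qed
  then show "(\<lambda>x. \<Sum>j\<in>F. c j *\<^sub>R v j x) \<in> vH10 \<Omega>"
    "vH1_norm \<Omega> (\<lambda>x. \<Sum>j\<in>F. c j *\<^sub>R v j x) \<le> (\<Sum>j\<in>F. \<bar>c j\<bar> * vH1_norm \<Omega> (v j))"
    by auto
qed

text \<open>Makes \<open>P z(t)\<close> an admissible test function: every component is a linear
  combination of functions in \<open>H10\<close>.\<close>

lemma vH10_matrix_mult:
  fixes P :: "real^'n^'n"
  assumes "u \<in> vH10 \<Omega>"
  shows "(\<lambda>x. P *v u x) \<in> vH10 \<Omega>"
  using assms unfolding vH10_iff by (auto simp: matrix_vector_mult_def intro!: H10_sum)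

lemma vgrad_matrix_mult:
  fixes P :: "real^'n^'n"
  assumes "u \<in> vH10 \<Omega>"
  shows "AE x in lebesgue_on \<Omega>. vgrad \<Omega> (\<lambda>x. P *v u x) x = kronecker P (mat 1 :: real^'m^'m) *v vgrad \<Omega> u x"
proof -
  have H1: "(\<lambda>x. u x $ i) \<in> H1 \<Omega>" for i
    using assms vH10_imp_vH1 by (auto simp: vH1_def)
  have "AE x in lebesgue_on \<Omega>. \<forall>i. grad \<Omega> (\<lambda>x. \<Sum>j\<in>UNIV. P $ i $ j * u x $ j) x
      = (\<Sum>j\<in>UNIV. P $ i $ j *\<^sub>R grad \<Omega> (\<lambda>x. u x $ j) x)"
    by (intro eventually_all_finite grad_sum H1) auto
  then show ?thesis
  proof eventually_elim
    fix x
    assume *: "\<forall>i. grad \<Omega> (\<lambda>x. \<Sum>j\<in>UNIV. P $ i $ j * u x $ j) x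
      = (\<Sum>j\<in>UNIV. P $ i $ j *\<^sub>R grad \<Omega> (\<lambda>x. u x $ j) x)"
    show "vgrad \<Omega> (\<lambda>x. P *v u x) x = kronecker P (mat 1 :: real^'m^'m) *v vgrad \<Omega> u x"
      by (simp add: vec_eq_iff split_paired_all kronecker_mat_1_mult_component)
        (simp add: vgrad_def matrix_vector_mult_def *)
  qed
qed

lemma vH1_norm_matrix_mult_bound:
  fixes P :: "real^'n^'n"
  obtains K where "K \<ge> 0" "\<And>u. u \<in> vH10 \<Omega> \<Longrightarrow> vH1_norm \<Omega> (\<lambda>x. P *v u x) \<le> K * vH1_norm \<Omega> u"
proof -
  \<comment> \<open>A single linear map acts on the pair of value and stacked gradient, so its
    operator norm bounds the full \<open>vH1_norm\<close> at once.\<close>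
  define h where "h q = (P *v fst q, kronecker P (mat 1 :: real^'m^'m) *v snd q)"
    for q :: "(real^'n) \<times> (real^('n \<times> 'm))"
  have h: "bounded_linear h"
    unfolding h_def
    by (intro bounded_linear_Pair bounded_linear_compose[OF matrix_vector_mul_bounded_linear]
        bounded_linear_fst bounded_linear_snd)
  have "vH1_norm \<Omega> (\<lambda>x. P *v u x) \<le> onorm h * vH1_norm \<Omega> u" if u: "u \<in> vH10 \<Omega>" for u
  proof -
    note H1 = vH10_imp_vH1[OF u] vH10_imp_vH1[OF vH10_matrix_mult[OF u, of P]]
    show ?thesis
      unfolding vH1_norm_eq[OF H1(1)] vH1_norm_eq[OF H1(2)]
    proof (rule L2_norm_mono)
      show "AE x in lebesgue_on \<Omega>. norm (P *v u x, vgrad \<Omega> (\<lambda>x. P *v u x) x)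
          \<le> onorm h * norm (u x, vgrad \<Omega> u x)"
        using vgrad_matrix_mult[OF u, of P]
      proof eventually_elim
        fix x assume "vgrad \<Omega> (\<lambda>x. P *v u x) x = kronecker P (mat 1 :: real^'m^'m) *v vgrad \<Omega> u x"
        then show "norm (P *v u x, vgrad \<Omega> (\<lambda>x. P *v u x) x) \<le> onorm h * norm (u x, vgrad \<Omega> u x)"
          using onorm[OF h, of "(u x, vgrad \<Omega> u x)"] by (simp add: h_def)
      qed
    qed (use H1 onorm_pos_le[OF h] in \<open>auto intro!: L2_Pair vH1_imp_L2 vgrad_in_L2\<close>)
  qed
  with that onorm_pos_le[OF h] show thesis by blast
qed

end

section \<open>The matrix inequalities\<close>

text \<open>The quadratic form attains a positive minimum on the compact unit sphere, and
  homogeneity extends the bound to all vectors.\<close>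

lemma pos_def_coercive:
  fixes M :: "real^'n^'n"
  assumes "pos_def M"
  obtains \<epsilon> where "\<epsilon> > 0" "\<And>x. \<epsilon> * (norm x)\<^sup>2 \<le> x \<bullet> (M *v x)"
proof -
  have "continuous_on (sphere 0 1) (\<lambda>x. x \<bullet> (M *v x))"
    by (intro continuous_intros linear_continuous_on matrix_vector_mul_bounded_linear)
  moreover have "sphere (0 :: real^'n) 1 \<noteq> {}"
    by simp
  ultimately obtain y where y: "y \<in> sphere 0 1" "\<forall>x\<in>sphere 0 1. y \<bullet> (M *v y) \<le> x \<bullet> (M *v x)"
    using continuous_attains_inf[of "sphere 0 1" "\<lambda>x. x \<bullet> (M *v x)"] by auto
  have "y \<noteq> 0"
    using y(1) by auto
  then have "y \<bullet> (M *v y) > 0"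
    using assms by (simp add: pos_def_def)
  moreover have "y \<bullet> (M *v y) * (norm x)\<^sup>2 \<le> x \<bullet> (M *v x)" for x
  proof (cases "x = 0")
    case False
    have "y \<bullet> (M *v y) \<le> (x /\<^sub>R norm x) \<bullet> (M *v (x /\<^sub>R norm x))"
      using False by (intro y(2)[rule_format]) simp
    also have "\<dots> = x \<bullet> (M *v x) / (norm x)\<^sup>2"
      by (simp add: matrix_vector_mult_scaleR power2_eq_square divide_inverse)
    finally show ?thesis
      using False by (simp add: field_simps)
  qed simp
  ultimately show thesis
    using that by blast
qed

lemma quadratic_form_bound:
  fixes M :: "real^'n^'n"
  shows "x \<bullet> (M *v x) \<le> onorm ((*v) M) * (norm x)\<^sup>2"
proof -
  have "x \<bullet> (M *v x) \<le> norm x * norm (M *v x)"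
    by (rule norm_cauchy_schwarz)
  also have "\<dots> \<le> norm x * (onorm ((*v) M) * norm x)"
    by (intro mult_left_mono onorm matrix_vector_mul_bounded_linear) auto
  finally show ?thesis
    by (simp add: power2_eq_square mult_ac)
qed

lemma inner_symmetric_matrix:
  fixes M :: "real^'n^'n"
  assumes "transpose M = M"
  shows "x \<bullet> (M *v y) = (M *v x) \<bullet> y"
  by (metis assms dot_lmul_matrix matrix_vector_mul_linear transpose_matrix_vector)

lemma inner_transpose_matrix:
  fixes M :: "real^'n^'n"
  shows "x \<bullet> (transpose M *v y) = (M *v x) \<bullet> y"
  by (metis dot_lmul_matrix transpose_matrix_vector transpose_transpose)

lemma block_matrix_quadratic_form:
  fixes x y :: "real^'n" and M11 :: "real^'n^'n"
  defines "w \<equiv> \<chi> p. case p of Inl i \<Rightarrow> x $ i | Inr i \<Rightarrow> y $ i"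
  shows "w \<bullet> (block_matrix M11 M12 M21 M22 *v w) =
    x \<bullet> (M11 *v x) + x \<bullet> (M12 *v y) + y \<bullet> (M21 *v x) + y \<bullet> (M22 *v y)"
    and "(norm w)\<^sup>2 = (norm x)\<^sup>2 + (norm y)\<^sup>2"
proof -
  have split: "(\<Sum>p\<in>UNIV. f p) = (\<Sum>i\<in>UNIV. f (Inl i)) + (\<Sum>i\<in>UNIV. f (Inr i))" for f :: "'n + 'n \<Rightarrow> real"
    unfolding UNIV_Plus_UNIV[symmetric] by (subst sum.Plus) (auto simp: comp_def)
  show "w \<bullet> (block_matrix M11 M12 M21 M22 *v w) =
    x \<bullet> (M11 *v x) + x \<bullet> (M12 *v y) + y \<bullet> (M21 *v x) + y \<bullet> (M22 *v y)"
    by (simp add: inner_vec_def matrix_vector_mult_def block_matrix_def w_def split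
        distrib_left sum.distrib)
  show "(norm w)\<^sup>2 = (norm x)\<^sup>2 + (norm y)\<^sup>2"
    by (simp add: power2_norm_eq_inner inner_vec_def w_def split)
qed

text \<open>\<sigma> is the multiplier of the constraint |y| \<le> |x|, as in the S-procedure: the
  block form at (x, y) exceeds the wanted form by \<sigma> (|y|^2 - |x|^2), which is nonpositive.
  The margin \<epsilon> depends neither on B nor on x, so it serves all points of one piece.\<close>

lemma lmi_pointwise:
  fixes P :: "real^'n^'n"
  assumes "transpose P = P" "\<rho> > 0" "\<sigma> > 0"
    and "pos_def (block_matrix (\<Lambda> - \<sigma> *\<^sub>R mat 1 - transpose B0 ** P - P ** B0) (\<rho> *\<^sub>R P)
              (\<rho> *\<^sub>R P) (\<sigma> *\<^sub>R mat 1))"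
  obtains \<epsilon> where "\<epsilon> > 0"
    "\<And>B x. matrix_norm (B - B0) \<le> \<rho> \<Longrightarrow>
       \<epsilon> * (norm x)\<^sup>2 \<le> x \<bullet> (\<Lambda> *v x) - 2 * ((B *v x) \<bullet> (P *v x))"
proof -
  let ?M = "block_matrix (\<Lambda> - \<sigma> *\<^sub>R mat 1 - transpose B0 ** P - P ** B0) (\<rho> *\<^sub>R P)
              (\<rho> *\<^sub>R P) (\<sigma> *\<^sub>R mat 1)"
  obtain \<epsilon> where \<epsilon>: "\<epsilon> > 0" "\<And>w. \<epsilon> * (norm w)\<^sup>2 \<le> w \<bullet> (?M *v w)"
    using pos_def_coercive[OF assms(4)] by blast
  have "\<epsilon> * (norm x)\<^sup>2 \<le> x \<bullet> (\<Lambda> *v x) - 2 * ((B *v x) \<bullet> (P *v x))"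
    if B: "matrix_norm (B - B0) \<le> \<rho>" for B x
  proof -
    define d where "d = (B - B0) *v x"
    have "norm d \<le> matrix_norm (B - B0) * norm x"
      unfolding d_def matrix_norm_def by (rule onorm[OF matrix_vector_mul_bounded_linear])
    also have "\<dots> \<le> \<rho> * norm x"
      using B by (intro mult_right_mono) auto
    finally have "norm d / \<rho> \<le> norm x"
      using assms(2) by (simp add: field_simps)
    \<comment> \<open>Scaled so that the two blocks \<open>\<rho> *\<^sub>R P\<close> together
      contribute -2 d . P x, which replaces B0 by B in the form.\<close>
    define y where "y = - (1 / \<rho>) *\<^sub>R d"
    have y: "norm y \<le> norm x" "\<rho> *\<^sub>R y = - d"
      using \<open>norm d / \<rho> \<le> norm x\<close> assms(2) by (simp_all add: y_def)
    define w :: "real^('n + 'n)" where "w = (\<chi> p. case p of Inl i \<Rightarrow> x $ i | Inr i \<Rightarrow> y $ i)"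
    have symP: "x \<bullet> (P *v (B *v x)) = (B *v x) \<bullet> (P *v x)"
      using inner_symmetric_matrix[OF assms(1)] by (simp add: inner_commute)
    have "\<epsilon> * (norm x)\<^sup>2 \<le> \<epsilon> * (norm w)\<^sup>2"
      using \<epsilon>(1) by (simp add: w_def block_matrix_quadratic_form(2))
    also have "\<dots> \<le> w \<bullet> (?M *v w)"
      by (rule \<epsilon>(2))
    also have "\<dots> = x \<bullet> (\<Lambda> *v x) - \<sigma> * (x \<bullet> x) - x \<bullet> (transpose B0 *v (P *v x)) - x \<bullet> (P *v (B0 *v x))
        + x \<bullet> (P *v (\<rho> *\<^sub>R y)) + (\<rho> *\<^sub>R y) \<bullet> (P *v x) + \<sigma> * (y \<bullet> y)"
      unfolding w_def block_matrix_quadratic_form(1)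
      by (simp add: matrix_vector_mult_diff_rdistrib inner_diff_right scaleR_matrix_vector_assoc[symmetric]
          matrix_vector_mul_assoc matrix_vector_mult_scaleR)
    also have "\<dots> = x \<bullet> (\<Lambda> *v x) - 2 * ((B *v x) \<bullet> (P *v x)) + \<sigma> * ((norm y)\<^sup>2 - (norm x)\<^sup>2)"
      unfolding y(2) inner_transpose_matrix inner_symmetric_matrix[OF assms(1)]
      by (simp add: d_def matrix_vector_mult_diff_rdistrib inner_diff_left inner_diff_right inner_commute
          power2_norm_eq_inner algebra_simps symP)
    also have "\<dots> \<le> x \<bullet> (\<Lambda> *v x) - 2 * ((B *v x) \<bullet> (P *v x))"
      using assms(3) y(1) by (simp add: mult_nonneg_nonpos power_mono)
    finally show ?thesis .
  qed
  with \<epsilon>(1) that show thesis by blast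
qed

lemma diagonal_quadratic_form:
  fixes \<Lambda> :: "real^'n^'n"
  assumes "diagonal_matrix \<Lambda>"
  shows "v \<bullet> (\<Lambda> *v v) = (\<Sum>i\<in>UNIV. \<Lambda> $ i $ i * (v $ i)\<^sup>2)"
proof -
  have "(\<Lambda> *v v) $ i = \<Lambda> $ i $ i * v $ i" for i
  proof -
    have "(\<Lambda> *v v) $ i = (\<Sum>j\<in>UNIV. \<Lambda> $ i $ j * v $ j)"
      by (simp add: matrix_vector_mult_def)
    also have "\<dots> = (\<Sum>j\<in>UNIV. if i = j then \<Lambda> $ i $ j * v $ j else 0)"
      by (rule sum.cong) (use assms in \<open>auto simp: diagonal_matrix_def\<close>)
    finally show ?thesis by simp
  qed
  then show ?thesis
    by (simp add: inner_vec_def power2_eq_square mult_ac)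
qed

text \<open>For each direction k the entries \<open>w $ (i, k)\<close> form one vector, on which a
  Kronecker product with the identity acts as the matrix itself; the semidefinite condition is
  applied to each of them and summed. Diagonality of \<Lambda> regroups the lower bound by
  components i, the form in which the Poincare inequality applies.\<close>

lemma gradient_form_bound:
  fixes A P \<Lambda> :: "real^'n^'n" and w :: "real^('n \<times> 'm::finite)"
  assumes "transpose P = P" "diagonal_matrix \<Lambda>"
    and "pos_semidef (transpose A ** P + P ** A - c\<^sup>2 *\<^sub>R \<Lambda>)"
  shows "c\<^sup>2 * (\<Sum>i\<in>UNIV. \<Lambda> $ i $ i * (\<Sum>k\<in>UNIV. (w $ (i, k))\<^sup>2))
    \<le> 2 * ((kronecker A (mat 1 :: real^'m^'m) *v w) \<bullet> (kronecker P (mat 1 :: real^'m^'m) *v w))"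
proof -
  define y where "y k = (\<chi> i. w $ (i, k))" for k
  have sum: "(\<Sum>p\<in>UNIV. f p) = (\<Sum>k\<in>UNIV. \<Sum>i\<in>UNIV. f (i, k))" for f :: "'n \<times> 'm \<Rightarrow> real"
    unfolding UNIV_Times_UNIV[symmetric] by (subst sum.swap) (simp add: sum.cartesian_product)
  have kron: "(kronecker M (mat 1 :: real^'m^'m) *v w) $ (i, k) = (M *v y k) $ i" for M :: "real^'n^'n" and i k
    by (simp only: kronecker_mat_1_mult_component) (simp add: matrix_vector_mult_def y_def)
  have "c\<^sup>2 * (v \<bullet> (\<Lambda> *v v)) \<le> 2 * ((A *v v) \<bullet> (P *v v))" for v
  proof -
    have "0 \<le> v \<bullet> ((transpose A ** P + P ** A - c\<^sup>2 *\<^sub>R \<Lambda>) *v v)"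
      using assms(3) by (simp add: pos_semidef_def)
    also have "\<dots> = v \<bullet> (transpose A *v (P *v v)) + v \<bullet> (P *v (A *v v)) - c\<^sup>2 * (v \<bullet> (\<Lambda> *v v))"
      by (simp add: matrix_vector_mult_diff_rdistrib matrix_vector_mult_add_rdistrib inner_diff_right
          inner_add_right scaleR_matrix_vector_assoc[symmetric] matrix_vector_mul_assoc)
    also have "\<dots> = 2 * ((A *v v) \<bullet> (P *v v)) - c\<^sup>2 * (v \<bullet> (\<Lambda> *v v))"
      using inner_symmetric_matrix[OF assms(1), of v "A *v v"] inner_transpose_matrix[of v A "P *v v"]
        inner_commute[of "P *v v" "A *v v"] by linarith
    finally show ?thesis by simp
  qed
  then have "(\<Sum>k\<in>UNIV. c\<^sup>2 * (y k \<bullet> (\<Lambda> *v y k))) \<le> (\<Sum>k\<in>UNIV. 2 * ((A *v y k) \<bullet> (P *v y k)))"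
    by (intro sum_mono)
  also have "\<dots> = 2 * ((kronecker A (mat 1 :: real^'m^'m) *v w) \<bullet> (kronecker P (mat 1 :: real^'m^'m) *v w))"
    by (simp add: inner_vec_def sum kron sum_distrib_left)
  also have "(\<Sum>k\<in>UNIV. c\<^sup>2 * (y k \<bullet> (\<Lambda> *v y k))) = c\<^sup>2 * (\<Sum>i\<in>UNIV. \<Lambda> $ i $ i * (\<Sum>k\<in>UNIV. (w $ (i, k))\<^sup>2))"
    unfolding diagonal_quadratic_form[OF assms(2)] by (simp add: y_def sum_distrib_left) (rule sum.swap)
  finally show ?thesis .
qed

section \<open>The bilinear form of the elliptic operator\<close>

text \<open>Signed as the right-hand side of the weak formulation, that is, as the time derivative
  of the inner product of z with v; dissipation therefore means negative values.\<close>

definition bilinear_form ::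
  "(real^'m) set \<Rightarrow> real^'n^'n \<Rightarrow> (real^'m \<Rightarrow> real^'n^'n) \<Rightarrow> (real^'m \<Rightarrow> real^'n) \<Rightarrow> (real^'m \<Rightarrow> real^'n) \<Rightarrow> real" where
  "bilinear_form \<Omega> A B u v =
     - L2_inner \<Omega> (\<lambda>x. kronecker A (mat 1 :: real^'m^'m) *v vgrad \<Omega> u x) (vgrad \<Omega> v)
     + L2_inner \<Omega> (\<lambda>x. B x *v u x) v"

text \<open>The vector y is quantified inside the null set because it will be the value of a
  function at the same point x.\<close>

lemma Linf_matrix_mult_bound:
  fixes B :: "real^'m \<Rightarrow> real^'n^'n"
  assumes "B \<in> Linf_matrix \<Omega>"
  obtains C where "C \<ge> 0" "AE x in lebesgue_on \<Omega>. \<forall>y. norm (B x *v y) \<le> C * norm y"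
proof -
  have "\<forall>i j. \<exists>C. AE x in lebesgue_on \<Omega>. \<bar>B x $ i $ j\<bar> \<le> C"
    using assms by (simp add: Linf_matrix_def)
  then obtain C where C: "\<And>i j. AE x in lebesgue_on \<Omega>. \<bar>B x $ i $ j\<bar> \<le> C i j"
    by metis
  define K where "K = (\<Sum>i\<in>UNIV. \<Sum>j\<in>UNIV. \<bar>C i j\<bar>)"
  have "AE x in lebesgue_on \<Omega>. \<forall>i j. \<bar>B x $ i $ j\<bar> \<le> C i j"
    by (intro eventually_all_finite C)
  then have "AE x in lebesgue_on \<Omega>. \<forall>y. norm (B x *v y) \<le> K * norm y"
  proof eventually_elim
    fix x assume x: "\<forall>i j. \<bar>B x $ i $ j\<bar> \<le> C i j"
    show "\<forall>y. norm (B x *v y) \<le> K * norm y"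
    proof
      fix y
      have "norm (B x *v y) \<le> (\<Sum>i\<in>UNIV. \<bar>(B x *v y) $ i\<bar>)"
        by (rule norm_le_l1_cart)
      also have "\<dots> \<le> (\<Sum>i\<in>UNIV. \<Sum>j\<in>UNIV. \<bar>C i j\<bar> * norm y)"
      proof (rule sum_mono)
        fix i
        have "\<bar>(B x *v y) $ i\<bar> \<le> (\<Sum>j\<in>UNIV. \<bar>B x $ i $ j * y $ j\<bar>)"
          unfolding matrix_vector_mult_def by (simp add: sum_abs)
        also have "\<dots> \<le> (\<Sum>j\<in>UNIV. \<bar>C i j\<bar> * norm y)"
          unfolding abs_mult using x component_le_norm_cart[of y]
          by (intro sum_mono mult_mono) (auto intro: order.trans[OF _ abs_ge_self])
        finally show "\<bar>(B x *v y) $ i\<bar> \<le> (\<Sum>j\<in>UNIV. \<bar>C i j\<bar> * norm y)" .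
      qed
      finally show "norm (B x *v y) \<le> K * norm y"
        by (simp add: K_def sum_distrib_right)
    qed
  qed
  moreover have "K \<ge> 0"
    by (auto simp: K_def intro!: sum_nonneg)
  ultimately show thesis
    using that by blast
qed

lemma borel_measurable_vec:
  fixes f :: "'a \<Rightarrow> real^'n"
  assumes "\<And>i. (\<lambda>x. f x $ i) \<in> borel_measurable M"
  shows "f \<in> borel_measurable M"
  by (subst borel_measurable_euclidean_space) (auto simp: Basis_vec_def inner_axis assms)

lemma L2_Linf_matrix_mult:
  fixes B :: "real^'m \<Rightarrow> real^'n^'n"
  assumes "B \<in> Linf_matrix \<Omega>" "u \<in> L2 \<Omega>"
  shows "(\<lambda>x. B x *v u x) \<in> L2 \<Omega>"
proof -
  obtain C where C: "C \<ge> 0" "AE x in lebesgue_on \<Omega>. \<forall>y. norm (B x *v y) \<le> C * norm y"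
    using Linf_matrix_mult_bound[OF assms(1)] .
  have "(\<lambda>x. B x $ i $ j) \<in> borel_measurable (lebesgue_on \<Omega>)" for i j
    using assms(1) by (simp add: Linf_matrix_def)
  moreover have "(\<lambda>x. u x $ j) \<in> borel_measurable (lebesgue_on \<Omega>)" for j
    using L2_component[OF assms(2)] by (rule L2_measurable)
  ultimately have "(\<lambda>x. B x *v u x) \<in> borel_measurable (lebesgue_on \<Omega>)"
    by (intro borel_measurable_vec) (simp add: matrix_vector_mult_def)
  then show ?thesis
    by (rule L2_dominated[OF assms(2)]) (use C(2) in \<open>auto elim: eventually_mono\<close>)
qed

context
  fixes \<Omega> :: "(real^'m) set" and A :: "real^'n^'n" and B :: "real^'m \<Rightarrow> real^'n^'n"
  assumes opn: "open \<Omega>" and bnd: "bounded \<Omega>" and Linf: "B \<in> Linf_matrix \<Omega>"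
begin

lemma bilinear_form_diff_right:
  assumes "u \<in> vH10 \<Omega>" "v \<in> vH10 \<Omega>" "w \<in> vH10 \<Omega>"
  shows "bilinear_form \<Omega> A B u (v - w) = bilinear_form \<Omega> A B u v - bilinear_form \<Omega> A B u w"
proof -
  note H1 = assms[THEN vH10_imp_vH1] vH10_imp_vH1[OF vH10_diff[OF opn bnd assms(2,3)]]
  note L = H1[THEN vH1_imp_L2] H1[THEN vgrad_in_L2]
  let ?G = "\<lambda>x. kronecker A (mat 1 :: real^'m^'m) *v vgrad \<Omega> u x"
  have G: "?G \<in> L2 \<Omega>"
    by (intro L2_matrix_mult L)
  have "L2_inner \<Omega> ?G (vgrad \<Omega> (v - w)) = L2_inner \<Omega> ?G (\<lambda>x. vgrad \<Omega> v x - vgrad \<Omega> w x)"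
    unfolding L2_inner_def
    by (intro integral_cong_AE borel_measurable_inner borel_measurable_diff L2_measurable G L)
      (use vgrad_diff[OF opn bnd assms(2,3)] in eventually_elim, simp)
  also have "\<dots> = L2_inner \<Omega> ?G (vgrad \<Omega> v) - L2_inner \<Omega> ?G (vgrad \<Omega> w)"
    by (intro L2_inner_diff_right G L)
  finally show ?thesis
    using L2_inner_diff_right[OF L(2,3) L2_Linf_matrix_mult[OF Linf L(1)]]
    by (simp add: bilinear_form_def fun_diff_def)
qed

lemma bilinear_form_diff_left:
  assumes "u \<in> vH10 \<Omega>" "v \<in> vH10 \<Omega>" "w \<in> vH10 \<Omega>"
  shows "bilinear_form \<Omega> A B (u - v) w = bilinear_form \<Omega> A B u w - bilinear_form \<Omega> A B v w"
proof -
  note H1 = assms[THEN vH10_imp_vH1] vH10_imp_vH1[OF vH10_diff[OF opn bnd assms(1,2)]]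
  note L = H1[THEN vH1_imp_L2] H1[THEN vgrad_in_L2]
  let ?G = "\<lambda>u x. kronecker A (mat 1 :: real^'m^'m) *v vgrad \<Omega> u x"
  have G: "?G u \<in> L2 \<Omega>" "?G v \<in> L2 \<Omega>" "?G (u - v) \<in> L2 \<Omega>"
    by (intro L2_matrix_mult L)+
  have "L2_inner \<Omega> (?G (u - v)) (vgrad \<Omega> w) = L2_inner \<Omega> (\<lambda>x. ?G u x - ?G v x) (vgrad \<Omega> w)"
    unfolding L2_inner_def
    by (intro integral_cong_AE borel_measurable_inner borel_measurable_diff L2_measurable G L)
      (use vgrad_diff[OF opn bnd assms(1,2)] in eventually_elim, simp add: matrix_vector_mult_diff_distrib)
  also have "\<dots> = L2_inner \<Omega> (?G u) (vgrad \<Omega> w) - L2_inner \<Omega> (?G v) (vgrad \<Omega> w)"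
    by (intro L2_inner_diff_left G L)
  finally show ?thesis
    using L2_inner_diff_left[OF L2_Linf_matrix_mult[OF Linf L(1)] L2_Linf_matrix_mult[OF Linf L(2)] L(3)]
    by (simp add: bilinear_form_def matrix_vector_mult_diff_distrib)
qed

lemma bilinear_form_bounded:
  obtains K where "K \<ge> 0" "\<And>u v. u \<in> vH10 \<Omega> \<Longrightarrow> v \<in> vH10 \<Omega> \<Longrightarrow>
    \<bar>bilinear_form \<Omega> A B u v\<bar> \<le> K * vH1_norm \<Omega> u * vH1_norm \<Omega> v"
proof -
  let ?N = "kronecker A (mat 1 :: real^'m^'m)"
  obtain C where C: "C \<ge> 0" "AE x in lebesgue_on \<Omega>. \<forall>y. norm (B x *v y) \<le> C * norm y"
    using Linf_matrix_mult_bound[OF Linf] .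
  define D where "D = onorm ((*v) ?N)"
  have D: "D \<ge> 0"
    unfolding D_def by (intro onorm_pos_le matrix_vector_mul_bounded_linear)
  have "\<bar>bilinear_form \<Omega> A B u v\<bar> \<le> (D + C) * vH1_norm \<Omega> u * vH1_norm \<Omega> v"
    if "u \<in> vH10 \<Omega>" "v \<in> vH10 \<Omega>" for u v
  proof -
    note H1 = that[THEN vH10_imp_vH1]
    note L = H1[THEN vH1_imp_L2] H1[THEN vgrad_in_L2]
    have "L2_norm \<Omega> (\<lambda>x. ?N *v vgrad \<Omega> u x) \<le> D * L2_norm \<Omega> (vgrad \<Omega> u)"
      unfolding D_def
      by (intro L2_norm_mono L L2_matrix_mult onorm_pos_le matrix_vector_mul_bounded_linear AE_I2 onorm)
    also have "\<dots> \<le> D * vH1_norm \<Omega> u"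
      by (intro mult_left_mono L2_norm_vgrad_le_vH1_norm D)
    finally have 1: "L2_norm \<Omega> (\<lambda>x. ?N *v vgrad \<Omega> u x) \<le> D * vH1_norm \<Omega> u" .
    have "L2_norm \<Omega> (\<lambda>x. B x *v u x) \<le> C * L2_norm \<Omega> u"
      by (intro L2_norm_mono L L2_Linf_matrix_mult Linf C(1)) (use C(2) in \<open>auto elim: eventually_mono\<close>)
    also have "\<dots> \<le> C * vH1_norm \<Omega> u"
      by (intro mult_left_mono L2_norm_le_vH1_norm C)
    finally have 2: "L2_norm \<Omega> (\<lambda>x. B x *v u x) \<le> C * vH1_norm \<Omega> u" .
    have "\<bar>L2_inner \<Omega> (\<lambda>x. ?N *v vgrad \<Omega> u x) (vgrad \<Omega> v)\<bar>
        \<le> L2_norm \<Omega> (\<lambda>x. ?N *v vgrad \<Omega> u x) * L2_norm \<Omega> (vgrad \<Omega> v)"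
      by (intro L2_Cauchy_Schwarz L2_matrix_mult L)
    also have "\<dots> \<le> D * vH1_norm \<Omega> u * vH1_norm \<Omega> v"
      using 1 D by (intro mult_mono L2_norm_vgrad_le_vH1_norm) (auto simp: L2_norm_nonneg vH1_norm_nonneg)
    finally have 3: "\<bar>L2_inner \<Omega> (\<lambda>x. ?N *v vgrad \<Omega> u x) (vgrad \<Omega> v)\<bar> \<le> D * vH1_norm \<Omega> u * vH1_norm \<Omega> v" .
    have "\<bar>L2_inner \<Omega> (\<lambda>x. B x *v u x) v\<bar> \<le> L2_norm \<Omega> (\<lambda>x. B x *v u x) * L2_norm \<Omega> v"
      by (intro L2_Cauchy_Schwarz L2_Linf_matrix_mult Linf L)
    also have "\<dots> \<le> C * vH1_norm \<Omega> u * vH1_norm \<Omega> v"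
      using 2 C by (intro mult_mono L2_norm_le_vH1_norm) (auto simp: L2_norm_nonneg vH1_norm_nonneg)
    finally show ?thesis
      using 3 by (simp add: bilinear_form_def algebra_simps)
  qed
  with that[of "D + C"] C D show thesis by simp
qed

end

lemma bilinear_form_dissipative:
  fixes \<Omega> :: "(real^'m) set" and A P \<Lambda> :: "real^'n^'n" and Bk :: "nat \<Rightarrow> real^'n^'n"
  assumes opn: "open \<Omega>" and bnd: "bounded \<Omega>" and Linf: "B \<in> Linf_matrix \<Omega>"
    and meas: "\<forall>k\<in>{1..N}. \<Omega>k k \<in> sets lebesgue"
    and cover: "\<Omega> = (\<Union>k\<in>{1..N}. \<Omega>k k)"
    and \<rho>: "\<forall>k\<in>{1..N}. \<rho> k > 0"
    and Bk: "\<forall>k\<in>{1..N}. AE x in lebesgue_on (\<Omega>k k). matrix_norm (B x - Bk k) \<le> \<rho> k"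
    and c: "c > 0"
    and poincare: "\<forall>f\<in>H10 \<Omega>. L2_norm \<Omega> f \<le> c * L2_norm \<Omega> (grad \<Omega> f)"
    and P: "pos_def P" and \<Lambda>: "pos_def \<Lambda>" "diagonal_matrix \<Lambda>"
    and \<sigma>: "\<forall>k\<in>{1..N}. \<sigma> k > 0"
    and block: "\<forall>k\<in>{1..N}. pos_def (block_matrix
              (\<Lambda> - \<sigma> k *\<^sub>R mat 1 - transpose (Bk k) ** P - P ** Bk k) (\<rho> k *\<^sub>R P)
              (\<rho> k *\<^sub>R P) (\<sigma> k *\<^sub>R mat 1))"
    and semidef: "pos_semidef (transpose A ** P + P ** A - c\<^sup>2 *\<^sub>R \<Lambda>)"
  obtains \<epsilon> where "\<epsilon> > 0" "\<And>u. u \<in> vH10 \<Omega> \<Longrightarrow>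
    2 * bilinear_form \<Omega> A B u (\<lambda>x. P *v u x) \<le> - \<epsilon> * (L2_norm \<Omega> u)\<^sup>2"
proof -
  have sym: "transpose P = P"
    using P by (simp add: pos_def_def)
  have "\<exists>\<epsilon>>0. \<forall>B x. matrix_norm (B - Bk k) \<le> \<rho> k \<longrightarrow>
       \<epsilon> * (norm x)\<^sup>2 \<le> x \<bullet> (\<Lambda> *v x) - 2 * ((B *v x) \<bullet> (P *v x))" if "k \<in> {1..N}" for k
    using lmi_pointwise[OF sym \<rho>[rule_format, OF that] \<sigma>[rule_format, OF that] block[rule_format, OF that]]
    by metis
  then obtain e where e: "\<And>k. k \<in> {1..N} \<Longrightarrow> e k > 0"
    "\<And>k B x. k \<in> {1..N} \<Longrightarrow> matrix_norm (B - Bk k) \<le> \<rho> k \<Longrightarrow>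
       e k * (norm x)\<^sup>2 \<le> x \<bullet> (\<Lambda> *v x) - 2 * ((B *v x) \<bullet> (P *v x))"
    by metis
  \<comment> \<open>The inserted 1 keeps the set nonempty; the other elements make \<epsilon> a
    common margin for all pieces.\<close>
  define \<epsilon> where "\<epsilon> = Min (insert 1 (e ` {1..N}))"
  have \<epsilon>: "\<epsilon> > 0" "\<And>k. k \<in> {1..N} \<Longrightarrow> \<epsilon> \<le> e k"
    unfolding \<epsilon>_def using e(1) by (auto simp del: Min_insert simp: Min_gr_iff intro!: Min_le)
  \<comment> \<open>The null sets of the finitely many pieces are merged into one before the pieces
    are glued together.\<close>
  have "AE x in lebesgue. \<forall>k\<in>{1..N}. x \<in> \<Omega>k k \<longrightarrow> matrix_norm (B x - Bk k) \<le> \<rho> k"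
    using Bk meas by (intro AE_finite_allI) (auto simp: AE_restrict_space_iff)
  then have "AE x in lebesgue_on \<Omega>. \<forall>k\<in>{1..N}. x \<in> \<Omega>k k \<longrightarrow> matrix_norm (B x - Bk k) \<le> \<rho> k"
    using opn by (subst AE_restrict_space_iff) (auto elim: eventually_mono)
  then have pointwise: "AE x in lebesgue_on \<Omega>. \<forall>y. \<epsilon> * (norm y)\<^sup>2 \<le> y \<bullet> (\<Lambda> *v y) - 2 * ((B x *v y) \<bullet> (P *v y))"
  proof (rule AE_mp, intro AE_I2 impI allI)
    fix x and y :: "real^'n"
    assume "x \<in> space (lebesgue_on \<Omega>)"
      and *: "\<forall>k\<in>{1..N}. x \<in> \<Omega>k k \<longrightarrow> matrix_norm (B x - Bk k) \<le> \<rho> k"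
    then obtain k where k: "k \<in> {1..N}" "x \<in> \<Omega>k k"
      using cover by auto
    have "\<epsilon> * (norm y)\<^sup>2 \<le> e k * (norm y)\<^sup>2"
      using \<epsilon>(2)[OF k(1)] by (intro mult_right_mono) auto
    also have "\<dots> \<le> y \<bullet> (\<Lambda> *v y) - 2 * ((B x *v y) \<bullet> (P *v y))"
      using e(2)[OF k(1)] * k by blast
    finally show "\<epsilon> * (norm y)\<^sup>2 \<le> y \<bullet> (\<Lambda> *v y) - 2 * ((B x *v y) \<bullet> (P *v y))" .
  qed
  have "2 * bilinear_form \<Omega> A B u (\<lambda>x. P *v u x) \<le> - \<epsilon> * (L2_norm \<Omega> u)\<^sup>2" if u: "u \<in> vH10 \<Omega>" for u
  proof -
    let ?M = "lebesgue_on \<Omega>"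
    let ?KA = "kronecker A (mat 1 :: real^'m^'m)" and ?KP = "kronecker P (mat 1 :: real^'m^'m)"
    note H1 = vH10_imp_vH1[OF u] vH10_imp_vH1[OF vH10_matrix_mult[OF opn bnd u, of P]]
    note L = H1[THEN vH1_imp_L2] H1[THEN vgrad_in_L2]
    have comp: "(\<lambda>x. u x $ i) \<in> H10 \<Omega>" for i
      using u vH10_iff[OF opn bnd] by blast
    let ?g = "\<lambda>i. grad \<Omega> (\<lambda>x. u x $ i)"
    have gL2: "?g i \<in> L2 \<Omega>" for i
      using comp by (intro grad_in_L2 H10_imp_H1)
    \<comment> \<open>Positive diagonal entries allow the Poincare inequality of each component to
      be multiplied by its weight.\<close>
    have \<Lambda>pos: "\<Lambda> $ i $ i > 0" for i
    proof -
      have "axis i 1 \<bullet> (\<Lambda> *v axis i 1) > 0"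
        using \<Lambda>(1) by (simp add: pos_def_def axis_eq_0_iff)
      then show ?thesis
        by (simp add: matrix_vector_mult_basis inner_axis' column_def)
    qed
    have "L2_inner \<Omega> u (\<lambda>x. \<Lambda> *v u x) = (\<Sum>i\<in>UNIV. \<Lambda> $ i $ i * (L2_norm \<Omega> (\<lambda>x. u x $ i))\<^sup>2)"
      unfolding L2_inner_def diagonal_quadratic_form[OF \<Lambda>(2)] L2_norm_power2
      using L2_integrable[OF L2_component[OF L(1)]] by simp
    also have "\<dots> \<le> (\<Sum>i\<in>UNIV. \<Lambda> $ i $ i * (c\<^sup>2 * (L2_norm \<Omega> (?g i))\<^sup>2))"
      using poincare comp \<Lambda>pos L2_norm_nonneg
      by (intro sum_mono mult_left_mono) (auto simp: power_mult_distrib[symmetric] less_imp_le intro!: power_mono)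
    also have "\<dots> = (LINT x|?M. c\<^sup>2 * (\<Sum>i\<in>UNIV. \<Lambda> $ i $ i * (norm (?g i x))\<^sup>2))"
      unfolding L2_norm_power2 using L2_integrable[OF gL2]
      by (simp add: sum_distrib_left mult_ac)
    also have "\<dots> \<le> (LINT x|?M. 2 * ((?KA *v vgrad \<Omega> u x) \<bullet> (?KP *v vgrad \<Omega> u x)))"
    proof (rule integral_mono)
      show "integrable ?M (\<lambda>x. c\<^sup>2 * (\<Sum>i\<in>UNIV. \<Lambda> $ i $ i * (norm (?g i x))\<^sup>2))"
        using L2_integrable[OF gL2] by simp
      show "integrable ?M (\<lambda>x. 2 * ((?KA *v vgrad \<Omega> u x) \<bullet> (?KP *v vgrad \<Omega> u x)))"
        using integrable_inner[OF L2_matrix_mult[OF L(3), of ?KA] L2_matrix_mult[OF L(3), of ?KP]] by simp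
      fix x
      have "(norm (?g i x))\<^sup>2 = (\<Sum>k\<in>UNIV. (vgrad \<Omega> u x $ (i, k))\<^sup>2)" for i
        by (simp add: norm_vec_def L2_set_def sum_nonneg vgrad_def)
      then show "c\<^sup>2 * (\<Sum>i\<in>UNIV. \<Lambda> $ i $ i * (norm (?g i x))\<^sup>2)
          \<le> 2 * ((?KA *v vgrad \<Omega> u x) \<bullet> (?KP *v vgrad \<Omega> u x))"
        using gradient_form_bound[OF sym \<Lambda>(2) semidef, of "vgrad \<Omega> u x"] by simp
    qed
    also have "\<dots> = 2 * L2_inner \<Omega> (\<lambda>x. ?KA *v vgrad \<Omega> u x) (\<lambda>x. ?KP *v vgrad \<Omega> u x)"
      by (simp add: L2_inner_def)
    also have "L2_inner \<Omega> (\<lambda>x. ?KA *v vgrad \<Omega> u x) (\<lambda>x. ?KP *v vgrad \<Omega> u x)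
        = L2_inner \<Omega> (\<lambda>x. ?KA *v vgrad \<Omega> u x) (vgrad \<Omega> (\<lambda>x. P *v u x))"
      unfolding L2_inner_def
      by (intro integral_cong_AE borel_measurable_inner L2_measurable L2_matrix_mult L)
        (use vgrad_matrix_mult[OF opn bnd u, of P] in eventually_elim, simp)
    finally have diffusion: "L2_inner \<Omega> u (\<lambda>x. \<Lambda> *v u x)
        \<le> 2 * L2_inner \<Omega> (\<lambda>x. ?KA *v vgrad \<Omega> u x) (vgrad \<Omega> (\<lambda>x. P *v u x))" .
    have "\<epsilon> * (L2_norm \<Omega> u)\<^sup>2 = (LINT x|?M. \<epsilon> * (norm (u x))\<^sup>2)"
      by (simp add: L2_norm_power2)
    also have "\<dots> \<le> (LINT x|?M. u x \<bullet> (\<Lambda> *v u x) - 2 * ((B x *v u x) \<bullet> (P *v u x)))"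
    proof (rule integral_mono_AE)
      show "integrable ?M (\<lambda>x. \<epsilon> * (norm (u x))\<^sup>2)"
        using L2_integrable[OF L(1)] by simp
      show "integrable ?M (\<lambda>x. u x \<bullet> (\<Lambda> *v u x) - 2 * ((B x *v u x) \<bullet> (P *v u x)))"
        using integrable_inner[OF L(1) L2_matrix_mult[OF L(1), of \<Lambda>]]
          integrable_inner[OF L2_Linf_matrix_mult[OF Linf L(1)] L(2)] by simp
      show "AE x in ?M. \<epsilon> * (norm (u x))\<^sup>2 \<le> u x \<bullet> (\<Lambda> *v u x) - 2 * ((B x *v u x) \<bullet> (P *v u x))"
        using pointwise by eventually_elim blast
    qed
    also have "\<dots> = L2_inner \<Omega> u (\<lambda>x. \<Lambda> *v u x) - 2 * L2_inner \<Omega> (\<lambda>x. B x *v u x) (\<lambda>x. P *v u x)"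
      using integrable_inner[OF L(1) L2_matrix_mult[OF L(1), of \<Lambda>]]
        integrable_inner[OF L2_Linf_matrix_mult[OF Linf L(1)] L(2)]
      by (simp add: L2_inner_def)
    finally show ?thesis
      using diffusion by (simp add: bilinear_form_def)
  qed
  with \<epsilon>(1) that show thesis by blast
qed

section \<open>Functions of time\<close>

text \<open>By completeness of Lebesgue measure; extension by zero moves the question from S to the
  whole space. Later this transfers measurability from the bilinear form to \<open>g t v\<close>,
  which equals it only almost everywhere.\<close>

lemma borel_measurable_lebesgue_on_AE:
  fixes f g :: "'a::euclidean_space \<Rightarrow> real"
  assumes "f \<in> borel_measurable (lebesgue_on S)" "S \<in> sets lebesgue" "AE x in lebesgue_on S. f x = g x"
  shows "g \<in> borel_measurable (lebesgue_on S)"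
proof -
  have "(\<lambda>x. if x \<in> S then f x else 0) \<in> borel_measurable lebesgue"
    using assms(1,2) by (simp add: borel_measurable_if)
  moreover have "AE x in lebesgue. (if x \<in> S then f x else 0) = (if x \<in> S then g x else 0)"
    using assms(2,3) by (subst (asm) AE_restrict_space_iff) (auto elim: eventually_mono)
  ultimately have "(\<lambda>x. if x \<in> S then g x else 0) \<in> borel_measurable lebesgue"
    by (rule borel_measurable_AE)
  then show ?thesis
    using assms(2) by (simp add: borel_measurable_if)
qed

lemma integrable_lebesgue_on_subset:
  fixes f :: "'a::euclidean_space \<Rightarrow> real"
  assumes "integrable (lebesgue_on S) f" "S \<in> sets lebesgue" "U \<in> sets lebesgue" "U \<subseteq> S"
  shows "integrable (lebesgue_on U) f"
proof -
  have "set_integrable lebesgue S f"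
    using assms(1,2) by (simp add: integrable_restrict_space set_integrable_def)
  then have "set_integrable lebesgue U f"
    by (rule set_integrable_subset) (use assms(3,4) in auto)
  then show ?thesis
    using assms(3) by (simp add: integrable_restrict_space set_integrable_def)
qed

lemma continuous_imp_integrable_Ioo:
  fixes f :: "real \<Rightarrow> real"
  assumes "continuous_on {a..b} f"
  shows "integrable (lebesgue_on {a<..<b}) f"
  by (rule integrable_lebesgue_on_subset[OF continuous_imp_integrable_real[OF assms]]) auto

lemma
  fixes f :: "real \<Rightarrow> real"
  assumes "integrable (lebesgue_on {a<..<b}) f"
  shows integral_lebesgue_on_Ioo: "(LINT x|lebesgue_on {a<..<b}. f x) = integral {a..b} f"
    and integrable_lebesgue_on_Ioo: "f integrable_on {a..b}"
proof -
  have "integral\<^sup>L (lebesgue_on {a<..<b}) f = integral {a<..<b} f"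
    using assms by (intro lebesgue_integral_eq_integral) auto
  then show "(LINT x|lebesgue_on {a<..<b}. f x) = integral {a..b} f"
    by (simp add: integral_open_interval_real)
  have "f integrable_on {a<..<b}"
    using assms by (intro integrable_on_lebesgue_on) auto
  then show "f integrable_on {a..b}"
    by (simp add: integrable_on_Icc_iff_Ioo)
qed

lemma integral_mono_AE_Icc:
  fixes f g :: "real \<Rightarrow> real"
  assumes "integrable (lebesgue_on {a<..<b}) f" "integrable (lebesgue_on {a<..<b}) g"
    and "AE x in lebesgue_on {a<..<b}. f x \<le> g x"
  shows "integral {a..b} f \<le> integral {a..b} g"
  using integral_mono_AE[OF assms] by (simp add: integral_lebesgue_on_Ioo assms(1,2))

lemma AE_lebesgue_on_subset:
  assumes "AE x in lebesgue_on S. Q x" "S \<in> sets lebesgue" "U \<in> sets lebesgue" "U \<subseteq> S"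
  shows "AE x in lebesgue_on U. Q x"
  using assms by (simp add: AE_restrict_space_iff) (auto elim: eventually_mono)

text \<open>At such a point the step takes its extreme value 0 or 1, so the derivative is taken at a
  local extremum.\<close>

lemma smooth_step_deriv_eq_0:
  assumes "(smooth_step has_real_derivative d) (at x)" "x \<le> 0 \<or> 1 \<le> x"
  shows "d = 0"
  using assms(2)
proof
  assume "x \<le> 0"
  then show ?thesis
    using smooth_step_bounds
    by (intro DERIV_local_min[OF assms(1), of 1]) (auto simp: smooth_step_le_0)
next
  assume "1 \<le> x"
  then show ?thesis
    using smooth_step_bounds
    by (intro DERIV_local_max[OF assms(1), of 1]) (auto simp: smooth_step_ge_1)
qed

text \<open>For large n the weight \<open>real n * \<rho> (real n * (x - s))\<close> is nonnegative,
  lives on [s, s + 1/n] and integrates to 1: an approximate identity at s.\<close>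

lemma smooth_step_deriv_concentrates:
  fixes w :: "real \<Rightarrow> real"
  assumes \<rho>: "\<And>x. (smooth_step has_real_derivative \<rho> x) (at x)" "\<And>x. \<rho> x \<ge> 0" "continuous_on UNIV \<rho>"
    and s: "0 < s" "s < T" and w: "continuous_on {0..T} w"
  shows "(\<lambda>n. LINT x|lebesgue_on {0<..<T}. real n * \<rho> (real n * (x - s)) * w x) \<longlonglongrightarrow> w s"
proof (rule LIMSEQ_I)
  fix \<eta> :: real assume "\<eta> > 0"
  then have "\<exists>\<delta>>0. \<forall>x\<in>{0..T}. \<bar>x - s\<bar> < \<delta> \<longrightarrow> \<bar>w x - w s\<bar> < \<eta> / 2"
    using w[unfolded continuous_on_iff dist_real_def, rule_format, of s "\<eta> / 2"] s by simp
  then obtain \<delta> where \<delta>: "\<delta> > 0" "\<And>x. x \<in> {0..T} \<Longrightarrow> \<bar>x - s\<bar> < \<delta> \<Longrightarrow> \<bar>w x - w s\<bar> < \<eta> / 2"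
    by blast
  \<comment> \<open>The bound by \<delta> fits the window [s, s + 1/n] to the continuity of w; the
    bound by T - s keeps it below T, so that no mass is lost.\<close>
  obtain m where "inverse (real (Suc m)) < min \<delta> (T - s)"
    using reals_Archimedean[of "min \<delta> (T - s)"] \<delta>(1) s by auto
  then obtain n0 where n0: "n0 > 0" "1 / real n0 < min \<delta> (T - s)"
    by (metis inverse_eq_divide zero_less_Suc)
  have "norm ((LINT x|lebesgue_on {0<..<T}. real n * \<rho> (real n * (x - s)) * w x) - w s) < \<eta>" if "n \<ge> n0" for n
  proof -
    define D where "D x = real n * \<rho> (real n * (x - s))" for x
    have n: "real n > 0" "1 / real n < \<delta>" "1 / real n < T - s"
    proof -
      have "1 / real n \<le> 1 / real n0"
        using that n0(1) by (simp add: frac_le)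
      with n0 that show "real n > 0" "1 / real n < \<delta>" "1 / real n < T - s"
        by auto
    qed
    have D0: "D x \<ge> 0" for x
      using \<rho>(2) by (simp add: D_def)
    have Dcont: "continuous_on {0..T} D"
      unfolding D_def by (intro continuous_intros continuous_on_compose2[OF \<rho>(3)]) auto
    have "((\<lambda>x. smooth_step (real n * (x - s))) has_real_derivative D x) (at x)" for x
      unfolding D_def by (rule DERIV_chain2[OF \<rho>(1), THEN DERIV_cong]) (auto intro!: derivative_eq_intros)
    then have "(D has_integral (smooth_step (real n * (T - s)) - smooth_step (real n * (0 - s)))) {0..T}"
      using s by (intro fundamental_theorem_of_calculus)
        (auto simp: has_real_derivative_iff_has_vector_derivative[symmetric] intro: has_field_derivative_at_within)
    moreover have "real n * (T - s) \<ge> 1" "real n * (0 - s) \<le> 0"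
      using n s by (auto simp: field_simps)
    ultimately have Dint: "(D has_integral 1) {0..T}"
      by (simp add: smooth_step_ge_1 smooth_step_le_0)
    have "norm (integral {0..T} (\<lambda>x. D x * (w x - w s))) \<le> integral {0..T} (\<lambda>x. D x * (\<eta> / 2))"
    proof (rule integral_norm_bound_integral)
      show "(\<lambda>x. D x * (w x - w s)) integrable_on {0..T}" "(\<lambda>x. D x * (\<eta> / 2)) integrable_on {0..T}"
        by (intro integrable_continuous_real continuous_intros Dcont w)+
      fix x assume x: "x \<in> {0..T}"
      show "norm (D x * (w x - w s)) \<le> D x * (\<eta> / 2)"
      proof (cases "0 \<le> real n * (x - s) \<and> real n * (x - s) \<le> 1")
        case True
        then have "\<bar>x - s\<bar> \<le> 1 / real n"
          using n(1) by (auto simp: field_simps zero_le_mult_iff)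
        then have "\<bar>w x - w s\<bar> \<le> \<eta> / 2"
          using \<delta>(2)[OF x] n(2) by linarith
        then show ?thesis
          using mult_left_mono[OF _ D0[of x], of "\<bar>w x - w s\<bar>" "\<eta> / 2"] D0[of x] by (simp add: abs_mult)
      next
        case False
        then have "D x = 0"
          using smooth_step_deriv_eq_0[OF \<rho>(1), of "real n * (x - s)"] by (auto simp: D_def)
        then show ?thesis by simp
      qed
    qed
    also have "\<dots> = \<eta> / 2"
      by (simp add: integral_unique[OF Dint])
    also have "integral {0..T} (\<lambda>x. D x * (w x - w s)) = integral {0..T} (\<lambda>x. D x * w x) - w s"
    proof -
      have "integral {0..T} (\<lambda>x. D x * (w x - w s)) = integral {0..T} (\<lambda>x. D x * w x - D x * w s)"
        by (simp add: right_diff_distrib)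
      also have "\<dots> = integral {0..T} (\<lambda>x. D x * w x) - integral {0..T} (\<lambda>x. D x * w s)"
        by (intro Henstock_Kurzweil_Integration.integral_diff integrable_continuous_real continuous_intros Dcont w)
      finally show ?thesis
        by (simp add: integral_unique[OF Dint])
    qed
    also have "integral {0..T} (\<lambda>x. D x * w x) = (LINT x|lebesgue_on {0<..<T}. D x * w x)"
      by (intro integral_lebesgue_on_Ioo[symmetric] continuous_imp_integrable_Ioo continuous_intros Dcont w)
    finally show ?thesis
      using \<open>\<eta> > 0\<close> by (simp add: D_def)
  qed
  then show "\<exists>n0. \<forall>n\<ge>n0. norm ((LINT x|lebesgue_on {0<..<T}. real n * \<rho> (real n * (x - s)) * w x) - w s) < \<eta>"
    by blast
qed

lemma smooth_step_scaled_tendsto: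
  "(\<lambda>n. smooth_step (real n * d)) \<longlonglongrightarrow> (if d > 0 then 1 else 0)"
proof (cases "d > 0")
  case True
  have "eventually (\<lambda>n. real n * d \<ge> 1) sequentially"
    using True by real_asymp
  then have "eventually (\<lambda>n. smooth_step (real n * d) = 1) sequentially"
    by eventually_elim (simp add: smooth_step_ge_1)
  with True show ?thesis
    by (simp add: tendsto_eventually)
next
  case False
  then have "smooth_step (real n * d) = 0" for n
    by (intro smooth_step_le_0 mult_nonneg_nonpos) auto
  with False show ?thesis by simp
qed

text \<open>The identity is tested with a smooth plateau that rises just after s and falls just
  after t. Its derivative is a difference of two approximate identities and yields w s - w t, while
  the plateau itself converges to the indicator of the interval.\<close>

theorem weak_derivative_imp_integral:
  fixes w f :: "real \<Rightarrow> real"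
  assumes w: "continuous_on {0..T} w" and f: "integrable (lebesgue_on {0<..<T}) f"
    and weak: "\<And>\<phi>. \<phi> \<in> test_functions {0<..<T} \<Longrightarrow>
      (LINT t|lebesgue_on {0<..<T}. deriv \<phi> t * w t) = - (LINT t|lebesgue_on {0<..<T}. \<phi> t * f t)"
    and st: "0 < s" "s < t" "t < T"
  shows "w t - w s = integral {s..t} f"
proof -
  let ?M = "lebesgue_on {0<..<T}"
  obtain \<rho> where \<rho>: "\<And>x. (smooth_step has_real_derivative \<rho> x) (at x)" "\<And>x. \<rho> x \<ge> 0" "continuous_on UNIV \<rho>"
    using smooth_step_deriv_obtain by blast
  define \<phi> where "\<phi> n x = smooth_step (real n * (x - s)) - smooth_step (real n * (x - t))" for n x
  have smooth: "C_k k (\<phi> n)" for k n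
  proof -
    have "C_k k (\<lambda>x::real. smooth_step (x \<bullet> real n + - real n * s) - smooth_step (x \<bullet> real n + - real n * t))"
      by (intro C_k_diff C_k_compose_affine C_k_smooth_step)
    moreover have "\<phi> n = (\<lambda>x. smooth_step (x \<bullet> real n + - real n * s) - smooth_step (x \<bullet> real n + - real n * t))"
      by (auto simp: \<phi>_def algebra_simps)
    ultimately show ?thesis by simp
  qed
  have deriv: "deriv (\<phi> n) x = real n * \<rho> (real n * (x - s)) - real n * \<rho> (real n * (x - t))" for n x
  proof -
    have "((\<lambda>x. smooth_step (real n * (x - a))) has_real_derivative real n * \<rho> (real n * (x - a))) (at x)" for a
      by (rule DERIV_chain2[OF \<rho>(1), THEN DERIV_cong]) (auto intro!: derivative_eq_intros)
    then have "(\<phi> n has_real_derivative real n * \<rho> (real n * (x - s)) - real n * \<rho> (real n * (x - t))) (at x)"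
      unfolding \<phi>_def by (intro DERIV_diff)
    then show ?thesis
      by (rule DERIV_imp_deriv)
  qed
  have test: "\<phi> n \<in> test_functions {0<..<T}" if n: "1 / real n < T - t" "n > 0" for n
  proof (rule test_functionsI[OF smooth, of "{s..t + 1 / n}"])
    show "{s..t + 1 / real n} \<subseteq> {0<..<T}"
      using st n by auto
    fix x assume "x \<notin> {s..t + 1 / real n}"
    then consider "x < s" | "x > t + 1 / n"
      by force
    then show "\<phi> n x = 0"
    proof cases
      case 1
      then have "real n * (x - s) \<le> 0" "real n * (x - t) \<le> 0"
        using st by (auto intro!: mult_nonneg_nonpos)
      then show ?thesis by (simp add: \<phi>_def smooth_step_le_0)
    next
      case 2
      then have "real n * (x - t) \<ge> 1"
        using n by (simp add: field_simps)
      moreover have "real n * (x - s) \<ge> real n * (x - t)"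
        using st by (intro mult_left_mono) auto
      ultimately show ?thesis by (simp add: \<phi>_def smooth_step_ge_1)
    qed
  qed auto
  have \<rho>int: "integrable ?M (\<lambda>x. real n * \<rho> (real n * (x - a)) * w x)" for n a
    by (intro continuous_imp_integrable_Ioo continuous_intros w continuous_on_compose2[OF \<rho>(3)]) auto
  have "(\<lambda>n. (LINT x|?M. real n * \<rho> (real n * (x - s)) * w x) - (LINT x|?M. real n * \<rho> (real n * (x - t)) * w x))
      \<longlonglongrightarrow> w s - w t"
    using st by (intro tendsto_diff smooth_step_deriv_concentrates[OF \<rho>] w) auto
  then have "(\<lambda>n. LINT x|?M. deriv (\<phi> n) x * w x) \<longlonglongrightarrow> w s - w t"
    unfolding deriv left_diff_distrib by (simp add: Bochner_Integration.integral_diff[OF \<rho>int \<rho>int])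
  moreover have "eventually (\<lambda>n. (LINT x|?M. deriv (\<phi> n) x * w x) = - (LINT x|?M. \<phi> n x * f x)) sequentially"
  proof -
    have "eventually (\<lambda>n. 1 / real n < T - t) sequentially"
      using st by real_asymp
    then show ?thesis
      using eventually_gt_at_top[of 0] by eventually_elim (intro weak test)
  qed
  ultimately have "(\<lambda>n. - (LINT x|?M. \<phi> n x * f x)) \<longlonglongrightarrow> w s - w t"
    by (rule Lim_transform_eventually)
  then have lim1: "(\<lambda>n. LINT x|?M. \<phi> n x * f x) \<longlonglongrightarrow> w t - w s"
    using tendsto_minus by fastforce
  have "(\<lambda>n. LINT x|?M. \<phi> n x * f x) \<longlonglongrightarrow> (LINT x|?M. indicator {s<..t} x * f x)"
  proof (rule integral_dominated_convergence[where w = "\<lambda>x. \<bar>f x\<bar>"])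
    show "AE x in ?M. (\<lambda>n. \<phi> n x * f x) \<longlonglongrightarrow> indicator {s<..t} x * f x"
    proof (intro AE_I2 tendsto_mult tendsto_const)
      fix x
      have "(\<lambda>n. \<phi> n x) \<longlonglongrightarrow> (if x - s > 0 then 1 else 0) - (if x - t > 0 then 1 else 0)"
        unfolding \<phi>_def by (intro tendsto_diff smooth_step_scaled_tendsto)
      moreover have "(if x - s > 0 then 1 else 0) - (if x - t > 0 then 1 else 0) = indicat_real {s<..t} x"
        using st by (auto simp: indicator_def)
      ultimately show "(\<lambda>n. \<phi> n x) \<longlonglongrightarrow> indicator {s<..t} x"
        by simp
    qed
    have "\<phi> n \<in> borel_measurable borel" for n
      by (intro borel_measurable_continuous_onI C_k_imp_continuous[OF smooth])
    then have "\<phi> n \<in> borel_measurable ?M" for n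
      by (rule borel_measurable_lebesgue_on)
    then show "(\<lambda>x. \<phi> n x * f x) \<in> borel_measurable ?M" for n
      using f by (intro borel_measurable_times) auto
    have "\<bar>\<phi> n x\<bar> \<le> 1" for n x
      using smooth_step_bounds[of "real n * (x - s)"] smooth_step_bounds[of "real n * (x - t)"]
      by (auto simp: \<phi>_def abs_le_iff)
    then show "AE x in ?M. norm (\<phi> n x * f x) \<le> \<bar>f x\<bar>" for n
      by (intro AE_I2) (simp add: abs_mult mult_left_le_one_le)
    have "indicat_real {s<..t} \<in> borel_measurable ?M"
      by (intro borel_measurable_lebesgue_on borel_measurable_indicator) auto
    then show "(\<lambda>x. indicator {s<..t} x * f x) \<in> borel_measurable ?M"
      using f by (intro borel_measurable_times) auto
  qed (use f in auto)
  with lim1 have "w t - w s = (LINT x|?M. indicator {s<..t} x * f x)"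
    by (rule LIMSEQ_unique)
  \<comment> \<open>Both ramps start at their reference point and go to the right, so the limit
    excludes s and includes t; the single point t is null.\<close>
  also have "\<dots> = (LINT x|?M. indicator {s<..<t} x * f x)"
  proof (rule integral_cong_AE)
    have "AE x in lebesgue. x \<noteq> t"
      by (intro AE_completion AE_lborel_singleton)
    then have "AE x in ?M. x \<noteq> t"
      by (subst AE_restrict_space_iff) (auto elim: eventually_mono)
    then show "AE x in ?M. indicat_real {s<..t} x * f x = indicator {s<..<t} x * f x"
      by eventually_elim (auto simp: indicator_def)
    have "indicat_real A \<in> borel_measurable ?M" if "A \<in> sets borel" for A
      using that by (intro borel_measurable_lebesgue_on borel_measurable_indicator)
    then show "(\<lambda>x. indicat_real {s<..t} x * f x) \<in> borel_measurable ?M"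
        "(\<lambda>x. indicat_real {s<..<t} x * f x) \<in> borel_measurable ?M"
      using f by (auto intro!: borel_measurable_times)
  qed
  also have "\<dots> = (LINT x|lebesgue_on {s<..<t}. f x)"
  proof -
    have "(LINT x|?M. indicator {s<..<t} x * f x) = (LINT x|lebesgue. indicator {0<..<T} x *\<^sub>R (indicator {s<..<t} x * f x))"
      by (subst integral_restrict_space) auto
    also have "\<dots> = (LINT x|lebesgue. indicator {s<..<t} x *\<^sub>R f x)"
      using st by (intro Bochner_Integration.integral_cong) (auto simp: indicator_def)
    also have "\<dots> = (LINT x|lebesgue_on {s<..<t}. f x)"
      by (subst integral_restrict_space) auto
    finally show ?thesis .
  qed
  also have "\<dots> = integral {s..t} f"
    using st by (intro integral_lebesgue_on_Ioo integrable_lebesgue_on_subset[OF f]) auto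
  finally show ?thesis .
qed

text \<open>Averaging an increment over time turns it into a difference of averages near the endpoints, which
  converges to the increment itself; so an error that is only integrable in time contributes only its
  integral.\<close>

lemma averaged_increment_bound:
  fixes W e :: "real \<Rightarrow> real"
  assumes W: "continuous_on {0..T} W"
    and e: "integrable (lebesgue_on {0<..<T}) e" "\<And>t. e t \<ge> 0"
    and "h0 > 0"
    and incr: "\<And>h. 0 < h \<Longrightarrow> h < h0 \<Longrightarrow> AE t in lebesgue_on {h<..<T}. W t - W (t - h) \<le> h * e t"
    and st: "0 < s" "s \<le> t" "t < T"
  shows "W t - W s \<le> (LINT r|lebesgue_on {0<..<T}. e r)"
proof -
  let ?E = "LINT r|lebesgue_on {0<..<T}. e r"
  define \<Phi> where "\<Phi> x = integral {0..x} W" for x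
  have deriv: "(\<Phi> has_real_derivative W x) (at x within {0..T})" if "x \<in> {0..T}" for x
    unfolding \<Phi>_def by (rule integral_has_real_derivative[OF W that])
  have interior: "(\<Phi> has_real_derivative W x) (at x)" if "0 < x" "x < T" for x
    using deriv[of x] that at_within_interior[of x "{0..T}"] by simp
  have quot: "((\<lambda>h. (\<Phi> x - \<Phi> (x - h)) / h) \<longlongrightarrow> W x) (at_right 0)" if "0 < x" "x < T" for x
  proof -
    have "((\<lambda>h. (\<Phi> (x + h) - \<Phi> x) / h) \<longlongrightarrow> W x) (at_left 0)"
      using interior[OF that] by (simp add: DERIV_def filterlim_at_split)
    then have "((\<lambda>h. (\<Phi> (x + - h) - \<Phi> x) / - h) \<longlongrightarrow> W x) (at_right 0)"
      by (simp add: filterlim_at_left_to_right)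
    then show ?thesis
      by (simp add: minus_divide_left[symmetric] minus_divide_right[symmetric] diff_divide_distrib)
  qed
  have "(\<Phi> t - \<Phi> (t - h)) / h - (\<Phi> s - \<Phi> (s - h)) / h \<le> ?E" if h: "0 < h" "h < h0" "h < s" for h
  proof -
    have sub: "{s..t} \<subseteq> {0..T}"
      using st by auto
    have W1: "continuous_on {s..t} W"
      using W sub by (rule continuous_on_subset)
    have W2: "continuous_on {s..t} (\<lambda>r. W (r - h))"
      using st h by (intro continuous_on_compose2[OF W] continuous_intros) auto
    have e': "integrable (lebesgue_on {s<..<t}) e"
      using st by (intro integrable_lebesgue_on_subset[OF e(1)]) auto
    have "(W has_integral \<Phi> t - \<Phi> s) {s..t}"
    proof (rule fundamental_theorem_of_calculus[OF st(2)])
      fix r assume "r \<in> {s..t}"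
      then have "(\<Phi> has_real_derivative W r) (at r within {s..t})"
        using sub by (intro has_field_derivative_subset[OF deriv]) auto
      then show "(\<Phi> has_vector_derivative W r) (at r within {s..t})"
        by (simp add: has_real_derivative_iff_has_vector_derivative)
    qed
    moreover have "((\<lambda>r. W (r - h)) has_integral \<Phi> (t - h) - \<Phi> (s - h)) {s..t}"
    proof (rule fundamental_theorem_of_calculus)
      fix r assume "r \<in> {s..t}"
      then have "(\<Phi> has_real_derivative W (r - h)) (at (r - h))"
        using st h by (intro interior) auto
      then have "((\<lambda>r. \<Phi> (r - h)) has_real_derivative W (r - h)) (at r)"
        by (rule DERIV_chain2[THEN DERIV_cong]) (auto intro!: derivative_eq_intros)
      then show "((\<lambda>r. \<Phi> (r - h)) has_vector_derivative W (r - h)) (at r within {s..t})"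
        by (simp add: has_real_derivative_iff_has_vector_derivative[symmetric] has_field_derivative_at_within)
    qed (rule st)
    ultimately have "((\<lambda>r. W r - W (r - h)) has_integral (\<Phi> t - \<Phi> s) - (\<Phi> (t - h) - \<Phi> (s - h))) {s..t}"
      by (rule has_integral_diff)
    \<comment> \<open>Rearranged, the left side is the integral of W over [t - h, t] minus that over
      [s - h, s]; divided by h, these are averages with limits W t and W s.\<close>
    then have "(\<Phi> t - \<Phi> s) - (\<Phi> (t - h) - \<Phi> (s - h)) = integral {s..t} (\<lambda>r. W r - W (r - h))"
      by (simp add: integral_unique)
    also have "\<dots> \<le> integral {s..t} (\<lambda>r. h * e r)"
    proof (rule integral_mono_AE_Icc)
      show "integrable (lebesgue_on {s<..<t}) (\<lambda>r. W r - W (r - h))"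
        by (intro continuous_imp_integrable_Ioo continuous_intros W1 W2)
      show "integrable (lebesgue_on {s<..<t}) (\<lambda>r. h * e r)"
        using e' by simp
      show "AE r in lebesgue_on {s<..<t}. W r - W (r - h) \<le> h * e r"
        using st h by (intro AE_lebesgue_on_subset[OF incr]) auto
    qed
    also have "\<dots> = h * integral {s..t} e"
      by simp
    also have "integral {s..t} e \<le> integral {0..T} e"
      using st e by (intro integral_subset_le integrable_lebesgue_on_Ioo e') auto
    also have "\<dots> = ?E"
      using e by (simp add: integral_lebesgue_on_Ioo)
    finally have "(\<Phi> t - \<Phi> s) - (\<Phi> (t - h) - \<Phi> (s - h)) \<le> h * ?E"
      using h by simp
    then have "((\<Phi> t - \<Phi> s) - (\<Phi> (t - h) - \<Phi> (s - h))) / h \<le> ?E"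
      using h by (simp add: pos_divide_le_eq mult.commute)
    then show ?thesis
      by (simp add: diff_divide_distrib)
  qed
  then have "eventually (\<lambda>h. (\<Phi> t - \<Phi> (t - h)) / h - (\<Phi> s - \<Phi> (s - h)) / h \<le> ?E) (at_right 0)"
    using st \<open>h0 > 0\<close> by (intro eventually_at_rightI[of 0 "min h0 s"]) auto
  moreover have "((\<lambda>h. (\<Phi> t - \<Phi> (t - h)) / h - (\<Phi> s - \<Phi> (s - h)) / h) \<longlongrightarrow> W t - W s) (at_right 0)"
    using st by (intro tendsto_diff quot) auto
  ultimately show ?thesis
    by (intro tendsto_upperbound) auto
qed

text \<open>V is only continuous, so Gronwall's differential argument is replaced by implicit Euler
  steps. V is nonincreasing, hence its integral over [s, t] is at least (t - s) V t, and V t is at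
  most V s divided by 1 + \<kappa> (t - s). With n steps of length t / n the factor (1 + \<kappa> t
  / n)^n tends to exp (\<kappa> t).\<close>

lemma integral_inequality_imp_exponential_decay:
  fixes V :: "real \<Rightarrow> real"
  assumes V: "continuous_on {0..T} V" "\<And>t. t \<in> {0..T} \<Longrightarrow> V t \<ge> 0" and "\<kappa> > 0"
    and decay: "\<And>s t. 0 < s \<Longrightarrow> s \<le> t \<Longrightarrow> t < T \<Longrightarrow> V t - V s \<le> - \<kappa> * integral {s..t} V"
    and t: "t \<in> {0..T}"
  shows "V t \<le> exp (- \<kappa> * t) * V 0"
proof -
  have mono: "V t \<le> V s" if "0 < s" "s \<le> t" "t < T" for s t
  proof -
    have "integral {s..t} V \<ge> 0"
      using that V by (intro integral_nonneg integrable_continuous_real continuous_on_subset[OF V(1)]) auto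
    then have "\<kappa> * integral {s..t} V \<ge> 0"
      using \<open>\<kappa> > 0\<close> by simp
    then show ?thesis
      using decay[OF that] by simp
  qed
  have step_interior: "V t * (1 + \<kappa> * (t - s)) \<le> V s" if "0 < s" "s \<le> t" "t < T" for s t
  proof -
    have "integral {s..t} (\<lambda>_. V t) \<le> integral {s..t} V"
      using that by (intro integral_le integrable_continuous_real continuous_on_subset[OF V(1)] mono) auto
    then have "(t - s) * V t \<le> integral {s..t} V"
      using that by simp
    then have "\<kappa> * ((t - s) * V t) \<le> \<kappa> * integral {s..t} V"
      using \<open>\<kappa> > 0\<close> by (intro mult_left_mono) auto
    then show ?thesis
      using decay[OF that] by (simp add: algebra_simps)
  qed
  have step: "V t * (1 + \<kappa> * (t - s)) \<le> V s" if st: "0 \<le> s" "s \<le> t" "t \<le> T" for s t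
  proof (cases "s = t")
    case False
    \<comment> \<open>Interior points approaching the endpoints, because the decay inequality is
      given only inside (0, T). The offset 3 makes the shift at most a third of the interval, so
      \<open>a n\<close> stays to the left of \<open>b n\<close>.\<close>
    define a where "a n = s + (t - s) / (real n + 3)" for n
    define b where "b n = t - (t - s) / (real n + 3)" for n
    have ab: "0 < a n" "a n \<le> b n" "b n < T" "a n \<in> {0..T}" "b n \<in> {0..T}" for n
    proof -
      define d where "d = (t - s) / (real n + 3)"
      have "d > 0"
        using False st by (simp add: d_def)
      moreover have "d \<le> (t - s) / 3"
        unfolding d_def by (rule divide_left_mono) (use st in auto)
      moreover have "a n = s + d" "b n = t - d"
        by (simp_all add: a_def b_def d_def)
      ultimately show "0 < a n" "a n \<le> b n" "b n < T" "a n \<in> {0..T}" "b n \<in> {0..T}"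
        using st by simp_all
    qed
    have "(\<lambda>n. (t - s) / (real n + 3)) \<longlonglongrightarrow> 0"
      by real_asymp
    from tendsto_add[OF tendsto_const this, of s] tendsto_diff[OF tendsto_const this, of t]
    have lim: "a \<longlonglongrightarrow> s" "b \<longlonglongrightarrow> t"
      by (simp_all add: a_def[abs_def] b_def[abs_def])
    have "(\<lambda>n. V (a n)) \<longlonglongrightarrow> V s" "(\<lambda>n. V (b n)) \<longlonglongrightarrow> V t"
      using st ab lim by (auto intro!: continuous_on_tendsto_compose[OF V(1)])
    then have "(\<lambda>n. V (b n) * (1 + \<kappa> * (b n - a n))) \<longlonglongrightarrow> V t * (1 + \<kappa> * (t - s))" "(\<lambda>n. V (a n)) \<longlonglongrightarrow> V s"
      by (auto intro!: tendsto_intros lim)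
    then show ?thesis
      by (rule LIMSEQ_le) (use step_interior ab in blast)
  qed simp
  have "V t * (1 + \<kappa> * t / real n) ^ n \<le> V 0" if "n > 0" for n
  proof -
    have "V (real j * (t / n)) * (1 + \<kappa> * t / real n) ^ j \<le> V 0" if "j \<le> n" for j
      using that
    proof (induction j)
      case (Suc j)
      let ?q = "1 + \<kappa> * t / real n"
      have q: "?q \<ge> 0"
        using \<open>\<kappa> > 0\<close> t by simp
      have bound: "real (Suc j) * (t / n) \<le> T"
      proof -
        have "real (Suc j) * (t / n) \<le> real n * (t / n)"
          using Suc.prems t by (intro mult_right_mono) auto
        then show ?thesis
          using t \<open>n > 0\<close> by simp
      qed
      have "V (real (Suc j) * (t / n)) * (1 + \<kappa> * (real (Suc j) * (t / n) - real j * (t / n))) \<le> V (real j * (t / n))"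
      proof (rule step)
        show "0 \<le> real j * (t / n)"
          using t by simp
        show "real j * (t / n) \<le> real (Suc j) * (t / n)"
          using t by (intro mult_right_mono) auto
      qed (rule bound)
      also have "real (Suc j) * (t / n) - real j * (t / n) = t / n"
        by (simp add: distrib_right add_divide_distrib)
      finally have "V (real (Suc j) * (t / n)) * ?q * ?q ^ j \<le> V (real j * (t / n)) * ?q ^ j"
        using q by (intro mult_right_mono) auto
      with Suc show ?case
        by (simp add: mult_ac)
    qed simp
    from this[of n] that show ?thesis by simp
  qed
  then have "eventually (\<lambda>n. V t * (1 + \<kappa> * t / real n) ^ n \<le> V 0) sequentially"
    by (intro eventually_mono[OF eventually_gt_at_top[of "0::nat"]])
  moreover have "(\<lambda>n. V t * (1 + \<kappa> * t / real n) ^ n) \<longlonglongrightarrow> V t * exp (\<kappa> * t)"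
    by (intro tendsto_intros tendsto_exp_limit_sequentially)
  ultimately have "V t * exp (\<kappa> * t) \<le> V 0"
    by (intro tendsto_upperbound) auto
  then show ?thesis
    by (simp add: exp_minus field_simps)
qed

text \<open>Regularity of Lebesgue measure squeezes E between a closed and an open set whose
  difference D is small; a Urysohn function between them has values in [0, 1] and can be wrong only
  on D.\<close>

lemma continuous_approximation_of_indicator:
  fixes E :: "real set"
  assumes "E \<in> sets lebesgue" "\<mu> > 0"
  obtains \<phi> D where "continuous_on UNIV \<phi>" "D \<in> lmeasurable" "measure lebesgue D < \<mu>"
    "\<And>t. \<bar>indicator E t - \<phi> t\<bar> \<le> indicat_real D t"
proof -
  obtain U where U: "open U" "E \<subseteq> U" "U - E \<in> lmeasurable" "emeasure lebesgue (U - E) < ennreal (\<mu> / 2)"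
    using sets_lebesgue_outer_open[OF assms(1), of "\<mu> / 2"] assms(2) by auto
  obtain K where K: "closed K" "K \<subseteq> E" "E - K \<in> lmeasurable" "emeasure lebesgue (E - K) < ennreal (\<mu> / 2)"
    using sets_lebesgue_inner_closed[OF assms(1), of "\<mu> / 2"] assms(2) by auto
  have small: "measure lebesgue (U - E) < \<mu> / 2" "measure lebesgue (E - K) < \<mu> / 2"
    using U(3,4) K(3,4) assms(2) by (simp_all add: emeasure_eq_measure2 ennreal_less_iff)
  have D: "U - K = (U - E) \<union> (E - K)"
    using U(2) K(2) by auto
  have "measure lebesgue (U - K) \<le> measure lebesgue (U - E) + measure lebesgue (E - K)"
    unfolding D using U(3) K(3) by (intro measure_Un_le) auto
  with small have "measure lebesgue (U - K) < \<mu>"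
    by simp
  moreover have "U - K \<in> lmeasurable"
    unfolding D using U(3) K(3) by (rule fmeasurable.Un)
  moreover obtain \<phi> :: "real \<Rightarrow> real" where \<phi>: "continuous_on UNIV \<phi>" "\<And>t. \<phi> t \<in> closed_segment 1 0"
    "\<And>t. t \<in> K \<Longrightarrow> \<phi> t = 1" "\<And>t. t \<in> - U \<Longrightarrow> \<phi> t = 0"
    using Urysohn[of K "- U" "1::real" 0] U(1,2) K(1,2) by auto
  moreover have "\<bar>indicator E t - \<phi> t\<bar> \<le> indicat_real (U - K) t" for t
    using \<phi>(2)[of t] \<phi>(3,4)[of t] U(2) K(2)
    by (auto simp: indicator_def closed_segment_eq_real_ivl)
  ultimately show thesis
    using that by blast
qed

section \<open>Measurability and approximation of Sobolev-valued functions of time\<close>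

lemma borel_measurable_AE_limit:
  fixes g :: "'a::euclidean_space \<Rightarrow> real"
  assumes "\<And>k. f k \<in> borel_measurable (lebesgue_on S)" "S \<in> sets lebesgue"
    and "AE x in lebesgue_on S. (\<lambda>k::nat. f k x) \<longlonglongrightarrow> g x"
  shows "g \<in> borel_measurable (lebesgue_on S)"
proof (rule borel_measurable_lebesgue_on_AE[OF _ assms(2)])
  show "(\<lambda>x. lim (\<lambda>k. f k x)) \<in> borel_measurable (lebesgue_on S)"
    using assms(1) by (rule borel_measurable_lim_metric)
  show "AE x in lebesgue_on S. lim (\<lambda>k. f k x) = g x"
    using assms(3) by eventually_elim (rule limI)
qed

text \<open>Integrability in \<open>Bochner_L2\<close> is stated for the squared norm; for a
  nonnegative function the square root recovers its measurability.\<close>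

lemma borel_measurable_norm_of_power2:
  fixes q :: "'a \<Rightarrow> real"
  assumes "integrable M (\<lambda>t. (q t)\<^sup>2)" "\<And>t. q t \<ge> 0"
  shows "q \<in> borel_measurable M"
proof -
  have "(\<lambda>t. sqrt ((q t)\<^sup>2)) \<in> borel_measurable M"
    using borel_measurable_integrable[OF assms(1)] by measurable
  with assms(2) show ?thesis by simp
qed

context
  fixes \<Omega> :: "(real^'m) set"
  assumes opn: "open \<Omega>" and bnd: "bounded \<Omega>"
begin

lemma vH1_norm_reverse_triangle:
  fixes u v w :: "real^'m \<Rightarrow> real^'n"
  assumes "u \<in> vH10 \<Omega>" "v \<in> vH10 \<Omega>" "w \<in> vH10 \<Omega>"
  shows "\<bar>vH1_norm \<Omega> (v - w) - vH1_norm \<Omega> (u - w)\<bar> \<le> vH1_norm \<Omega> (u - v)"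
  using vH1_norm_diff_triangle[OF opn bnd assms] vH1_norm_diff_triangle[OF opn bnd assms(2,1,3)]
    vH1_norm_diff_commute[OF opn bnd assms(1,2)] by linarith

text \<open>Strong measurability provides simple functions that converge almost everywhere but
  without a common bound. Truncating them by twice the norm of \<open>z t\<close> supplies the
  domination under which the integrals converge.\<close>

lemma Bochner_L2_simple_approximation:
  fixes z :: "real \<Rightarrow> real^'m \<Rightarrow> real^'n"
  assumes z: "z \<in> Bochner_L2 T (vH10 \<Omega>) (vH1_norm \<Omega>)" and "\<eta> > 0"
  obtains u where "simple_function (lebesgue_on {0<..<T}) u" "u ` {0<..<T} \<subseteq> vH10 \<Omega>"
    "integrable (lebesgue_on {0<..<T}) (\<lambda>t. (vH1_norm \<Omega> (z t - u t))\<^sup>2)"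
    "(LINT t|lebesgue_on {0<..<T}. (vH1_norm \<Omega> (z t - u t))\<^sup>2) < \<eta>"
proof -
  let ?M = "lebesgue_on {0<..<T}" and ?p = "vH1_norm \<Omega>"
  have I: "{0<..<T} \<in> sets lebesgue" and space: "space ?M = {0<..<T}"
    by auto
  obtain s where s: "\<And>k. simple_function ?M (s k)" "\<And>k. s k ` space ?M \<subseteq> vH10 \<Omega>"
    and lim: "AE t in ?M. z t \<in> vH10 \<Omega> \<and> (\<lambda>k. ?p (z t - s k t)) \<longlonglongrightarrow> 0"
    using z unfolding Bochner_L2_def strongly_measurable_def by blast
  have z2: "integrable ?M (\<lambda>t. (?p (z t))\<^sup>2)"
    using z by (simp add: Bochner_L2_def)
  have pz: "(\<lambda>t. ?p (z t)) \<in> borel_measurable ?M"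
    by (rule borel_measurable_norm_of_power2[OF z2 vH1_norm_nonneg])
  have zero: "(\<lambda>x. 0 :: real^'n) \<in> vH10 \<Omega>"
    using zero_in_H10[OF opn bnd] by (simp add: vH10_iff[OF opn bnd])
  have pzero: "?p (\<lambda>x. 0 :: real^'n) = 0"
    using vH1_norm_lincomb[OF opn bnd zero zero, of 0 0] vH1_norm_nonneg[of \<Omega> "\<lambda>x. 0 :: real^'n"] by simp
  \<comment> \<open>Where the norm of \<open>z t\<close> is positive, the factor 2 makes the
    truncation inactive for large k; where it is zero, the truncated functions have norm zero as
    well. In both cases the error is at most 3 times the norm of \<open>z t\<close>.\<close>
  define u where "u k t = (if ?p (s k t) \<le> 2 * ?p (z t) then s k t else (\<lambda>x. 0))" for k t
  have u: "simple_function ?M (u k)" for k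
    unfolding u_def
  proof (rule simple_function_If)
    have "(\<lambda>t. ?p (s k t)) \<in> borel_measurable ?M"
      using borel_measurable_simple_function[OF simple_function_compose[OF s(1), of ?p]] by (simp add: comp_def)
    then show "{t \<in> space ?M. ?p (s k t) \<le> 2 * ?p (z t)} \<in> sets ?M"
      using pz by (intro borel_measurable_le) auto
  qed (use s in auto)
  have uX: "u k ` {0<..<T} \<subseteq> vH10 \<Omega>" for k
    using s(2)[of k] zero by (auto simp: u_def)
  \<comment> \<open>The distance to z is reached as an almost everywhere limit of distances between
    simple functions, by the reverse triangle inequality.\<close>
  have meas: "(\<lambda>t. ?p (z t - u k t)) \<in> borel_measurable ?M" for k
  proof (rule borel_measurable_AE_limit[OF _ I])
    show "(\<lambda>t. ?p (s j t - u k t)) \<in> borel_measurable ?M" for j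
      using borel_measurable_simple_function[OF simple_function_compose2[OF s(1) u, of "\<lambda>a b. ?p (a - b)"]] .
    show "AE t in ?M. (\<lambda>j. ?p (s j t - u k t)) \<longlonglongrightarrow> ?p (z t - u k t)"
      using lim AE_space
    proof eventually_elim
      fix t assume t: "z t \<in> vH10 \<Omega> \<and> (\<lambda>k. ?p (z t - s k t)) \<longlonglongrightarrow> 0" "t \<in> space ?M"
      then have X: "z t \<in> vH10 \<Omega>" "\<And>j. s j t \<in> vH10 \<Omega>" "u k t \<in> vH10 \<Omega>"
        using image_subset_iff[THEN iffD1, OF s(2)] image_subset_iff[THEN iffD1, OF uX] space by auto
      have "(\<lambda>j. ?p (s j t - u k t) - ?p (z t - u k t)) \<longlonglongrightarrow> 0"
      proof (rule Lim_null_comparison)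
        show "eventually (\<lambda>j. norm (?p (s j t - u k t) - ?p (z t - u k t)) \<le> ?p (z t - s j t)) sequentially"
          using vH1_norm_reverse_triangle[OF X(1,2,3)] by simp
      qed (use t(1) in simp)
      then show "(\<lambda>j. ?p (s j t - u k t)) \<longlonglongrightarrow> ?p (z t - u k t)"
        by (simp add: LIM_zero_iff)
    qed
  qed
  have bound: "?p (z t - u k t) \<le> 3 * ?p (z t)" if "z t \<in> vH10 \<Omega>" "t \<in> {0<..<T}" for k t
  proof -
    have "?p (z t - u k t) \<le> ?p (z t) + ?p (u k t)"
      using vH1_norm_lincomb[OF opn bnd that(1), of "u k t" 1 "-1"]
        image_subset_iff[THEN iffD1, OF uX, rule_format, OF that(2), of k]
      by (simp add: fun_diff_def)
    moreover have "?p (u k t) \<le> 2 * ?p (z t)"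
      by (auto simp: u_def pzero vH1_norm_nonneg)
    ultimately show ?thesis by linarith
  qed
  have conv: "AE t in ?M. (\<lambda>k. (?p (z t - u k t))\<^sup>2) \<longlonglongrightarrow> 0"
    using lim AE_space
  proof eventually_elim
    fix t assume t: "z t \<in> vH10 \<Omega> \<and> (\<lambda>k. ?p (z t - s k t)) \<longlonglongrightarrow> 0" "t \<in> space ?M"
    then have X: "z t \<in> vH10 \<Omega>" "\<And>j. s j t \<in> vH10 \<Omega>" "t \<in> {0<..<T}"
      using image_subset_iff[THEN iffD1, OF s(2)] space by auto
    have "(\<lambda>k. ?p (z t - u k t)) \<longlonglongrightarrow> 0"
    proof (cases "?p (z t) = 0")
      case True
      then have "?p (z t - u k t) = 0" for k
        using bound[OF X(1,3), of k] vH1_norm_nonneg[of \<Omega> "z t - u k t"] by simp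
      then show ?thesis by simp
    next
      case False
      then have "?p (z t) > 0"
        using vH1_norm_nonneg[of \<Omega> "z t"] by simp
      then have "eventually (\<lambda>k. ?p (z t - s k t) < ?p (z t)) sequentially"
        using t(1) by (auto intro: order_tendstoD(2))
      then have "eventually (\<lambda>k. ?p (z t - s k t) = ?p (z t - u k t)) sequentially"
      proof eventually_elim
        fix k assume k: "?p (z t - s k t) < ?p (z t)"
        have "s k t = (\<lambda>x. 1 *\<^sub>R z t x + (-1) *\<^sub>R (z t - s k t) x)"
          by (simp add: fun_eq_iff)
        then have "?p (s k t) \<le> ?p (z t) + ?p (z t - s k t)"
          using vH1_norm_lincomb[OF opn bnd X(1) vH10_diff[OF opn bnd X(1,2)], of 1 "-1" k] by simp
        with k show "?p (z t - s k t) = ?p (z t - u k t)"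
          by (simp add: u_def)
      qed
      then show ?thesis
        using t(1) by (auto intro: Lim_transform_eventually)
    qed
    from tendsto_power[OF this, of 2] show "(\<lambda>k. (?p (z t - u k t))\<^sup>2) \<longlonglongrightarrow> 0"
      by simp
  qed
  have dom: "AE t in ?M. norm ((?p (z t - u k t))\<^sup>2) \<le> 9 * (?p (z t))\<^sup>2" for k
    using lim AE_space
  proof eventually_elim
    fix t assume t: "z t \<in> vH10 \<Omega> \<and> (\<lambda>k. ?p (z t - s k t)) \<longlonglongrightarrow> 0" "t \<in> space ?M"
    then have "(?p (z t - u k t))\<^sup>2 \<le> (3 * ?p (z t))\<^sup>2"
      using bound[of t k] space by (intro power_mono) (auto simp: vH1_norm_nonneg)
    then show "norm ((?p (z t - u k t))\<^sup>2) \<le> 9 * (?p (z t))\<^sup>2"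
      by (simp add: power_mult_distrib)
  qed
  have "(\<lambda>k. LINT t|?M. (?p (z t - u k t))\<^sup>2) \<longlonglongrightarrow> (LINT t|?M. 0)"
    by (rule integral_dominated_convergence[where w = "\<lambda>t. 9 * (?p (z t))\<^sup>2"])
      (use z2 meas conv dom in auto)
  then have "eventually (\<lambda>k. (LINT t|?M. (?p (z t - u k t))\<^sup>2) < \<eta>) sequentially"
    using \<open>\<eta> > 0\<close> by (auto intro: order_tendstoD(2))
  then obtain k where "(LINT t|?M. (?p (z t - u k t))\<^sup>2) < \<eta>"
    by (auto simp: eventually_sequentially)
  moreover have "integrable ?M (\<lambda>t. (?p (z t - u k t))\<^sup>2)"
    by (rule Bochner_Integration.integrable_bound[of ?M "\<lambda>t. 9 * (?p (z t))\<^sup>2"])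
      (use z2 meas dom[of k] in auto)
  ultimately show thesis
    using that[OF u uX] by blast
qed

text \<open>The approximation error is only required to have an integrable majorant, which avoids a proof that
  the error itself is measurable.\<close>

lemma Bochner_L2_continuous_approximation:
  fixes z :: "real \<Rightarrow> real^'m \<Rightarrow> real^'n"
  assumes z: "z \<in> Bochner_L2 T (vH10 \<Omega>) (vH1_norm \<Omega>)" and "\<eta> > 0"
  obtains y e where "integrable (lebesgue_on {0<..<T}) e" "\<And>t. e t \<ge> 0"
    "(LINT t|lebesgue_on {0<..<T}. e t) < \<eta>"
    "AE t in lebesgue_on {0<..<T}. (vH1_norm \<Omega> (z t - y t))\<^sup>2 \<le> e t"
    "\<And>t. y t \<in> vH10 \<Omega>"
    "\<And>\<kappa>. \<kappa> > 0 \<Longrightarrow> \<exists>\<delta>>0. \<forall>r\<in>{0..T}. \<forall>t\<in>{0..T}. \<bar>t - r\<bar> < \<delta> \<longrightarrow> vH1_norm \<Omega> (y t - y r) < \<kappa>"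
proof -
  let ?M = "lebesgue_on {0<..<T}" and ?p = "vH1_norm \<Omega>"
  have space: "space ?M = {0<..<T}"
    by auto
  interpret finite_measure ?M
    by (intro finite_measure_lebesgue_on) auto
  obtain u where u: "simple_function ?M u" "u ` {0<..<T} \<subseteq> vH10 \<Omega>"
    and u2: "integrable ?M (\<lambda>t. (?p (z t - u t))\<^sup>2)" "(LINT t|?M. (?p (z t - u t))\<^sup>2) < \<eta> / 4"
    using Bochner_L2_simple_approximation[OF z, of "\<eta> / 4"] \<open>\<eta> > 0\<close> by auto
  have zX: "AE t in ?M. z t \<in> vH10 \<Omega>"
    using z by (auto simp: Bochner_L2_def strongly_measurable_def elim: eventually_mono)
  define F where "F = u ` {0<..<T}"
  have F: "finite F" "\<And>v. v \<in> F \<Longrightarrow> v \<in> vH10 \<Omega>"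
    using simple_functionD(1)[OF u(1)] u(2) by (auto simp: F_def)
  define E where "E v = u -` {v} \<inter> {0<..<T}" for v
  have E: "E v \<in> sets lebesgue" for v
  proof -
    have "E v \<in> sets ?M"
      using simple_functionD(2)[OF u(1), of "{v}"] by (simp add: E_def)
    then show ?thesis
      by (simp add: sets_restrict_space_iff)
  qed
  define C where "C = (\<Sum>v\<in>F. ?p v)"
  have C: "C \<ge> 0"
    by (simp add: C_def sum_nonneg vH1_norm_nonneg)
  \<comment> \<open>Chosen so that the sets \<open>D v\<close> contribute
    \<open>2 * C * (C * \<mu>)\<close>, at most half of \<eta>; adding 1 avoids division by zero
    when C = 0.\<close>
  define \<mu> where "\<mu> = \<eta> / (4 * (C\<^sup>2 + 1))"
  have \<mu>: "\<mu> > 0" "2 * C\<^sup>2 * \<mu> \<le> \<eta> / 2"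
  proof -
    show "\<mu> > 0"
      using \<open>\<eta> > 0\<close> by (auto simp: \<mu>_def intro!: divide_pos_pos add_nonneg_pos)
    have "C\<^sup>2 + 1 > 0"
      by (intro add_nonneg_pos) auto
    then have "4 * (C\<^sup>2 + 1) * \<mu> = \<eta>"
      by (simp add: \<mu>_def)
    then have "4 * (C\<^sup>2 * \<mu>) + 4 * \<mu> = \<eta>"
      by (simp add: algebra_simps)
    with \<open>\<mu> > 0\<close> show "2 * C\<^sup>2 * \<mu> \<le> \<eta> / 2"
      by simp
  qed
  have "\<exists>\<phi> D. continuous_on UNIV \<phi> \<and> D \<in> lmeasurable \<and> measure lebesgue D < \<mu> \<and>
      (\<forall>t. \<bar>indicator (E v) t - \<phi> t\<bar> \<le> indicat_real D t)" for v
    by (rule continuous_approximation_of_indicator[OF E \<mu>(1)]) blast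
  then obtain \<phi> D where \<phi>: "\<And>v. continuous_on UNIV (\<phi> v)"
    and D: "\<And>v. D v \<in> lmeasurable" "\<And>v. measure lebesgue (D v) < \<mu>"
    and \<phi>D: "\<And>v t. \<bar>indicator (E v) t - \<phi> v t\<bar> \<le> indicat_real (D v) t"
    by metis
  \<comment> \<open>The values of the simple function u are kept, and the indicators of its level
    sets are replaced by continuous functions of time.\<close>
  define y where "y t = (\<lambda>x. \<Sum>v\<in>F. \<phi> v t *\<^sub>R v x)" for t
  define S where "S t = (\<Sum>v\<in>F. indicat_real (D v) t * ?p v)" for t
  \<comment> \<open>From (a + S)^2 \<le> 2 a^2 + 2 S^2 and S^2 \<le> C S: the majorant becomes
    linear in S, whose integral is small.\<close>
  define e where "e t = 2 * (?p (z t - u t))\<^sup>2 + 2 * C * S t" for t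
  have S: "0 \<le> S t" "S t \<le> C" for t
  proof -
    show "0 \<le> S t"
      by (simp add: S_def sum_nonneg vH1_norm_nonneg)
    show "S t \<le> C"
      unfolding S_def C_def
      by (intro sum_mono mult_left_le_one_le) (auto simp: vH1_norm_nonneg indicator_def)
  qed
  have indD: "integrable ?M (indicat_real (D v))" "(LINT t|?M. indicat_real (D v) t) \<le> \<mu>" for v
  proof -
    have Dv: "D v \<in> sets lebesgue"
      using D(1) by blast
    have "indicat_real (D v) \<in> borel_measurable ?M"
      using Dv by (intro measurable_restrict_space1 borel_measurable_indicator)
    then show "integrable ?M (indicat_real (D v))"
      by (intro integrable_const_bound[of _ 1]) (auto simp: indicator_def)
    have "(LINT t|?M. indicat_real (D v) t) = (LINT t|lebesgue. indicator {0<..<T} t *\<^sub>R indicat_real (D v) t)"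
      by (subst integral_restrict_space) auto
    also have "\<dots> \<le> (LINT t|lebesgue. indicat_real (D v) t)"
    proof (rule integral_mono')
      show "integrable lebesgue (indicat_real (D v))"
        using D(1)[of v] by (intro integrable_real_indicator) (auto simp: fmeasurable_def)
    qed (auto simp: indicator_def)
    also have "\<dots> = measure lebesgue (D v)"
      using Dv by simp
    finally show "(LINT t|?M. indicat_real (D v) t) \<le> \<mu>"
      using D(2)[of v] by simp
  qed
  have Sint: "integrable ?M S"
    unfolding S_def using indD(1) by simp
  have SC: "(LINT t|?M. S t) \<le> C * \<mu>"
  proof -
    have "(LINT t|?M. S t) = (\<Sum>v\<in>F. (LINT t|?M. indicat_real (D v) t) * ?p v)"
      unfolding S_def using indD(1) by (subst Bochner_Integration.integral_sum) auto
    also have "\<dots> \<le> (\<Sum>v\<in>F. \<mu> * ?p v)"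
      by (intro sum_mono mult_right_mono indD(2) vH1_norm_nonneg)
    finally show ?thesis
      by (simp add: C_def sum_distrib_left mult.commute)
  qed
  show thesis
  proof (rule that)
    show "integrable ?M e"
      unfolding e_def using u2(1) Sint by simp
    show "e t \<ge> 0" for t
      using S C by (simp add: e_def)
    have "(LINT t|?M. e t) = 2 * (LINT t|?M. (?p (z t - u t))\<^sup>2) + 2 * C * (LINT t|?M. S t)"
      unfolding e_def using u2(1) Sint by simp
    also have "\<dots> < 2 * (\<eta> / 4) + 2 * C * (C * \<mu>)"
      using u2(2) SC C by (intro add_less_le_mono mult_left_mono) auto
    also have "\<dots> \<le> \<eta>"
      using \<mu>(2) by (simp add: power2_eq_square mult_ac)
    finally show "(LINT t|?M. e t) < \<eta>" .
    show yX: "y t \<in> vH10 \<Omega>" for t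
      unfolding y_def by (intro vH10_sum[OF opn bnd] F)
    show "AE t in ?M. (?p (z t - y t))\<^sup>2 \<le> e t"
      using zX AE_space
    proof eventually_elim
      fix t assume t: "z t \<in> vH10 \<Omega>" "t \<in> space ?M"
      then have uF: "u t \<in> F" "t \<in> {0<..<T}"
        using space by (auto simp: F_def)
      have "u t - y t = (\<lambda>x. \<Sum>v\<in>F. (indicator (E v) t - \<phi> v t) *\<^sub>R v x)"
      proof
        fix x
        have "(\<Sum>v\<in>F. indicat_real (E v) t *\<^sub>R v x) = (\<Sum>v\<in>F. if v = u t then u t x else 0)"
          using uF(2) by (intro sum.cong) (auto simp: E_def indicator_def)
        also have "\<dots> = u t x"
          using F(1) uF(1) by simp
        finally show "(u t - y t) x = (\<Sum>v\<in>F. (indicator (E v) t - \<phi> v t) *\<^sub>R v x)"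
          by (simp add: y_def scaleR_diff_left sum_subtractf)
      qed
      then have "?p (u t - y t) \<le> (\<Sum>v\<in>F. \<bar>indicator (E v) t - \<phi> v t\<bar> * ?p v)"
        using vH1_norm_sum[OF opn bnd F, of "\<lambda>v. v" "\<lambda>v. indicator (E v) t - \<phi> v t"] by simp
      also have "\<dots> \<le> S t"
        unfolding S_def by (intro sum_mono mult_right_mono \<phi>D vH1_norm_nonneg)
      finally have uy: "?p (u t - y t) \<le> S t" .
      have "?p (z t - y t) \<le> ?p (z t - u t) + ?p (u t - y t)"
        using t uF(1) F(2) yX by (intro vH1_norm_diff_triangle[OF opn bnd]) auto
      also have "\<dots> \<le> ?p (z t - u t) + S t"
        using uy by simp
      finally have "(?p (z t - y t))\<^sup>2 \<le> (?p (z t - u t) + S t)\<^sup>2"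
        by (intro power_mono vH1_norm_nonneg)
      also have "\<dots> \<le> 2 * (?p (z t - u t))\<^sup>2 + 2 * (S t)\<^sup>2"
        using sum_squares_bound[of "?p (z t - u t)" "S t"] by (simp add: power2_sum)
      also have "\<dots> \<le> e t"
        using mult_right_mono[OF S(2) S(1), of t t] by (simp add: e_def power2_eq_square)
      finally show "(?p (z t - y t))\<^sup>2 \<le> e t" .
    qed
    fix \<kappa> :: real assume "\<kappa> > 0"
    \<comment> \<open>g vanishes on the diagonal and dominates the distance between two values of y,
      so its uniform continuity on the compact square gives a modulus of continuity for y.\<close>
    define g where "g q = (\<Sum>v\<in>F. \<bar>\<phi> v (fst q) - \<phi> v (snd q)\<bar> * ?p v)" for q
    have "continuous_on ({0..T} \<times> {0..T}) g"
      unfolding g_def by (intro continuous_intros continuous_on_compose2[OF \<phi>]) auto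
    then have "uniformly_continuous_on ({0..T} \<times> {0..T}) g"
      by (intro compact_uniformly_continuous compact_Times) auto
    then have "\<exists>\<delta>>0. \<forall>q\<in>{0..T} \<times> {0..T}. \<forall>q'\<in>{0..T} \<times> {0..T}.
        dist q' q < \<delta> \<longrightarrow> dist (g q') (g q) < \<kappa>"
      using \<open>\<kappa> > 0\<close> by (simp only: uniformly_continuous_on_def)
    then obtain \<delta> where \<delta>: "\<delta> > 0" "\<forall>q\<in>{0..T} \<times> {0..T}. \<forall>q'\<in>{0..T} \<times> {0..T}.
        dist q' q < \<delta> \<longrightarrow> dist (g q') (g q) < \<kappa>"
      by (elim exE conjE)
    have "?p (y t - y r) < \<kappa>" if "r \<in> {0..T}" "t \<in> {0..T}" "\<bar>t - r\<bar> < \<delta>" for r t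
    proof -
      have "y t - y r = (\<lambda>x. \<Sum>v\<in>F. (\<phi> v t - \<phi> v r) *\<^sub>R v x)"
        by (simp add: y_def fun_eq_iff scaleR_diff_left sum_subtractf)
      then have "?p (y t - y r) \<le> g (t, r)"
        using vH1_norm_sum[OF opn bnd F, of "\<lambda>v. v" "\<lambda>v. \<phi> v t - \<phi> v r"] by (simp add: g_def)
      also have "\<dots> < \<kappa>"
        using \<delta>(2)[rule_format, of "(r, r)" "(t, r)"] that by (simp add: dist_Pair_Pair dist_real_def g_def)
      finally show ?thesis .
    qed
    with \<delta>(1) show "\<exists>\<delta>>0. \<forall>r\<in>{0..T}. \<forall>t\<in>{0..T}. \<bar>t - r\<bar> < \<delta> \<longrightarrow> ?p (y t - y r) < \<kappa>"
      by blast
  qed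
qed

end

section \<open>The energy of weak solutions\<close>

definition energy :: "(real^'m) set \<Rightarrow> real^'n^'n \<Rightarrow> (real^'m \<Rightarrow> real^'n) \<Rightarrow> real" where
  "energy \<Omega> P u = L2_inner \<Omega> u (\<lambda>x. P *v u x)"

text \<open>Expansion of the quadratic form around v. With u = z (t - h) and v = z t the first term
  is nonnegative for positive P, and dropping it leaves the one-sided substitute for the derivative
  of the energy.\<close>

lemma energy_diff:
  fixes P :: "real^'n^'n"
  assumes "transpose P = P" "u \<in> L2 \<Omega>" "v \<in> L2 \<Omega>"
  shows "energy \<Omega> P u - energy \<Omega> P v
    = energy \<Omega> P (u - v) + 2 * L2_inner \<Omega> (u - v) (\<lambda>x. P *v v x)"
proof -
  have sym: "L2_inner \<Omega> a (\<lambda>x. P *v b x) = L2_inner \<Omega> b (\<lambda>x. P *v a x)" for a b :: "real^'a \<Rightarrow> real^'n"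
    unfolding L2_inner_def
    by (rule Bochner_Integration.integral_cong[OF refl], subst inner_symmetric_matrix[OF assms(1)])
      (rule inner_commute)
  have L2: "(\<lambda>x. P *v w x) \<in> L2 \<Omega>" if "w \<in> L2 \<Omega>" for w :: "real^'a \<Rightarrow> real^'n"
    using that by (rule L2_matrix_mult)
  have uv: "(\<lambda>x. u x - v x) \<in> L2 \<Omega>"
    using assms by (intro L2_diff)
  have "energy \<Omega> P (u - v) = L2_inner \<Omega> (\<lambda>x. u x - v x) (\<lambda>x. P *v u x - P *v v x)"
    by (simp add: energy_def matrix_vector_mult_diff_distrib fun_diff_def)
  also have "\<dots> = L2_inner \<Omega> (\<lambda>x. u x - v x) (\<lambda>x. P *v u x) - L2_inner \<Omega> (\<lambda>x. u x - v x) (\<lambda>x. P *v v x)"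
    by (intro L2_inner_diff_right L2 uv assms)
  also have "\<dots> = L2_inner \<Omega> u (\<lambda>x. P *v u x) - L2_inner \<Omega> v (\<lambda>x. P *v u x)
      - L2_inner \<Omega> (\<lambda>x. u x - v x) (\<lambda>x. P *v v x)"
    using L2_inner_diff_left[OF assms(2,3) L2[OF assms(2)]] by simp
  finally show ?thesis
    using L2_inner_diff_left[OF assms(2,3) L2[OF assms(3)]] sym[of v u]
    by (simp add: energy_def fun_diff_def)
qed

lemma energy_bounds:
  fixes P :: "real^'n^'n" and \<Omega> :: "(real^'m) set"
  assumes "pos_def P"
  obtains a b where "a > 0" "b > 0"
    "\<And>u. u \<in> L2 \<Omega> \<Longrightarrow> a * (L2_norm \<Omega> u)\<^sup>2 \<le> energy \<Omega> P u"
    "\<And>u. u \<in> L2 \<Omega> \<Longrightarrow> energy \<Omega> P u \<le> b * (L2_norm \<Omega> u)\<^sup>2"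
proof -
  obtain a where a: "a > 0" "\<And>x. a * (norm x)\<^sup>2 \<le> x \<bullet> (P *v x)"
    using pos_def_coercive[OF assms] by blast
  \<comment> \<open>The added 1 makes b positive, as it later becomes a divisor.\<close>
  define b where "b = onorm ((*v) P) + 1"
  have b: "b > 0"
    unfolding b_def using onorm_pos_le[OF matrix_vector_mul_bounded_linear, of P] by simp
  have bP: "x \<bullet> (P *v x) \<le> b * (norm x)\<^sup>2" for x
    using quadratic_form_bound[of x P] by (simp add: b_def distrib_right add_increasing2)
  have *: "a * (L2_norm \<Omega> u)\<^sup>2 \<le> energy \<Omega> P u" "energy \<Omega> P u \<le> b * (L2_norm \<Omega> u)\<^sup>2"
    if u: "u \<in> L2 \<Omega>" for u
  proof -
    note int = integrable_inner[OF u L2_matrix_mult[OF u, of P]] L2_integrable[OF u]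
    have "(LINT x|lebesgue_on \<Omega>. a * (norm (u x))\<^sup>2) \<le> energy \<Omega> P u"
      unfolding energy_def L2_inner_def using int by (intro integral_mono a(2)) auto
    then show "a * (L2_norm \<Omega> u)\<^sup>2 \<le> energy \<Omega> P u"
      by (simp add: L2_norm_power2)
    have "energy \<Omega> P u \<le> (LINT x|lebesgue_on \<Omega>. b * (norm (u x))\<^sup>2)"
      unfolding energy_def L2_inner_def using int by (intro integral_mono bP) auto
    then show "energy \<Omega> P u \<le> b * (L2_norm \<Omega> u)\<^sup>2"
      by (simp add: L2_norm_power2)
  qed
  show thesis
    by (rule that[OF a(1) b]) (rule *, assumption)+
qed

context
  fixes \<Omega> :: "(real^'m) set" and A :: "real^'n^'n" and B :: "real^'m \<Rightarrow> real^'n^'n"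
    and T :: real and z0 :: "real^'m \<Rightarrow> real^'n" and z :: "real \<Rightarrow> real^'m \<Rightarrow> real^'n"
  assumes opn: "open \<Omega>" and bnd: "bounded \<Omega>" and Linf: "B \<in> Linf_matrix \<Omega>"
    and sol: "weak_solution \<Omega> A B T z0 z"
begin

section \<open>Weak solutions: continuity, increments and decay\<close>

lemma solution_Bochner: "z \<in> Bochner_L2 T (vH10 \<Omega>) (vH1_norm \<Omega>)"
  and solution_in_L2: "t \<in> {0..T} \<Longrightarrow> z t \<in> L2 \<Omega>"
  and solution_continuous: "t \<in> {0..T} \<Longrightarrow> ((\<lambda>s. L2_norm \<Omega> (z s - z t)) \<longlongrightarrow> 0) (at t within {0..T})"
  using sol by (auto simp: weak_solution_def)

lemma solution_in_vH10: "AE t in lebesgue_on {0<..<T}. z t \<in> vH10 \<Omega>"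
  using solution_Bochner by (auto simp: Bochner_L2_def strongly_measurable_def elim: eventually_mono)

lemma solution_inner_continuous:
  assumes "v \<in> L2 \<Omega>"
  shows "continuous_on {0..T} (\<lambda>t. L2_inner \<Omega> (z t) v)"
  unfolding continuous_on_def
proof
  fix t assume t: "t \<in> {0..T}"
  have "((\<lambda>s. L2_inner \<Omega> (z s) v - L2_inner \<Omega> (z t) v) \<longlongrightarrow> 0) (at t within {0..T})"
  proof (rule Lim_null_comparison)
    show "((\<lambda>s. L2_norm \<Omega> (z s - z t) * L2_norm \<Omega> v) \<longlongrightarrow> 0) (at t within {0..T})"
      using tendsto_mult_right[OF solution_continuous[OF t], of "L2_norm \<Omega> v"] by simp
    show "eventually (\<lambda>s. norm (L2_inner \<Omega> (z s) v - L2_inner \<Omega> (z t) v)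
        \<le> L2_norm \<Omega> (z s - z t) * L2_norm \<Omega> v) (at t within {0..T})"
      unfolding eventually_at_filter
    proof (intro always_eventually allI impI)
      fix s assume "s \<in> {0..T}"
      then have L: "z s \<in> L2 \<Omega>" "z t \<in> L2 \<Omega>"
        using t by (auto intro: solution_in_L2)
      have "norm (L2_inner \<Omega> (\<lambda>x. z s x - z t x) v) \<le> L2_norm \<Omega> (\<lambda>x. z s x - z t x) * L2_norm \<Omega> v"
        using L2_Cauchy_Schwarz[OF L2_diff[OF L] assms] by simp
      then show "norm (L2_inner \<Omega> (z s) v - L2_inner \<Omega> (z t) v) \<le> L2_norm \<Omega> (z s - z t) * L2_norm \<Omega> v"
        using L2_inner_diff_left[OF L assms] by (simp add: fun_diff_def)
    qed
  qed
  then show "((\<lambda>t. L2_inner \<Omega> (z t) v) \<longlongrightarrow> L2_inner \<Omega> (z t) v) (at t within {0..T})"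
    by (simp add: LIM_zero_iff)
qed

lemma solution_energy_continuous:
  assumes "pos_def P"
  shows "continuous_on {0..T} (\<lambda>t. energy \<Omega> P (z t))"
  unfolding continuous_on_def
proof
  fix t assume t: "t \<in> {0..T}"
  have sym: "transpose P = P"
    using assms by (simp add: pos_def_def)
  obtain a b where ab: "a > 0" "b > 0"
    "\<And>u. u \<in> L2 \<Omega> \<Longrightarrow> a * (L2_norm \<Omega> u)\<^sup>2 \<le> energy \<Omega> P u"
    "\<And>u. u \<in> L2 \<Omega> \<Longrightarrow> energy \<Omega> P u \<le> b * (L2_norm \<Omega> u)\<^sup>2"
    using energy_bounds[OF assms, of \<Omega>] by blast
  let ?d = "\<lambda>s. L2_norm \<Omega> (z s - z t)" and ?n = "L2_norm \<Omega> (\<lambda>x. P *v z t x)"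
  have "((\<lambda>s. energy \<Omega> P (z s) - energy \<Omega> P (z t)) \<longlongrightarrow> 0) (at t within {0..T})"
  proof (rule Lim_null_comparison)
    have "((\<lambda>s. b * (?d s)\<^sup>2 + 2 * (?d s * ?n)) \<longlongrightarrow> b * 0\<^sup>2 + 2 * (0 * ?n)) (at t within {0..T})"
      by (intro tendsto_intros solution_continuous t)
    then show "((\<lambda>s. b * (?d s)\<^sup>2 + 2 * (?d s * ?n)) \<longlongrightarrow> 0) (at t within {0..T})"
      by simp
    show "eventually (\<lambda>s. norm (energy \<Omega> P (z s) - energy \<Omega> P (z t)) \<le> b * (?d s)\<^sup>2 + 2 * (?d s * ?n)) (at t within {0..T})"
      unfolding eventually_at_filter
    proof (intro always_eventually allI impI)
      fix s assume "s \<in> {0..T}"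
      then have L: "z s \<in> L2 \<Omega>" "z t \<in> L2 \<Omega>"
        using t by (auto intro: solution_in_L2)
      have d: "z s - z t \<in> L2 \<Omega>"
        using L2_diff[OF L] by (simp add: fun_diff_def)
      have "0 \<le> energy \<Omega> P (z s - z t)"
        using order.trans[OF _ ab(3)[OF d], of 0] ab(1) by simp
      then show "norm (energy \<Omega> P (z s) - energy \<Omega> P (z t)) \<le> b * (?d s)\<^sup>2 + 2 * (?d s * ?n)"
        using energy_diff[OF sym L] ab(4)[OF d] L2_Cauchy_Schwarz[OF d L2_matrix_mult[OF L(2), of P]]
        by (simp add: abs_le_iff)
    qed
  qed
  then show "((\<lambda>t. energy \<Omega> P (z t)) \<longlongrightarrow> energy \<Omega> P (z t)) (at t within {0..T})"
    by (simp add: LIM_zero_iff)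
qed

text \<open>Measurability in time comes from the simple functions approximating z, because the form
  is continuous in its first argument; its bound is linear in the norm of \<open>z t\<close>, which
  is square integrable on a bounded interval.\<close>

lemma solution_bilinear_form_integrable:
  assumes v: "v \<in> vH10 \<Omega>"
  shows "integrable (lebesgue_on {0<..<T}) (\<lambda>t. bilinear_form \<Omega> A B (z t) v)"
proof -
  let ?M = "lebesgue_on {0<..<T}" and ?p = "vH1_norm \<Omega>"
  interpret finite_measure ?M
    by (intro finite_measure_lebesgue_on) auto
  obtain K where K: "K \<ge> 0" "\<And>u v. u \<in> vH10 \<Omega> \<Longrightarrow> v \<in> vH10 \<Omega> \<Longrightarrow>
      \<bar>bilinear_form \<Omega> A B u v\<bar> \<le> K * ?p u * ?p v"
    using bilinear_form_bounded[OF opn bnd Linf] by blast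
  obtain s where s: "\<And>k. simple_function ?M (s k)" "\<And>k. s k ` space ?M \<subseteq> vH10 \<Omega>"
    and lim: "AE t in ?M. z t \<in> vH10 \<Omega> \<and> (\<lambda>k. ?p (z t - s k t)) \<longlonglongrightarrow> 0"
    using solution_Bochner unfolding Bochner_L2_def strongly_measurable_def by blast
  have meas: "(\<lambda>t. bilinear_form \<Omega> A B (z t) v) \<in> borel_measurable ?M"
  proof (rule borel_measurable_AE_limit)
    show "(\<lambda>t. bilinear_form \<Omega> A B (s k t) v) \<in> borel_measurable ?M" for k
      using borel_measurable_simple_function[OF simple_function_compose[OF s(1), of "\<lambda>u. bilinear_form \<Omega> A B u v"]]
      by (simp add: comp_def)
    show "AE t in ?M. (\<lambda>k. bilinear_form \<Omega> A B (s k t) v) \<longlonglongrightarrow> bilinear_form \<Omega> A B (z t) v"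
      using lim AE_space
    proof eventually_elim
      fix t assume t: "z t \<in> vH10 \<Omega> \<and> (\<lambda>k. ?p (z t - s k t)) \<longlonglongrightarrow> 0" "t \<in> space ?M"
      then have X: "z t \<in> vH10 \<Omega>" "\<And>j. s j t \<in> vH10 \<Omega>"
        using image_subset_iff[THEN iffD1, OF s(2)] by auto
      have "(\<lambda>k. bilinear_form \<Omega> A B (z t) v - bilinear_form \<Omega> A B (s k t) v) \<longlonglongrightarrow> 0"
      proof (rule Lim_null_comparison)
        show "eventually (\<lambda>k. norm (bilinear_form \<Omega> A B (z t) v - bilinear_form \<Omega> A B (s k t) v)
            \<le> K * ?p (z t - s k t) * ?p v) sequentially"
          using K(2)[OF vH10_diff[OF opn bnd X(1,2)] v] bilinear_form_diff_left[OF opn bnd Linf X(1,2) v]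
          by simp
        have "(\<lambda>k. K * ?p (z t - s k t) * ?p v) \<longlonglongrightarrow> K * 0 * ?p v"
          using t(1) by (intro tendsto_intros) auto
        then show "(\<lambda>k. K * ?p (z t - s k t) * ?p v) \<longlonglongrightarrow> 0"
          by simp
      qed
      from tendsto_diff[OF tendsto_const[of "bilinear_form \<Omega> A B (z t) v"] this]
      show "(\<lambda>k. bilinear_form \<Omega> A B (s k t) v) \<longlonglongrightarrow> bilinear_form \<Omega> A B (z t) v"
        by simp
    qed
  qed auto
  have "integrable ?M (\<lambda>t. (?p (z t))\<^sup>2)"
    using solution_Bochner by (simp add: Bochner_L2_def)
  then have int: "integrable ?M (\<lambda>t. K * (1 + (?p (z t))\<^sup>2) * ?p v)"
    by simp
  show ?thesis
  proof (rule Bochner_Integration.integrable_bound[OF int meas])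
    show "AE t in ?M. norm (bilinear_form \<Omega> A B (z t) v) \<le> norm (K * (1 + (?p (z t))\<^sup>2) * ?p v)"
      using solution_in_vH10
    proof eventually_elim
      fix t assume "z t \<in> vH10 \<Omega>"
      then have "\<bar>bilinear_form \<Omega> A B (z t) v\<bar> \<le> K * ?p (z t) * ?p v"
        by (rule K(2)[OF _ v])
      \<comment> \<open>Integrability is known for the squared norm, so the linear bound is turned
        into a quadratic one.\<close>
      also have "?p (z t) \<le> 1 + (?p (z t))\<^sup>2"
        using zero_le_power2[of "?p (z t) - 1"] vH1_norm_nonneg[of \<Omega> "z t"]
        unfolding power2_diff by simp
      then have "K * ?p (z t) * ?p v \<le> K * (1 + (?p (z t))\<^sup>2) * ?p v"
        using K(1) by (intro mult_left_mono mult_right_mono vH1_norm_nonneg)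
      finally show "norm (bilinear_form \<Omega> A B (z t) v) \<le> norm (K * (1 + (?p (z t))\<^sup>2) * ?p v)"
        using K(1) by (simp add: abs_mult vH1_norm_nonneg)
    qed
  qed
qed

text \<open>There are no exceptional times s and t: the null set attached to v disappears under the
  time integral. Therefore v may afterwards depend on t.\<close>

lemma solution_increment:
  assumes v: "v \<in> vH10 \<Omega>" and st: "0 < s" "s < t" "t < T"
  shows "L2_inner \<Omega> (z t) v - L2_inner \<Omega> (z s) v = integral {s..t} (\<lambda>r. bilinear_form \<Omega> A B (z r) v)"
proof (rule weak_derivative_imp_integral[of T "\<lambda>t. L2_inner \<Omega> (z t) v", OF _ solution_bilinear_form_integrable[OF v] _ st])
  let ?M = "lebesgue_on {0<..<T}"
  show "continuous_on {0..T} (\<lambda>t. L2_inner \<Omega> (z t) v)"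
    by (intro solution_inner_continuous vH1_imp_L2 vH10_imp_vH1 v)
  obtain g where g: "time_derivative \<Omega> T z g" "AE t in lebesgue_on {0..T}. g t v = bilinear_form \<Omega> A B (z t) v"
    using sol v unfolding weak_solution_def bilinear_form_def by blast
  have AE: "AE t in ?M. g t v = bilinear_form \<Omega> A B (z t) v"
    by (rule AE_lebesgue_on_subset[OF g(2)]) auto
  have form: "(\<lambda>t. bilinear_form \<Omega> A B (z t) v) \<in> borel_measurable ?M"
    using solution_bilinear_form_integrable[OF v] by (rule borel_measurable_integrable)
  have gv: "(\<lambda>t. g t v) \<in> borel_measurable ?M"
    by (rule borel_measurable_lebesgue_on_AE[OF form]) (use AE in \<open>auto elim: eventually_mono\<close>)
  fix \<phi> :: "real \<Rightarrow> real" assume \<phi>: "\<phi> \<in> test_functions {0<..<T}"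
  have \<phi>meas: "\<phi> \<in> borel_measurable ?M"
    by (rule borel_measurable_lebesgue_on[OF test_functions_measurable[OF \<phi>]])
  have "(LINT t|?M. deriv \<phi> t * L2_inner \<Omega> (z t) v) = - (LINT t|?M. \<phi> t * g t v)"
    using g(1) \<phi> v unfolding time_derivative_def by blast
  also have "(LINT t|?M. \<phi> t * g t v) = (LINT t|?M. \<phi> t * bilinear_form \<Omega> A B (z t) v)"
    using AE by (intro integral_cong_AE borel_measurable_times \<phi>meas gv form) (auto elim: eventually_mono)
  finally show "(LINT t|?M. deriv \<phi> t * L2_inner \<Omega> (z t) v) = - (LINT t|?M. \<phi> t * bilinear_form \<Omega> A B (z t) v)" .
qed

text \<open>The energy is not known to be differentiable, and \<open>z t\<close> is an admissible test function only at
  the same time \<open>t\<close>. Since \<open>P\<close> is positive, testing the increment over \<open>[t - h, t]\<close> with \<open>P (z t)\<close> bounds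
  the increment of the energy from above; the error of replacing \<open>z t\<close> by \<open>z r\<close> is controlled through a
  continuous approximation \<open>y\<close> of \<open>z\<close> and disappears after averaging over \<open>t\<close>.\<close>

lemma solution_energy_decrease_approx:
  assumes P: "pos_def P" and "\<kappa> \<ge> 0" "\<theta> > 0" "\<mu> > 0"
    and dissip: "\<And>u. u \<in> vH10 \<Omega> \<Longrightarrow> 2 * bilinear_form \<Omega> A B u (\<lambda>x. P *v u x) \<le> - \<kappa> * energy \<Omega> P u"
    and K: "K \<ge> 0" "\<And>u v. u \<in> vH10 \<Omega> \<Longrightarrow> v \<in> vH10 \<Omega> \<Longrightarrow>
      \<bar>bilinear_form \<Omega> A B u (\<lambda>x. P *v v x)\<bar> \<le> K * vH1_norm \<Omega> u * vH1_norm \<Omega> v"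
    and st: "0 < s" "s \<le> t" "t < T"
  shows "energy \<Omega> P (z t) - energy \<Omega> P (z s)
    \<le> - \<kappa> * integral {s..t} (\<lambda>r. energy \<Omega> P (z r))
      + \<theta> * (LINT r|lebesgue_on {0<..<T}. (vH1_norm \<Omega> (z r))\<^sup>2) + 3 * K\<^sup>2 / \<theta> * (\<mu> * T + 2 * \<mu>)"
proof -
  let ?M = "lebesgue_on {0<..<T}" and ?p = "vH1_norm \<Omega>"
  have sym: "transpose P = P"
    using P by (simp add: pos_def_def)
  define V where "V r = energy \<Omega> P (z r)" for r
  have V: "continuous_on {0..T} V"
    unfolding V_def by (rule solution_energy_continuous[OF P])
  \<comment> \<open>The 3 comes from the square of a sum of three distances, the factor
    \<open>K\<^sup>2 / \<theta>\<close> from Young's inequality.\<close>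
  define D where "D = 3 * K\<^sup>2 / \<theta>"
  have D: "D \<ge> 0"
    using \<open>\<theta> > 0\<close> by (simp add: D_def)
  obtain y e where e: "integrable ?M e" "\<And>t. e t \<ge> 0" "(LINT t|?M. e t) < \<mu>"
    and ze: "AE t in ?M. (?p (z t - y t))\<^sup>2 \<le> e t" and y: "\<And>t. y t \<in> vH10 \<Omega>"
    and modulus: "\<And>\<kappa>. \<kappa> > 0 \<Longrightarrow> \<exists>\<delta>>0. \<forall>r\<in>{0..T}. \<forall>t\<in>{0..T}. \<bar>t - r\<bar> < \<delta> \<longrightarrow> ?p (y t - y r) < \<kappa>"
  proof (rule Bochner_L2_continuous_approximation[OF opn bnd solution_Bochner \<open>\<mu> > 0\<close>])
    fix y e
    assume "integrable ?M e" "\<And>t. e t \<ge> 0" "(LINT t|?M. e t) < \<mu>"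
      "AE t in ?M. (?p (z t - y t))\<^sup>2 \<le> e t" "\<And>t. y t \<in> vH10 \<Omega>"
      "\<And>\<kappa>. \<kappa> > 0 \<Longrightarrow> \<exists>\<delta>>0. \<forall>r\<in>{0..T}. \<forall>t\<in>{0..T}. \<bar>t - r\<bar> < \<delta> \<longrightarrow> ?p (y t - y r) < \<kappa>"
    then show thesis
      by (rule that)
  qed
  \<comment> \<open>The square root is taken because this distance will enter squared and then
    contribute \<mu>.\<close>
  obtain \<delta> where \<delta>: "\<delta> > 0"
    "\<forall>r\<in>{0..T}. \<forall>t\<in>{0..T}. \<bar>t - r\<bar> < \<delta> \<longrightarrow> ?p (y t - y r) < sqrt \<mu>"
    using modulus[of "sqrt \<mu>"] \<open>\<mu> > 0\<close> by auto
  have p2: "integrable ?M (\<lambda>r. (?p (z r))\<^sup>2)"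
    using solution_Bochner by (simp add: Bochner_L2_def)
  interpret finite_measure ?M
    by (intro finite_measure_lebesgue_on) auto
  \<comment> \<open>These are the terms of the bound that do not involve the endpoint t. The
    remaining term \<open>D * e t\<close> is constant in r and only integrable in t, which is why
    averaging over t is needed.\<close>
  define G where "G r = - \<kappa> * V r + (\<theta> * (?p (z r))\<^sup>2 + (D * \<mu> + D * e r))" for r
  have Vint: "integrable ?M V"
    using V by (rule continuous_imp_integrable_Ioo)
  have G: "integrable ?M G"
    unfolding G_def using Vint p2 e(1) by simp
  \<comment> \<open>Subtracting a primitive of G from V leaves a function whose increments are at
    most \<open>h * (D * e t)\<close>, the shape that \<open>averaged_increment_bound\<close>
    requires.\<close>
  define \<Gamma> where "\<Gamma> r = integral {0..r} G" for r
  have \<Gamma>: "continuous_on {0..T} \<Gamma>"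
    unfolding \<Gamma>_def by (rule indefinite_integral_continuous_1[OF integrable_lebesgue_on_Ioo[OF G]])
  have \<Gamma>diff: "\<Gamma> b - \<Gamma> a = integral {a..b} G" if "0 \<le> a" "a \<le> b" "b \<le> T" for a b
  proof -
    have "G integrable_on {0..b}"
      using that by (intro integrable_subinterval_real[OF integrable_lebesgue_on_Ioo[OF G]]) auto
    from Henstock_Kurzweil_Integration.integral_combine[OF that(1,2) this] show ?thesis
      by (simp add: \<Gamma>_def)
  qed
  have good: "AE t in ?M. z t \<in> vH10 \<Omega> \<and> (?p (z t - y t))\<^sup>2 \<le> e t"
    using solution_in_vH10 ze by eventually_elim simp
  have incr: "AE t in lebesgue_on {h<..<T}. (V t - \<Gamma> t) - (V (t - h) - \<Gamma> (t - h)) \<le> h * (D * e t)"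
    if h: "0 < h" "h < \<delta>" for h
  proof -
    have "AE t in lebesgue_on {h<..<T}. z t \<in> vH10 \<Omega> \<and> (?p (z t - y t))\<^sup>2 \<le> e t"
      using h by (intro AE_lebesgue_on_subset[OF good]) auto
    then show ?thesis
      using AE_space
    proof eventually_elim
      fix t assume t: "z t \<in> vH10 \<Omega> \<and> (?p (z t - y t))\<^sup>2 \<le> e t" "t \<in> space (lebesgue_on {h<..<T})"
      then have ht: "0 < t - h" "t - h < t" "t < T"
        using h by auto
      have zt: "z t \<in> vH10 \<Omega>"
        using t by simp
      have L: "z (t - h) \<in> L2 \<Omega>" "z t \<in> L2 \<Omega>"
        using ht h by (auto intro: solution_in_L2)
      have Pzt: "(\<lambda>x. P *v z t x) \<in> vH10 \<Omega>"
        by (rule vH10_matrix_mult[OF opn bnd zt])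
      let ?q = "\<lambda>r. bilinear_form \<Omega> A B (z r) (\<lambda>x. P *v z t x)"
      have subint: "integrable (lebesgue_on {t - h<..<t}) f" if "integrable ?M f" for f :: "real \<Rightarrow> real"
        using ht h by (intro integrable_lebesgue_on_subset[OF that]) auto
      have "energy \<Omega> P (z (t - h) - z t) \<ge> 0"
      proof -
        have "z (t - h) - z t \<in> L2 \<Omega>"
          using L2_diff[OF L] by (simp add: fun_diff_def)
        then have "0 \<le> (LINT x|lebesgue_on \<Omega>. (z (t - h) - z t) x \<bullet> (P *v (z (t - h) - z t) x))"
          using P by (intro integral_nonneg_AE AE_I2) (metis inner_zero_left less_imp_le order_refl pos_def_def)
        then show ?thesis
          by (simp add: energy_def L2_inner_def)
      qed
      then have "V t - V (t - h) \<le> - 2 * L2_inner \<Omega> (z (t - h) - z t) (\<lambda>x. P *v z t x)"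
        using energy_diff[OF sym L] by (simp add: V_def)
      also have "\<dots> = 2 * (L2_inner \<Omega> (z t) (\<lambda>x. P *v z t x) - L2_inner \<Omega> (z (t - h)) (\<lambda>x. P *v z t x))"
        using L2_inner_diff_left[OF L L2_matrix_mult[OF L(2), of P]] by (simp add: fun_diff_def)
      \<comment> \<open>The test function depends on the final time t but not on the integration
        time r, so the increment formula applies with it held fixed.\<close>
      also have "\<dots> = integral {t - h..t} (\<lambda>r. 2 * ?q r)"
        by (simp add: solution_increment[OF Pzt ht])
      also have "\<dots> \<le> integral {t - h..t} (\<lambda>r. G r + D * e t)"
      proof (rule integral_mono_AE_Icc)
        show "integrable (lebesgue_on {t - h<..<t}) (\<lambda>r. 2 * ?q r)"
          by (rule subint) (simp add: solution_bilinear_form_integrable[OF Pzt])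
        show "integrable (lebesgue_on {t - h<..<t}) (\<lambda>r. G r + D * e t)"
          by (rule subint) (use G in simp)
        have "AE r in lebesgue_on {t - h<..<t}. z r \<in> vH10 \<Omega> \<and> (?p (z r - y r))\<^sup>2 \<le> e r"
          using ht h by (intro AE_lebesgue_on_subset[OF good]) auto
        then show "AE r in lebesgue_on {t - h<..<t}. 2 * ?q r \<le> G r + D * e t"
          using AE_space
        proof eventually_elim
          fix r assume r: "z r \<in> vH10 \<Omega> \<and> (?p (z r - y r))\<^sup>2 \<le> e r" "r \<in> space (lebesgue_on {t - h<..<t})"
          then have zr: "z r \<in> vH10 \<Omega>" and rt: "r \<in> {0..T}" "t \<in> {0..T}" "\<bar>t - r\<bar> < \<delta>"
            using ht h by auto
          \<comment> \<open>Dissipation is available only when both arguments of the form belong to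
            the same time, so the test function is split into its value at r and a
            remainder.\<close>
          have "(\<lambda>x. P *v z t x) - (\<lambda>x. P *v z r x) = (\<lambda>x. P *v (z t - z r) x)"
            by (simp add: fun_eq_iff matrix_vector_mult_diff_distrib)
          then have "?q r = bilinear_form \<Omega> A B (z r) (\<lambda>x. P *v z r x)
              + bilinear_form \<Omega> A B (z r) (\<lambda>x. P *v (z t - z r) x)"
            using bilinear_form_diff_right[OF opn bnd Linf zr Pzt vH10_matrix_mult[OF opn bnd zr, of P]]
            by simp
          moreover have "bilinear_form \<Omega> A B (z r) (\<lambda>x. P *v (z t - z r) x) \<le> K * ?p (z r) * ?p (z t - z r)"
            using K(2)[OF zr vH10_diff[OF opn bnd zt zr]] by (simp add: abs_le_iff)
          moreover have "2 * bilinear_form \<Omega> A B (z r) (\<lambda>x. P *v z r x) \<le> - \<kappa> * V r"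
            using dissip[OF zr] by (simp add: V_def)
          \<comment> \<open>Young's inequality with weight \<theta>: the first term is integrable in
            time, the second contains only the distance between two times.\<close>
          moreover have "2 * (K * ?p (z r) * ?p (z t - z r)) \<le> \<theta> * (?p (z r))\<^sup>2 + K\<^sup>2 / \<theta> * (?p (z t - z r))\<^sup>2"
          proof -
            have "0 \<le> (\<theta> * ?p (z r) - K * ?p (z t - z r))\<^sup>2 / \<theta>"
              using \<open>\<theta> > 0\<close> by simp
            also have "\<dots> = \<theta> * (?p (z r))\<^sup>2 - 2 * (K * ?p (z r) * ?p (z t - z r)) + K\<^sup>2 / \<theta> * (?p (z t - z r))\<^sup>2"
              using \<open>\<theta> > 0\<close> by (simp add: power2_eq_square field_simps)
            finally show ?thesis by simp
          qed
          \<comment> \<open>The distance runs through the continuous approximation, from z t to y t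
            to y r to z r.\<close>
          moreover have "K\<^sup>2 / \<theta> * (?p (z t - z r))\<^sup>2 \<le> D * \<mu> + D * e r + D * e t"
          proof -
            let ?a = "?p (z t - y t)" and ?b = "?p (y t - y r)" and ?c = "?p (z r - y r)"
            have "?p (z t - z r) \<le> ?a + (?b + ?c)"
              using vH1_norm_diff_triangle[OF opn bnd zt y zr, of t]
                vH1_norm_diff_triangle[OF opn bnd y y zr, of t r] vH1_norm_diff_commute[OF opn bnd y zr, of r]
              by linarith
            then have "(?p (z t - z r))\<^sup>2 \<le> (?a + (?b + ?c))\<^sup>2"
              by (intro power_mono vH1_norm_nonneg)
            also have "\<dots> \<le> 3 * (?a\<^sup>2 + ?b\<^sup>2 + ?c\<^sup>2)"
              using zero_le_power2[of "?a - ?b"] zero_le_power2[of "?b - ?c"] zero_le_power2[of "?a - ?c"]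
              by (simp add: power2_eq_square algebra_simps)
            also have "\<dots> \<le> 3 * (e t + \<mu> + e r)"
            proof -
              have "?b\<^sup>2 \<le> (sqrt \<mu>)\<^sup>2"
                using \<delta>(2) rt by (intro power_mono vH1_norm_nonneg) (auto intro: less_imp_le)
              then have "?b\<^sup>2 \<le> \<mu>"
                using \<open>\<mu> > 0\<close> by simp
              moreover have "?a\<^sup>2 \<le> e t" "?c\<^sup>2 \<le> e r"
                using t r by simp_all
              ultimately show ?thesis
                by simp
            qed
            finally have "(?p (z t - z r))\<^sup>2 \<le> 3 * (e t + \<mu> + e r)" .
            then have "K\<^sup>2 / \<theta> * (?p (z t - z r))\<^sup>2 \<le> K\<^sup>2 / \<theta> * (3 * (e t + \<mu> + e r))"
              using \<open>\<theta> > 0\<close> by (intro mult_left_mono) auto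
            also have "\<dots> = D * \<mu> + D * e r + D * e t"
              by (simp add: D_def algebra_simps)
            finally show ?thesis .
          qed
          ultimately show "2 * ?q r \<le> G r + D * e t"
            by (simp add: G_def)
        qed
      qed
      also have "\<dots> = integral {t - h..t} G + integral {t - h..t} (\<lambda>r. D * e t)"
        using ht h by (intro Henstock_Kurzweil_Integration.integral_add integrable_lebesgue_on_Ioo subint G) auto
      also have "\<dots> = (\<Gamma> t - \<Gamma> (t - h)) + h * (D * e t)"
        using \<Gamma>diff[of "t - h" t] ht h by simp
      finally show "(V t - \<Gamma> t) - (V (t - h) - \<Gamma> (t - h)) \<le> h * (D * e t)"
        by simp
    qed
  qed
  have "(V t - \<Gamma> t) - (V s - \<Gamma> s) \<le> (LINT r|?M. D * e r)"
  proof (rule averaged_increment_bound[of T "\<lambda>t. V t - \<Gamma> t" "\<lambda>t. D * e t" \<delta> s t, OF _ _ _ \<delta>(1) incr st])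
    show "continuous_on {0..T} (\<lambda>t. V t - \<Gamma> t)"
      by (intro continuous_on_diff V \<Gamma>)
  qed (use e(1,2) D in simp_all)
  also have "\<dots> \<le> D * \<mu>"
    using e(3) D by (simp add: mult_left_mono)
  finally have "V t - V s \<le> integral {s..t} G + D * \<mu>"
    using \<Gamma>diff[of s t] st by simp
  \<comment> \<open>The integral of \<open>D * e r\<close> inside G costs one
    \<open>D * \<mu>\<close> and the averaged \<open>D * e t\<close> another, hence the
    \<open>2 * \<mu>\<close> in the conclusion. The nonnegative terms are integrated over all of
    [0, T].\<close>
  also have "integral {s..t} G \<le> - \<kappa> * integral {s..t} V + \<theta> * (LINT r|?M. (?p (z r))\<^sup>2) + (D * \<mu> * T + D * \<mu>)"
  proof -
    let ?H = "\<lambda>r. \<theta> * (?p (z r))\<^sup>2 + (D * \<mu> + D * e r)"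
    have H: "integrable ?M ?H"
      using p2 e(1) by simp
    have sub: "integrable (lebesgue_on {s<..<t}) f" if "integrable ?M f" for f :: "real \<Rightarrow> real"
      using st by (intro integrable_lebesgue_on_subset[OF that]) auto
    have "integral {s..t} G = integral {s..t} (\<lambda>r. - \<kappa> * V r) + integral {s..t} ?H"
      unfolding G_def using Vint
      by (intro Henstock_Kurzweil_Integration.integral_add integrable_lebesgue_on_Ioo sub H) auto
    also have "integral {s..t} ?H \<le> integral {0..T} ?H"
      using st D \<open>\<theta> > 0\<close> \<open>\<mu> > 0\<close> e(2)
      by (intro integral_subset_le integrable_lebesgue_on_Ioo sub H) auto
    also have "\<dots> = (LINT r|?M. ?H r)"
      using integral_lebesgue_on_Ioo[OF H] by simp
    also have "\<dots> = \<theta> * (LINT r|?M. (?p (z r))\<^sup>2) + (D * \<mu> * T + D * (LINT r|?M. e r))"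
      using p2 e(1) st by (simp add: measure_restrict_space mult_ac)
    also have "\<dots> \<le> \<theta> * (LINT r|?M. (?p (z r))\<^sup>2) + (D * \<mu> * T + D * \<mu>)"
      using e(3) D by (simp add: mult_left_mono)
    finally show ?thesis
      by simp
  qed
  finally have "V t - V s \<le> - \<kappa> * integral {s..t} V + \<theta> * (LINT r|?M. (?p (z r))\<^sup>2) + D * (\<mu> * T + 2 * \<mu>)"
    by (simp add: algebra_simps)
  then show ?thesis
    unfolding D_def V_def .
qed

text \<open>Each error term receives half of an arbitrary \<beta>: \<theta> is chosen against the
  finite integral I of the squared norm, then \<mu> against Q, which contains 1 / \<theta>.\<close>

lemma solution_energy_decrease:
  assumes P: "pos_def P" and "\<kappa> \<ge> 0"
    and dissip: "\<And>u. u \<in> vH10 \<Omega> \<Longrightarrow> 2 * bilinear_form \<Omega> A B u (\<lambda>x. P *v u x) \<le> - \<kappa> * energy \<Omega> P u"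
    and st: "0 < s" "s \<le> t" "t < T"
  shows "energy \<Omega> P (z t) - energy \<Omega> P (z s) \<le> - \<kappa> * integral {s..t} (\<lambda>r. energy \<Omega> P (z r))"
proof (rule field_le_epsilon)
  fix \<beta> :: real assume "\<beta> > 0"
  obtain K0 where K0: "K0 \<ge> 0" "\<And>u v. u \<in> vH10 \<Omega> \<Longrightarrow> v \<in> vH10 \<Omega> \<Longrightarrow>
      \<bar>bilinear_form \<Omega> A B u v\<bar> \<le> K0 * vH1_norm \<Omega> u * vH1_norm \<Omega> v"
    using bilinear_form_bounded[OF opn bnd Linf] by blast
  obtain KP where KP: "KP \<ge> 0" "\<And>u. u \<in> vH10 \<Omega> \<Longrightarrow> vH1_norm \<Omega> (\<lambda>x. P *v u x) \<le> KP * vH1_norm \<Omega> u"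
    using vH1_norm_matrix_mult_bound[OF opn bnd] by blast
  define K where "K = K0 * KP"
  have K: "\<bar>bilinear_form \<Omega> A B u (\<lambda>x. P *v v x)\<bar> \<le> K * vH1_norm \<Omega> u * vH1_norm \<Omega> v"
    if "u \<in> vH10 \<Omega>" "v \<in> vH10 \<Omega>" for u v
  proof -
    have "\<bar>bilinear_form \<Omega> A B u (\<lambda>x. P *v v x)\<bar> \<le> K0 * vH1_norm \<Omega> u * vH1_norm \<Omega> (\<lambda>x. P *v v x)"
      using that by (intro K0(2) vH10_matrix_mult[OF opn bnd])
    also have "\<dots> \<le> K0 * vH1_norm \<Omega> u * (KP * vH1_norm \<Omega> v)"
      using K0(1) KP(2)[OF that(2)] by (intro mult_left_mono) (auto simp: vH1_norm_nonneg)
    finally show "\<bar>bilinear_form \<Omega> A B u (\<lambda>x. P *v v x)\<bar> \<le> K * vH1_norm \<Omega> u * vH1_norm \<Omega> v"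
      by (simp add: K_def mult_ac)
  qed
  have K': "K \<ge> 0"
    using K0(1) KP(1) by (simp add: K_def)
  define I where "I = (LINT r|lebesgue_on {0<..<T}. (vH1_norm \<Omega> (z r))\<^sup>2)"
  have I: "I \<ge> 0"
    by (simp add: I_def)
  define \<theta> where "\<theta> = \<beta> / (2 * (I + 1))"
  have \<theta>: "\<theta> > 0" "\<theta> * I \<le> \<beta> / 2"
  proof -
    show "\<theta> > 0"
      using \<open>\<beta> > 0\<close> I by (simp add: \<theta>_def)
    have "\<theta> * (I + 1) = \<beta> / 2"
      using I by (simp add: \<theta>_def field_simps)
    then show "\<theta> * I \<le> \<beta> / 2"
      using \<open>\<theta> > 0\<close> by (simp add: distrib_left)
  qed
  define Q where "Q = 3 * K\<^sup>2 / \<theta> * (T + 2)"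
  have Q: "Q \<ge> 0"
    using \<theta>(1) st by (simp add: Q_def)
  define \<mu> where "\<mu> = \<beta> / (2 * (Q + 1))"
  have \<mu>: "\<mu> > 0" "Q * \<mu> \<le> \<beta> / 2"
  proof -
    show "\<mu> > 0"
      using \<open>\<beta> > 0\<close> Q by (simp add: \<mu>_def)
    have "(Q + 1) * \<mu> = \<beta> / 2"
      using Q by (simp add: \<mu>_def field_simps)
    then show "Q * \<mu> \<le> \<beta> / 2"
      using \<open>\<mu> > 0\<close> by (simp add: distrib_right)
  qed
  have "energy \<Omega> P (z t) - energy \<Omega> P (z s)
      \<le> - \<kappa> * integral {s..t} (\<lambda>r. energy \<Omega> P (z r)) + \<theta> * I + 3 * K\<^sup>2 / \<theta> * (\<mu> * T + 2 * \<mu>)"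
    unfolding I_def
    by (rule solution_energy_decrease_approx[OF P \<open>\<kappa> \<ge> 0\<close> \<theta>(1) \<mu>(1) dissip K' K st])
  also have "3 * K\<^sup>2 / \<theta> * (\<mu> * T + 2 * \<mu>) = Q * \<mu>"
    by (simp add: Q_def algebra_simps)
  finally show "energy \<Omega> P (z t) - energy \<Omega> P (z s)
      \<le> - \<kappa> * integral {s..t} (\<lambda>r. energy \<Omega> P (z r)) + \<beta>"
    using \<theta>(2) \<mu>(2) by linarith
qed

lemma solution_energy_exponential_decay:
  assumes P: "pos_def P" and "\<kappa> > 0"
    and dissip: "\<And>u. u \<in> vH10 \<Omega> \<Longrightarrow> 2 * bilinear_form \<Omega> A B u (\<lambda>x. P *v u x) \<le> - \<kappa> * energy \<Omega> P u"
    and t: "t \<in> {0..T}"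
  shows "energy \<Omega> P (z t) \<le> exp (- \<kappa> * t) * energy \<Omega> P (z 0)"
proof (rule integral_inequality_imp_exponential_decay[OF solution_energy_continuous[OF P] _ \<open>\<kappa> > 0\<close> _ t])
  fix t assume "t \<in> {0..T}"
  have "0 \<le> z t x \<bullet> (P *v z t x)" for x
    using P by (cases "z t x = 0") (auto simp: pos_def_def less_imp_le)
  then show "0 \<le> energy \<Omega> P (z t)"
    by (simp add: energy_def L2_inner_def)
next
  fix s t assume "0 < s" "s \<le> t" "t < T"
  then show "energy \<Omega> P (z t) - energy \<Omega> P (z s) \<le> - \<kappa> * integral {s..t} (\<lambda>r. energy \<Omega> P (z r))"
    using \<open>\<kappa> > 0\<close> by (intro solution_energy_decrease[OF P _ dissip]) auto
qed

end

theorem mainTheorem1: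
  fixes \<Omega> :: "(real^'m) set"
    and A :: "real^'n^'n"
    and B :: "real^'m \<Rightarrow> real^'n^'n"
    and N :: nat
    and \<Omega>k :: "nat \<Rightarrow> (real^'m) set"
    and Bk :: "nat \<Rightarrow> real^'n^'n"
    and \<rho> :: "nat \<Rightarrow> real"
    and c :: real
  assumes "open \<Omega>" and "bounded \<Omega>"
    and "B \<in> Linf_matrix \<Omega>"
    and "\<exists>\<alpha>>0. \<forall>\<zeta>. \<zeta> \<bullet> (A *v \<zeta>) \<ge> \<alpha> * (norm \<zeta>)\<^sup>2"
    and "N \<ge> 1"
    and "disjoint_family_on \<Omega>k {1..N}"
    and "\<forall>k\<in>{1..N}. \<Omega>k k \<in> sets lebesgue"
    and "\<Omega> = (\<Union>k\<in>{1..N}. \<Omega>k k)"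
    and "\<forall>k\<in>{1..N}. \<rho> k > 0"
    and "\<forall>k\<in>{1..N}. AE x in lebesgue_on (\<Omega>k k). matrix_norm (B x - Bk k) \<le> \<rho> k"
    and "c > 0"
    and "\<forall>f\<in>H10 \<Omega>. L2_norm \<Omega> f \<le> c * L2_norm \<Omega> (grad \<Omega> f)"
    and "\<exists>(P :: real^'n^'n) (\<Lambda> :: real^'n^'n) (\<sigma> :: nat \<Rightarrow> real).
           pos_def P \<and> pos_def \<Lambda> \<and> diagonal_matrix \<Lambda> \<and> (\<forall>k\<in>{1..N}. \<sigma> k > 0) \<and>
           (\<forall>k\<in>{1..N}. pos_def (block_matrix
              (\<Lambda> - \<sigma> k *\<^sub>R mat 1 - transpose (Bk k) ** P - P ** Bk k) (\<rho> k *\<^sub>R P)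
              (\<rho> k *\<^sub>R P)                                              (\<sigma> k *\<^sub>R mat 1))) \<and>
           pos_semidef (transpose A ** P + P ** A - c\<^sup>2 *\<^sub>R \<Lambda>)"
  shows "exponentially_stable \<Omega> A B"
proof -
  obtain P \<Lambda> :: "real^'n^'n" and \<sigma> :: "nat \<Rightarrow> real" where P: "pos_def P"
    and \<Lambda>: "pos_def \<Lambda>" "diagonal_matrix \<Lambda>" and \<sigma>: "\<forall>k\<in>{1..N}. \<sigma> k > 0"
    and block: "\<forall>k\<in>{1..N}. pos_def (block_matrix
              (\<Lambda> - \<sigma> k *\<^sub>R mat 1 - transpose (Bk k) ** P - P ** Bk k) (\<rho> k *\<^sub>R P)
              (\<rho> k *\<^sub>R P) (\<sigma> k *\<^sub>R mat 1))"
    and semidef: "pos_semidef (transpose A ** P + P ** A - c\<^sup>2 *\<^sub>R \<Lambda>)"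
    using assms(13) by blast
  obtain \<epsilon> where \<epsilon>: "\<epsilon> > 0" "\<And>u. u \<in> vH10 \<Omega> \<Longrightarrow>
      2 * bilinear_form \<Omega> A B u (\<lambda>x. P *v u x) \<le> - \<epsilon> * (L2_norm \<Omega> u)\<^sup>2"
    using bilinear_form_dissipative[OF assms(1-3,7-12) P \<Lambda> \<sigma> block semidef] by blast
  obtain a b where ab: "a > 0" "b > 0"
    "\<And>u. u \<in> L2 \<Omega> \<Longrightarrow> a * (L2_norm \<Omega> u)\<^sup>2 \<le> energy \<Omega> P u"
    "\<And>u. u \<in> L2 \<Omega> \<Longrightarrow> energy \<Omega> P u \<le> b * (L2_norm \<Omega> u)\<^sup>2"
    using energy_bounds[OF P, of \<Omega>] by blast
  \<comment> \<open>Turns dissipation measured by the squared \<open>L2_norm\<close> into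
    dissipation measured by the energy, which is at most b times that square.\<close>
  define \<kappa> where "\<kappa> = \<epsilon> / b"
  have \<kappa>: "\<kappa> > 0"
    using \<epsilon>(1) ab(2) by (simp add: \<kappa>_def)
  have dissip: "2 * bilinear_form \<Omega> A B u (\<lambda>x. P *v u x) \<le> - \<kappa> * energy \<Omega> P u" if "u \<in> vH10 \<Omega>" for u
  proof -
    have "\<kappa> * energy \<Omega> P u \<le> \<kappa> * (b * (L2_norm \<Omega> u)\<^sup>2)"
      using \<kappa> that by (intro mult_left_mono ab(4) vH1_imp_L2 vH10_imp_vH1) auto
    also have "\<dots> = \<epsilon> * (L2_norm \<Omega> u)\<^sup>2"
      using ab(2) by (simp add: \<kappa>_def)
    finally show ?thesis
      using \<epsilon>(2)[OF that] by simp
  qed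
  \<comment> \<open>The square root of the ratio of the two energy bounds; the maximum with 1 meets
    the requirement M \<ge> 1.\<close>
  define M where "M = max 1 (sqrt (b / a))"
  have "L2_norm \<Omega> (z t) \<le> M * exp (- (\<kappa> / 2) * t) * L2_norm \<Omega> z0"
    if z0: "z0 \<in> L2 \<Omega>" and sol: "weak_solution \<Omega> A B T z0 z" and "T > 0" and t: "t \<in> {0..T}"
    for T z0 z t
  proof -
    note L2 = solution_in_L2[OF assms(1-3) sol]
    have zero: "0 \<in> {0..T}"
      using \<open>T > 0\<close> by simp
    \<comment> \<open>The initial values agree only almost everywhere, which suffices for their
      norms.\<close>
    have init: "L2_norm \<Omega> (z 0) = L2_norm \<Omega> z0"
      using sol by (intro L2_norm_cong L2[OF zero] z0) (simp add: weak_solution_def)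
    have "a * (L2_norm \<Omega> (z t))\<^sup>2 \<le> exp (- \<kappa> * t) * energy \<Omega> P (z 0)"
      using ab(3)[OF L2[OF t]] solution_energy_exponential_decay[OF assms(1-3) sol P \<kappa> dissip t]
      by linarith
    also have "\<dots> \<le> exp (- \<kappa> * t) * (b * (L2_norm \<Omega> z0)\<^sup>2)"
      using ab(4)[OF L2[OF zero]] by (simp add: init)
    finally have "(L2_norm \<Omega> (z t))\<^sup>2 \<le> b / a * exp (- \<kappa> * t) * (L2_norm \<Omega> z0)\<^sup>2"
      using ab(1) by (simp add: field_simps)
    also have "\<dots> = (sqrt (b / a) * exp (- (\<kappa> / 2) * t) * L2_norm \<Omega> z0)\<^sup>2"
      using ab(1,2) by (simp add: power_mult_distrib exp_double[symmetric])
    also have "\<dots> \<le> (M * exp (- (\<kappa> / 2) * t) * L2_norm \<Omega> z0)\<^sup>2"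
      using ab(1,2) by (intro power_mono mult_right_mono) (auto simp: M_def L2_norm_nonneg)
    finally show ?thesis
      by (rule power2_le_imp_le) (auto simp: M_def L2_norm_nonneg)
  qed
  then show ?thesis
    unfolding exponentially_stable_def using \<kappa>
    by (intro exI[of _ M] conjI exI[of _ "\<kappa> / 2"]) (auto simp: M_def)
qed

end
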